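(* Let $\alpha,\beta$ be integers different from $1$ with $v_2(\alpha-1)=v_2(\beta-1)=m\ge 3$, and let $\ell=v_2(\alpha-\beta)$ satisfy $m<\ell\le 2m-3$ and $2\ell+2>3m+1$. Then $|G_2|=2^{5m+\ell-1}$, the nilpotency class of $G_2$ is $5$, $o(a)=o(b)=2^{\ell+m+1}$ and $o(c)=2^{2m}$.
   Context: $G(\alpha,\beta)=\langle A,B\mid A^{[A,B]}=A^{\alpha},\ B^{[B,A]}=B^{\beta}\rangle$ with $[x,y]=x^{-1}y^{-1}xy$, $y^x=x^{-1}yx$, and $C=[A,B]$. The group $G(\alpha,\beta)$ is finite and nilpotent, hence the direct product of its Sylow subgroups; $G_2$ denotes its Sylow $2$-subgroup and $a,b,c$ denote the images of $A,B,C$ under the canonical projection $G(\alpha,\beta)\to G_2$. $v_2$ is the $2$-adic valuation and $o(x)$ the order of $x$. *)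

theory Defs
  imports "HOL-Algebra.Algebra" "HOL-Computational_Algebra.Primes"
begin

text \<open>A letter is (g, e): generator g (False = A, True = B), e = True meaning inverse.\<close>
type_synonym letter = "bool \<times> bool"
type_synonym word = "letter list"

definition letter_inv :: "letter \<Rightarrow> letter" where
  "letter_inv l = (fst l, \<not> snd l)"

definition word_inv :: "word \<Rightarrow> word" where
  "word_inv w = rev (map letter_inv w)"

definition word_pow :: "word \<Rightarrow> int \<Rightarrow> word" where
  "word_pow w n = (if 0 \<le> n then concat (replicate (nat n) w)
                   else concat (replicate (nat (- n)) (word_inv w)))"

inductive pres_eq :: "word set \<Rightarrow> word \<Rightarrow> word \<Rightarrow> bool" for R where
  refl: "pres_eq R w w"
| sym: "pres_eq R u v \<Longrightarrow> pres_eq R v u"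
| trans: "pres_eq R u v \<Longrightarrow> pres_eq R v w \<Longrightarrow> pres_eq R u w"
| cancel: "pres_eq R (u @ [x, letter_inv x] @ v) (u @ v)"
| relator: "r \<in> R \<Longrightarrow> pres_eq R (u @ r @ v) (u @ v)"

definition pres_class :: "word set \<Rightarrow> word \<Rightarrow> word set" where
  "pres_class R w = {v. pres_eq R w v}"

definition pres_mult :: "word set \<Rightarrow> word set \<Rightarrow> word set \<Rightarrow> word set" where
  "pres_mult R S T = pres_class R (append (SOME u. u \<in> S) (SOME v. v \<in> T))"

definition presented_group :: "word set \<Rightarrow> word set monoid" where
  "presented_group R =
     \<lparr> carrier = range (pres_class R), monoid.mult = pres_mult R, monoid.one = pres_class R [] \<rparr>"

definition wA :: word where "wA = [(False, False)]"
definition wB :: word where "wB = [(True, False)]"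
definition wC :: word where "wC = word_inv wA @ (word_inv wB @ (wA @ wB))"

text \<open>Relators: A^[A,B] (A^alpha)^-1 = C^-1 A C A^-alpha, and
  B^[B,A] (B^beta)^-1 = C B C^-1 B^-beta (since [B,A] = C^-1).\<close>
definition G_relators :: "int \<Rightarrow> int \<Rightarrow> word set" where
  "G_relators \<alpha> \<beta> =
     { word_inv wC @ wA @ wC @ word_pow wA (- \<alpha>),
       wC @ wB @ word_inv wC @ word_pow wB (- \<beta>) }"

definition Grp :: "int \<Rightarrow> int \<Rightarrow> word set monoid" where
  "Grp \<alpha> \<beta> = presented_group (G_relators \<alpha> \<beta>)"

definition genA :: "int \<Rightarrow> int \<Rightarrow> word set" where
  "genA \<alpha> \<beta> = pres_class (G_relators \<alpha> \<beta>) wA"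
definition genB :: "int \<Rightarrow> int \<Rightarrow> word set" where
  "genB \<alpha> \<beta> = pres_class (G_relators \<alpha> \<beta>) wB"
definition genC :: "int \<Rightarrow> int \<Rightarrow> word set" where
  "genC \<alpha> \<beta> = pres_class (G_relators \<alpha> \<beta>) wC"

text \<open>In a finite nilpotent group the Sylow 2-subgroup is the set of 2-elements.\<close>
definition sylow2_set :: "('a, 'b) monoid_scheme \<Rightarrow> 'a set" where
  "sylow2_set G = {x \<in> carrier G. \<exists>k::nat. group.ord G x = 2 ^ k}"

definition odd_part_set :: "('a, 'b) monoid_scheme \<Rightarrow> 'a set" where
  "odd_part_set G = {y \<in> carrier G. odd (group.ord G y)}"

text \<open>Canonical projection G = G_2 \<times> G_2' \<rightarrow> G_2: the G_2-component of g.\<close>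
definition proj2 :: "('a, 'b) monoid_scheme \<Rightarrow> 'a \<Rightarrow> 'a" where
  "proj2 G g = (THE x. x \<in> sylow2_set G \<and> (\<exists>y \<in> odd_part_set G. g = x \<otimes>\<^bsub>G\<^esub> y))"

definition comm :: "('a, 'b) monoid_scheme \<Rightarrow> 'a \<Rightarrow> 'a \<Rightarrow> 'a" where
  "comm G x y = inv\<^bsub>G\<^esub> x \<otimes>\<^bsub>G\<^esub> inv\<^bsub>G\<^esub> y \<otimes>\<^bsub>G\<^esub> x \<otimes>\<^bsub>G\<^esub> y"

text \<open>lower_central G n is gamma_(n+1)(G).\<close>
fun lower_central :: "('a, 'b) monoid_scheme \<Rightarrow> nat \<Rightarrow> 'a set" where
  "lower_central G 0 = carrier G"
| "lower_central G (Suc n) =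
     generate G {comm G x y | x y. x \<in> lower_central G n \<and> y \<in> carrier G}"

definition has_nilpotency_class :: "('a, 'b) monoid_scheme \<Rightarrow> nat \<Rightarrow> bool" where
  "has_nilpotency_class G c \<longleftrightarrow>
     lower_central G c = {\<one>\<^bsub>G\<^esub>} \<and> (\<forall>k<c. lower_central G k \<noteq> {\<one>\<^bsub>G\<^esub>})"

end

theory Submission
  imports Defs "HOL-Number_Theory.Number_Theory"
begin

text \<open>
  From \<open>A\<^bsup>n\<^esup> B = B C\<^bsup>n\<^esup> A\<^bsup>\<alpha>+\<dots>+\<alpha>^n\<^esup>\<close> and its mirror image, conjugating \<open>A\<close> by
  \<open>B\<^bsup>\<beta>^k\<^esup> = C\<^bsup>k\<^esup> B C\<^bsup>-k\<^esup>\<close> in two ways shows that certain powers of \<open>A\<close> are central, so \<open>A\<close> and \<open>B\<close> have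
  finite order; letting \<open>k\<close> vary, every prime dividing the order of \<open>A\<close> divides \<open>\<alpha> - 1\<close>. Since
  the whole group is the set product \<open>\<langle>A\<rangle>\<langle>C\<rangle>\<langle>B\<rangle>\<close>, it then splits into its 2-part and its odd part.

  In the 2-part the same relations, estimated 2-adically, give \<open>A\<^bsup>2^(l+m)\<^esup> = B\<^bsup>2^(l+m)\<^esup> = C\<^bsup>2^(2m-1)\<^esup>\<close>, of
  order at most 2, and \<open>C\<^bsup>\<alpha>-\<beta>\<^esup> = B\<^bsup>(\<beta>-1)^2/2\<^esup> A\<^bsup>(\<alpha>-1)^2/2\<^esup>\<close>, hence the
  upper bounds for the order and the class. For the lower bounds the group acts on the triples
  \<open>(i, k, j)\<close> of exponents in \<open>A\<^bsup>i\<^esup> C\<^bsup>-k\<^esup> B\<^bsup>j\<^esup>\<close>, taken modulo the lattice spanned by these relations.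
\<close>

section \<open>Geometric sums and 2-adic estimates\<close>

text \<open>For the lower bounds an action is used because associativity then costs nothing: the
  generators have to act invertibly on classes of triples and the two relators trivially. The price
  is a closed formula for the action of every power of \<open>A\<close>, which is available only
  modulo a power of 2.

  The bounds on \<open>l\<close> explain why both halves meet. The condition
  \<open>l \<le> 2m - 3\<close> reads \<open>l + m + 1 \<le> 3m - 2\<close>, and
  \<open>3m - 2\<close> is the valuation of \<open>(\<alpha> - 1)^3 / 4\<close>. So third-order
  terms in \<open>\<alpha> - 1\<close> and \<open>\<beta> - 1\<close> vanish in the action; in the
  Sylow subgroup the element \<open>A^(2^(3m-2))\<close>, which disturbs the relations, becomes a
  power of \<open>A^(2^(l+m+1))\<close> and is finally seen to be trivial. The condition
  \<open>2l + 2 > 3m + 1\<close> concerns the \<open>2^(l-m+1)\<close>-th multiple of the relation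
  for \<open>C^(\<alpha>-\<beta>)\<close>: its exponent of \<open>C\<close> is then divisible by
  \<open>2^(2m)\<close>. Above, this bounds the order of \<open>C\<close>; below, it shows that the
  lattice meets the planes \<open>i = 0\<close> and \<open>j = 0\<close> only in the expected
  points.\<close>

definition geom :: "int \<Rightarrow> nat \<Rightarrow> int" where
  "geom x n = (\<Sum>i<n. x ^ i)"

lemma geom_0 [simp]: "geom x 0 = 0"
  by (simp add: geom_def)

lemma geom_Suc: "geom x (Suc n) = geom x n + x ^ n"
  by (simp add: geom_def)

lemma geom_mult: "(x - 1) * geom x n = x ^ n - 1"
  by (induction n) (simp_all add: geom_Suc algebra_simps)

lemma geom_add: "geom x (m + n) = geom x m + x ^ m * geom x n"
  by (induction n) (simp_all add: geom_Suc algebra_simps power_add)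

lemma geom_times: "geom x (m * n) = geom x m * geom (x ^ m) n"
proof (induction n)
  case (Suc n)
  have "geom x (m * Suc n) = geom x (m * n + m)" by (simp add: add.commute)
  then show ?case
    unfolding geom_add Suc by (simp add: geom_Suc algebra_simps power_mult)
qed simp

lemma geom_cong:
  assumes "p dvd x - 1" shows "p dvd geom x n - int n"
proof (induction n)
  case (Suc n)
  have "p dvd x ^ n - 1"
    using assms dvd_trans[of p "x - 1" "x ^ n - 1"] by (metis dvd_triv_left geom_mult)
  with Suc have "p dvd (geom x n - int n) + (x ^ n - 1)" by (rule dvd_add)
  then show ?case by (simp add: geom_Suc algebra_simps)
qed simp

text \<open>A prime factor \<open>p\<close> of \<open>n = k * p\<close> can be split off, since
  \<open>geom x (k * p) = geom x k * geom (x ^ k) p\<close> and the second factor is divisible by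
  \<open>p\<close>. This turns knowledge about the primes dividing the order of \<open>A\<close>
  into divisibility of exponents in the group relations.\<close>

lemma dvd_geom_self:
  assumes "\<And>p. Factorial_Ring.prime p \<Longrightarrow> p dvd n \<Longrightarrow> int p dvd x - 1" and "n > 0"
  shows "int n dvd geom x n"
  using assms
proof (induction n rule: less_induct)
  case (less n)
  show ?case
  proof (cases "n = 1")
    case False
    then obtain p where p: "Factorial_Ring.prime p" "p dvd n"
      using prime_factor_nat by blast
    then obtain k where k: "n = k * p" by (metis dvd_def mult.commute)
    have "k < n" "k > 0" using less.prems(2) k prime_gt_1_nat[OF p(1)] by auto
    then have ik: "int k dvd geom x k"
      using less.IH[of k] less.prems(1) k by auto
    have "int p dvd x ^ k - 1"
      using less.prems(1)[OF p] by (metis dvd_mult2 geom_mult)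
    then have "int p dvd geom (x ^ k) p - int p" by (rule geom_cong)
    from dvd_add[OF this dvd_refl] have "int p dvd geom (x ^ k) p" by simp
    with ik show ?thesis unfolding k geom_times by (simp add: mult_dvd_mono)
  qed simp
qed

lemma dvd_geom:
  assumes "\<And>p. Factorial_Ring.prime p \<Longrightarrow> p dvd n \<Longrightarrow> int p dvd x - 1" "n > 0" "n dvd k"
  shows "int n dvd geom x k" and "int n dvd x ^ k - 1"
proof -
  obtain t where "k = n * t" using assms(3) by (auto simp: dvd_def)
  then show *: "int n dvd geom x k"
    using dvd_geom_self[OF assms(1,2)] by (simp add: geom_times)
  show "int n dvd x ^ k - 1"
    using * by (metis dvd_mult geom_mult)
qed

text \<open>Doubling avoids the denominator of \<open>N(N-1)/2\<close>. The exponent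
  \<open>k\<close> grows by squaring \<open>(1 + v) ^ N\<close>, each squaring gaining one factor 2
  in the error; for \<open>k = 0\<close> the error is the cubic remainder of the binomial
  expansion.\<close>

lemma binomial_second_order:
  fixes v :: int
  assumes "2 ^ m dvd v" "m \<ge> 1"
  shows "2 ^ (k + 3 * m) dvd 2 * ((1 + v) ^ (2 ^ k * n) - 1 - int (2 ^ k * n) * v)
           - v\<^sup>2 * int (2 ^ k * n) * (int (2 ^ k * n) - 1)"
proof (induction k)
  case 0
  have "v ^ 3 dvd 2 * ((1 + v) ^ n - 1 - int n * v) - v\<^sup>2 * int n * (int n - 1)"
  proof (induction n)
    case (Suc n)
    then obtain t where t: "2 * ((1 + v) ^ n - 1 - int n * v) - v\<^sup>2 * int n * (int n - 1) = v ^ 3 * t"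
      by (auto simp: dvd_def)
    have "2 * ((1 + v) ^ Suc n - 1 - int (Suc n) * v) - v\<^sup>2 * int (Suc n) * (int (Suc n) - 1)
       = (1 + v) * (2 * ((1 + v) ^ n - 1 - int n * v) - v\<^sup>2 * int n * (int n - 1)) 
         + v ^ 3 * (int n * (int n - 1))"
      by (simp add: algebra_simps power2_eq_square power3_eq_cube)
    then show ?case unfolding t by simp
  qed simp
  moreover have "(2::int) ^ (3 * m) dvd v ^ 3"
    using assms(1) dvd_power_same[of "2 ^ m" v 3] by (metis mult.commute power_mult)
  ultimately show ?case by (auto intro: dvd_trans)
next
  case (Suc k)
  define N where "N = (2::nat) ^ k * n"
  define a where "a = int N"
  define Y where "Y = (1 + v) ^ N - 1"
  define R where "R = 2 * (Y - a * v) - v\<^sup>2 * a * (a - 1)"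
  obtain t where t: "R = 2 ^ (k + 3 * m) * t"
    using Suc unfolding N_def[symmetric] Y_def[symmetric] R_def a_def by (auto simp: dvd_def Y_def)
  obtain w where w: "v = 2 ^ m * w" using assms(1) by (auto simp: dvd_def)
  obtain b where b: "a = 2 ^ k * b" using N_def a_def by simp
  have eq: "2 ^ Suc k * n = 2 * N" by (simp add: N_def)
  have pw: "(1 + v) ^ (2 * N) = (Y + 1)\<^sup>2"
    unfolding Y_def by (simp add: power_mult mult.commute[of 2])
  have "even (a * (a - 1))" by simp
  then obtain c where c: "a * (a - 1) = 2 * c" by (auto simp: dvd_def)
  have Y2: "2 * Y = R + 2 * a * v + v\<^sup>2 * 2 * c"
    unfolding R_def mult.assoc c by simp
  \<comment> \<open>The further factor 4 makes \<open>Y\<close> occur only as \<open>2 * Y\<close>,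
    for which \<open>Y2\<close> is an exact integer formula.\<close>
  have "4 * (2 * ((Y + 1)\<^sup>2 - 1 - 2 * a * v) - v\<^sup>2 * (2 * a) * (2 * a - 1))
      = 2 * ((2 * Y)\<^sup>2 + 4 * (2 * Y)) - 16 * a * v - 4 * (v\<^sup>2 * (2 * a) * (2 * a - 1))"
    by (simp add: algebra_simps power2_eq_square)
  also have "\<dots> = 2 * R\<^sup>2 + 8 * R * a * v + 8 * R * v\<^sup>2 * c + 8 * R + 16 * a * v ^ 3 * c + 8 * v ^ 4 * c\<^sup>2
       + 8 * v\<^sup>2 * (a\<^sup>2 + 2 * c - (2 * a\<^sup>2 - a))"
    unfolding Y2 by (simp add: algebra_simps power2_eq_square power3_eq_cube power4_eq_xxxx)
  also have "a\<^sup>2 + 2 * c - (2 * a\<^sup>2 - a) = 0"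
    unfolding c[symmetric] by (simp add: algebra_simps power2_eq_square)
  finally have main: "4 * (2 * ((Y + 1)\<^sup>2 - 1 - 2 * a * v) - v\<^sup>2 * (2 * a) * (2 * a - 1))
    = 2 * R\<^sup>2 + 8 * R * a * v + 8 * R * v\<^sup>2 * c + 8 * R + 16 * a * v ^ 3 * c + 8 * v ^ 4 * c\<^sup>2"
    by simp
  let ?M = "(2::int) ^ (k + 3 * m + 3)"
  have R8: "?M dvd 8 * R" unfolding t by (simp add: power_add)
  have "?M dvd 2 * R\<^sup>2"
  proof -
    have "2 * R\<^sup>2 = 2 ^ (k + 3 * m + 3) * (2 ^ (k + 3 * m - 2) * t\<^sup>2)"
    proof -
      have "k + 3 * m + 3 + (k + 3 * m - 2) = 1 + (k + 3 * m) + (k + 3 * m)" using assms(2) by simp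
      then have "(2::int) ^ (k + 3 * m + 3) * 2 ^ (k + 3 * m - 2) = 2 * 2 ^ (k + 3 * m) * 2 ^ (k + 3 * m)"
        by (metis power_add power_one_right)
      then show ?thesis unfolding t power2_eq_square by (simp add: mult_ac)
    qed
    then show ?thesis by simp
  qed
  moreover have "?M dvd 8 * R * a * v" "?M dvd 8 * R * v\<^sup>2 * c"
    using R8 by (auto intro: dvd_mult2)
  moreover have "?M dvd 16 * a * v ^ 3 * c"
  proof -
    have "v ^ 3 = 2 ^ (3 * m) * w ^ 3"
      unfolding w power_mult_distrib by (metis mult.commute power_mult)
    then have "16 * a * v ^ 3 * c = 2 ^ (k + 3 * m + 3) * (2 * b * w ^ 3 * c)"
      unfolding b power_add by simp
    then show ?thesis by (metis dvd_triv_left)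
  qed
  moreover have "?M dvd 8 * v ^ 4 * c\<^sup>2"
  proof -
    have "2 ^ k dvd 2 * c" unfolding c[symmetric] b by simp
    then have "2 ^ k dvd (2 * c) * c" by simp
    then have 1: "2 ^ k dvd 2 * c\<^sup>2" by (simp add: power2_eq_square mult.assoc)
    have "v ^ 4 = 2 ^ (3 * m) * 2 * (2 ^ (m - 1) * w ^ 4)"
    proof -
      have "4 * m = 3 * m + 1 + (m - 1)" using assms(2) by simp
      then have "(2::int) ^ (4 * m) = 2 ^ (3 * m) * 2 * 2 ^ (m - 1)"
        by (metis power_add power_one_right)
      moreover have "v ^ 4 = 2 ^ (4 * m) * w ^ 4"
        unfolding w power_mult_distrib by (metis mult.commute power_mult)
      ultimately show ?thesis by simp
    qed
    then have "8 * v ^ 4 * c\<^sup>2 = (8 * 2 ^ (3 * m)) * (2 * c\<^sup>2) * (2 ^ (m - 1) * w ^ 4)"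
      by (simp add: algebra_simps)
    moreover have "(2::int) ^ (k + 3 * m + 3) = (8 * 2 ^ (3 * m)) * 2 ^ k" by (simp add: power_add)
    ultimately show ?thesis using 1 by (metis dvd_mult2 dvd_refl mult_dvd_mono)
  qed
  ultimately have "?M dvd 4 * (2 * ((Y + 1)\<^sup>2 - 1 - 2 * a * v) - v\<^sup>2 * (2 * a) * (2 * a - 1))"
    unfolding main using R8 by (intro dvd_add)
  then have "4 * 2 ^ (Suc k + 3 * m) dvd 4 * (2 * ((Y + 1)\<^sup>2 - 1 - 2 * a * v) - v\<^sup>2 * (2 * a) * (2 * a - 1))"
    by (simp add: power_add mult.commute)
  then have "2 ^ (Suc k + 3 * m) dvd 2 * ((Y + 1)\<^sup>2 - 1 - 2 * a * v) - v\<^sup>2 * (2 * a) * (2 * a - 1)"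
    by (subst (asm) dvd_mult_cancel_left) simp
  then show ?case unfolding eq pw by (simp add: a_def)
qed

lemma binomial_first_order:
  fixes v :: int
  assumes "2 ^ m dvd v" "m \<ge> 1" "2 ^ k dvd n"
  shows "2 ^ (k + 2 * m - 1) dvd (1 + v) ^ n - 1 - int n * v"
proof -
  obtain n' where n: "n = 2 ^ k * n'" using assms(3) by (auto simp: dvd_def)
  have 1: "2 ^ (k + 3 * m) dvd 2 * ((1 + v) ^ n - 1 - int n * v) - v\<^sup>2 * int n * (int n - 1)"
    unfolding n by (rule binomial_second_order[OF assms(1,2)])
  have 2: "2 ^ (k + 2 * m) dvd v\<^sup>2 * int n * (int n - 1)"
  proof -
    have "2 ^ (2 * m) dvd v\<^sup>2"
      using assms(1) dvd_power_same[of "2 ^ m" v 2] by (metis mult.commute power_mult)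
    moreover have "2 ^ k dvd int n" unfolding n by simp
    ultimately show ?thesis by (metis add.commute dvd_mult2 mult_dvd_mono power_add)
  qed
  have "2 ^ (k + 2 * m) dvd 2 * ((1 + v) ^ n - 1 - int n * v) - v\<^sup>2 * int n * (int n - 1)"
    using 1 by (rule dvd_trans[rotated]) (simp add: le_imp_power_dvd)
  then have "2 ^ (k + 2 * m) dvd 2 * ((1 + v) ^ n - 1 - int n * v)"
    using 2 by (metis diff_add_cancel dvd_add)
  moreover have e: "(2::int) ^ (k + 2 * m) = 2 * 2 ^ (k + 2 * m - 1)"
    using assms(2) by (metis One_nat_def Suc_diff_le add_gr_0 diff_Suc_1 le_numeral_extra(4) less_eq_Suc_le mult_2 power_Suc Suc_pred)
  ultimately show ?thesis by (metis dvd_mult_cancel_left zero_neq_numeral)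
qed

section \<open>The relations and the fundamental identity\<close>

context group
begin

lemma conj_int_pow:
  assumes "x \<otimes> y = y \<otimes> z" "x \<in> carrier G" "y \<in> carrier G" "z \<in> carrier G"
  shows "x [^] (n::int) \<otimes> y = y \<otimes> z [^] n"
proof -
  have x: "x = y \<otimes> z \<otimes> inv y"
    using assms by (metis inv_solve_right m_closed)
  have n: "(y \<otimes> z \<otimes> inv y) [^] (k::nat) = y \<otimes> z [^] k \<otimes> inv y" for k
  proof (induction k)
    case (Suc k)
    then show ?case using assms
      by (simp add: m_assoc) (metis inv_closed l_inv l_one m_assoc m_closed nat_pow_closed)
  qed (use assms in simp)
  have "x [^] n = y \<otimes> z [^] n \<otimes> inv y"
    unfolding x int_pow_def2 n using assms
    by (simp add: inv_mult_group m_assoc)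
  then show ?thesis using assms by (simp add: m_assoc)
qed

lemma int_pow_mult_r:
  "x \<in> carrier G \<Longrightarrow> w \<in> carrier G \<Longrightarrow> x [^] (i::int) \<otimes> (x [^] (j::int) \<otimes> w) = x [^] (i + j) \<otimes> w"
  by (simp add: int_pow_mult m_assoc)

lemma int_pow_cong_mod:
  assumes "x \<in> carrier G" "x [^] (n::int) = \<one>" "n dvd i - j"
  shows "x [^] i = x [^] j"
proof -
  obtain t where "i = n * t + j" using assms(3) by (auto simp: dvd_def algebra_simps)
  then show ?thesis using assms(1,2) by (simp add: int_pow_mult flip: int_pow_pow)
qed

lemma pow_inverse_odd:
  assumes "x \<in> carrier G" "x [^] ((2::int) ^ t) = \<one>" "odd (r::int)"
  obtains s where "odd s" "(x [^] r) [^] (s::int) = x"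
proof -
  have "coprime r (2 ^ t)" using assms(3) by simp
  \<comment> \<open>Solving modulo \<open>2 ^ Suc t\<close> instead of \<open>2 ^ t\<close> makes
    \<open>s\<close> odd even when \<open>t = 0\<close>.\<close>
  then obtain s where "[r * s = 1] (mod 2 ^ (Suc t))"
    using cong_solve_coprime_int[of r "2 ^ Suc t"] assms(3) by auto
  then have d: "2 ^ Suc t dvd r * s - 1" by (simp add: cong_iff_dvd_diff)
  then have "even (r * s - 1)" by (metis dvd_trans dvd_triv_left power_Suc)
  then have "odd s" by auto
  moreover have "(x [^] r) [^] s = x"
    using int_pow_cong_mod[OF assms(1,2), of "r * s" 1] d assms(1)
    by (simp add: int_pow_pow) (meson dvd_mult_right)
  ultimately show thesis using that by blast
qed

end

text \<open>The group need be neither generated by \<open>A\<close> and \<open>B\<close> nor defined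
  by these relations, so the locale applies to the 2-parts of the generators as well. The relations
  are solved for products so that they serve as commutation rules.\<close>

locale macdonald = group G for G (structure) +
  fixes A B C :: 'a and \<alpha> \<beta> :: int
  assumes A [simp, intro]: "A \<in> carrier G" and B [simp, intro]: "B \<in> carrier G"
    and C [simp, intro]: "C \<in> carrier G"
    and AB: "A \<otimes> B = B \<otimes> A \<otimes> C"
    and AC: "A \<otimes> C = C \<otimes> A [^] \<alpha>"
    and CB: "C \<otimes> B = B [^] \<beta> \<otimes> C"
begin

text \<open>Exchanging the generators inverts \<open>[A,B]\<close>, which exchanges the two defining
  relations. Statements about \<open>A\<close> are transferred to \<open>B\<close> through this
  interpretation.\<close>

lemma swapped: "macdonald G B A (inv C) \<beta> \<alpha>"
proof
  show "B \<otimes> A = A \<otimes> B \<otimes> inv C" unfolding AB by (simp add: m_assoc)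
  show "B \<otimes> inv C = inv C \<otimes> B [^] \<beta>"
    using CB by (metis A B C inv_closed inv_solve_left inv_solve_right int_pow_closed m_assoc m_closed)
  show "inv C \<otimes> A = A [^] \<alpha> \<otimes> inv C"
    using AC by (metis A B C inv_closed inv_solve_left inv_solve_right int_pow_closed m_assoc m_closed)
qed auto

text \<open>Only the powers \<open>A^\<alpha>\<close> and \<open>B^\<beta>\<close> enter the
  relations. This is used to replace the exponents by positive ones once the orders are known to be
  finite.\<close>

lemma change_exponents:
  assumes "A [^] \<alpha>' = A [^] \<alpha>" "B [^] \<beta>' = B [^] \<beta>"
  shows "macdonald G A B C \<alpha>' \<beta>'"
  by unfold_locales (use AB AC CB assms in auto)

lemma A_C: "A [^] (i::int) \<otimes> C = C \<otimes> A [^] (\<alpha> * i)"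
  using conj_int_pow[OF AC] by (simp add: int_pow_pow)

lemma A_Cn: "A [^] (i::int) \<otimes> C [^] (int n) = C [^] (int n) \<otimes> A [^] (\<alpha> ^ n * i)"
proof (induction n)
  case (Suc n)
  have "A [^] i \<otimes> C [^] (int (Suc n)) = A [^] i \<otimes> C [^] (int n) \<otimes> C"
    using int_pow_mult[of C "int n" 1] by (simp add: m_assoc add.commute)
  also have "\<dots> = C [^] (int n) \<otimes> (C \<otimes> A [^] (\<alpha> * (\<alpha> ^ n * i)))"
    unfolding Suc by (simp add: m_assoc A_C)
  also have "\<dots> = C [^] (int (Suc n)) \<otimes> A [^] (\<alpha> ^ Suc n * i)"
    using int_pow_mult[of C "int n" 1] by (simp add: m_assoc add.commute mult.assoc)
  finally show ?case .
qed simp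

lemma A_Cn_r: "w \<in> carrier G \<Longrightarrow>
    A [^] (i::int) \<otimes> (C [^] (int n) \<otimes> w) = C [^] (int n) \<otimes> (A [^] (\<alpha> ^ n * i) \<otimes> w)"
  using A_Cn[of i n] by (metis A C int_pow_closed m_assoc)

lemma Cn_B: "C [^] (int n) \<otimes> B [^] (i::int) = B [^] (\<beta> ^ n * i) \<otimes> C [^] (int n)"
proof -
  interpret sw: macdonald G B A "inv C" \<beta> \<alpha> by (rule swapped)
  have "B [^] i \<otimes> inv (C [^] (int n)) = inv (C [^] (int n)) \<otimes> B [^] (\<beta> ^ n * i)"
    using sw.A_Cn[of i n] by (simp add: int_pow_inv)
  then show ?thesis
    by (metis B C inv_closed inv_solve_left inv_solve_right int_pow_closed m_assoc m_closed inv_inv)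
qed

lemma Cn_B_r: "w \<in> carrier G \<Longrightarrow>
    C [^] (int n) \<otimes> (B [^] (i::int) \<otimes> w) = B [^] (\<beta> ^ n * i) \<otimes> (C [^] (int n) \<otimes> w)"
  using Cn_B[of n i] by (metis B C int_pow_closed m_assoc)

lemma An_B: "A [^] (int n) \<otimes> B = B \<otimes> (C [^] (int n) \<otimes> A [^] (\<alpha> * geom \<alpha> n))"
proof (induction n)
  case (Suc n)
  have "A [^] (int (Suc n)) \<otimes> B = A \<otimes> (A [^] (int n) \<otimes> B)"
    using int_pow_mult[of A 1 "int n"] by (simp add: m_assoc)
  also have "\<dots> = (A \<otimes> B) \<otimes> (C [^] (int n) \<otimes> A [^] (\<alpha> * geom \<alpha> n))"
    unfolding Suc by (simp add: m_assoc)
  also have "\<dots> = B \<otimes> (A [^] (1::int) \<otimes> (C [^] (int (Suc n)) \<otimes> A [^] (\<alpha> * geom \<alpha> n)))"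
    unfolding AB using int_pow_mult[of C 1 "int n"] by (simp add: m_assoc)
  also have "\<dots> = B \<otimes> (C [^] (int (Suc n)) \<otimes> A [^] (\<alpha> ^ Suc n + \<alpha> * geom \<alpha> n))"
    by (subst A_Cn_r) (simp_all only: A C int_pow_closed int_pow_mult mult_1_right)
  also have "\<alpha> ^ Suc n + \<alpha> * geom \<alpha> n = \<alpha> * geom \<alpha> (Suc n)"
    by (simp add: geom_Suc algebra_simps)
  finally show ?case .
qed simp

lemma Bn_A: "B [^] (int n) \<otimes> A = A \<otimes> (C [^] (- int n) \<otimes> B [^] (\<beta> * geom \<beta> n))"
proof -
  interpret sw: macdonald G B A "inv C" \<beta> \<alpha> by (rule swapped)
  show ?thesis using sw.An_B[of n] by (simp add: int_pow_neg int_pow_inv)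
qed

text \<open>Both sides come from conjugating \<open>A\<close> by \<open>B\<^bsup>q\<^esup> = C\<^bsup>k\<^esup> B C\<^bsup>-k\<^esup>\<close>.\<close>

lemma fundamental_relation:
  assumes p: "int p = \<alpha> ^ k" and q: "int q = \<beta> ^ k"
  shows "B [^] (int q * \<beta> ^ q - \<beta> * geom \<beta> q) \<otimes> C [^] (int (q + k))
       = C [^] (int (p + k)) \<otimes> A [^] (\<alpha> * geom \<alpha> p - \<alpha> ^ (p + k))"
proof -
  let ?\<tau> = "\<beta> * geom \<beta> q" and ?\<sigma> = "\<alpha> * geom \<alpha> p"
  have CkB: "C [^] (int k) \<otimes> B = B [^] (int q) \<otimes> C [^] (int k)"
    using Cn_B[of k 1] q by simp
  have "A \<otimes> (B [^] (int q) \<otimes> C [^] (int k)) = A \<otimes> C [^] (int k) \<otimes> B"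
    by (simp add: m_assoc flip: CkB)
  also have "\<dots> = C [^] (int k) \<otimes> (A [^] (int p) \<otimes> B)"
    using A_Cn[of 1 k] p by (simp add: m_assoc)
  also have "\<dots> = C [^] (int k) \<otimes> B \<otimes> (C [^] (int p) \<otimes> A [^] ?\<sigma>)"
    unfolding An_B by (simp add: m_assoc)
  also have "\<dots> = B [^] (int q) \<otimes> (C [^] (int (p + k)) \<otimes> A [^] ?\<sigma>)"
    unfolding CkB by (simp add: m_assoc int_pow_mult_r add.commute)
  finally have 1: "A \<otimes> (B [^] (int q) \<otimes> C [^] (int k)) = B [^] (int q) \<otimes> (C [^] (int (p + k)) \<otimes> A [^] ?\<sigma>)" .
  \<comment> \<open>The product is regrouped as \<open>A B^(-?\<tau>) C^q\<close> times
    \<open>B^q C^k\<close>. By \<open>Bn_A\<close> the first factor is \<open>B^(-q) A\<close>,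
    after which \<open>1\<close> applies.\<close>
  have "A \<otimes> (B [^] (int q * \<beta> ^ q - ?\<tau>) \<otimes> C [^] (int (q + k)))
     = A \<otimes> (B [^] (- ?\<tau>) \<otimes> (B [^] (\<beta> ^ q * int q) \<otimes> (C [^] (int q) \<otimes> C [^] (int k))))"
    by (simp add: int_pow_mult_r int_pow_mult[symmetric] algebra_simps)
  also have "\<dots> = A \<otimes> (B [^] (- ?\<tau>) \<otimes> (C [^] (int q) \<otimes> (B [^] (int q) \<otimes> C [^] (int k))))"
    by (subst Cn_B_r) auto
  also have "\<dots> = B [^] (- int q) \<otimes> ((B [^] (int q) \<otimes> A) \<otimes> (B [^] (- ?\<tau>) \<otimes> (C [^] (int q) \<otimes> (B [^] (int q) \<otimes> C [^] (int k)))))"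
    by (simp add: m_assoc int_pow_mult_r)
  also have "\<dots> = B [^] (- int q) \<otimes> (A \<otimes> (B [^] (int q) \<otimes> C [^] (int k)))"
    unfolding Bn_A by (simp add: m_assoc int_pow_mult_r)
  also have "\<dots> = C [^] (int (p + k)) \<otimes> A [^] ?\<sigma>"
    unfolding 1 by (simp add: int_pow_mult_r)
  also have "\<dots> = A \<otimes> (A [^] (- 1::int) \<otimes> (C [^] (int (p + k)) \<otimes> A [^] ?\<sigma>))"
    by (simp add: int_pow_neg flip: m_assoc)
  also have "\<dots> = A \<otimes> (C [^] (int (p + k)) \<otimes> A [^] (?\<sigma> - \<alpha> ^ (p + k)))"
    by (subst A_Cn_r) (simp_all add: int_pow_mult_r flip: int_pow_mult)
  finally show ?thesis by simp
qed

text \<open>The element \<open>Y\<close> below normalises both \<open>\<langle>A\<rangle>\<close> and \<open>\<langle>B\<rangle>\<close>, and conjugates a power of \<open>A\<close> into a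
  power of \<open>B\<close>; hence that power is central. Taking \<open>k = 2\<close> makes \<open>\<alpha>\<^sup>2\<close> and \<open>\<beta>\<^sup>2\<close> natural
  numbers whatever the signs of \<open>\<alpha>\<close> and \<open>\<beta>\<close>.\<close>

lemma A_central_power:
  assumes p: "int p = \<alpha> ^ k" and q: "int q = \<beta> ^ k"
  defines "E \<equiv> \<alpha> * geom \<alpha> p - \<alpha> ^ (p + k)"
  shows "B \<otimes> A [^] ((\<alpha> - 1) * E) = A [^] ((\<alpha> - 1) * E) \<otimes> B"
    and "A [^] ((\<alpha> - 1) * ((\<alpha> - 1) * E)) = \<one>"
proof -
  define F where "F = int q * \<beta> ^ q - \<beta> * geom \<beta> q"
  define Y where "Y = C [^] (int (p + k + 1)) \<otimes> A [^] E"
  have fr: "B [^] F \<otimes> C [^] (int (q + k)) = C [^] (int (p + k)) \<otimes> A [^] E"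
    unfolding F_def E_def by (rule fundamental_relation[OF p q])
  have Y [simp]: "Y \<in> carrier G" by (simp add: Y_def)
  have Y2: "Y = B [^] (\<beta> * F) \<otimes> C [^] (int (q + k + 1))"
  proof -
    have "Y = C [^] (int 1) \<otimes> (C [^] (int (p + k)) \<otimes> A [^] E)"
      unfolding Y_def by (simp add: int_pow_mult_r add.commute del: int_pow_1)
    also have "\<dots> = B [^] (\<beta> * F) \<otimes> (C [^] (int 1) \<otimes> C [^] (int (q + k)))"
      unfolding fr[symmetric] by (subst Cn_B_r) auto
    finally show ?thesis by (simp add: int_pow_mult[symmetric] add_ac del: int_pow_1)
  qed
  have "Y \<otimes> A [^] ((\<alpha> - 1) * E) = C [^] (int (p + k)) \<otimes> (C [^] (int 1) \<otimes> A [^] (\<alpha> ^ 1 * E))"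
    unfolding Y_def by (simp add: m_assoc int_pow_mult_r int_pow_mult[symmetric] algebra_simps del: int_pow_1)
  also have "\<dots> = (C [^] (int (p + k)) \<otimes> A [^] E) \<otimes> C [^] (int 1)"
    by (subst A_Cn[symmetric]) (simp add: m_assoc)
  also have "\<dots> = B [^] F \<otimes> C [^] (int (q + k + 1))"
    unfolding fr[symmetric] by (simp add: m_assoc int_pow_mult[symmetric] add_ac del: int_pow_1)
  also have "\<dots> = B [^] (F - \<beta> * F) \<otimes> Y"
    unfolding Y2 by (simp add: int_pow_mult_r)
  finally have YA: "Y \<otimes> A [^] ((\<alpha> - 1) * E) = B [^] (F - \<beta> * F) \<otimes> Y" .
  have YB: "Y \<otimes> B = B [^] (\<beta> ^ (q + k + 1)) \<otimes> Y"
  proof -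
    have "Y \<otimes> B = B [^] (\<beta> * F) \<otimes> (C [^] (int (q + k + 1)) \<otimes> B [^] (1::int))"
      unfolding Y2 by (simp add: m_assoc)
    also have "\<dots> = B [^] (\<beta> ^ (q + k + 1)) \<otimes> Y"
      unfolding Y2 by (subst Cn_B) (simp add: int_pow_mult_r add.commute)
    finally show ?thesis .
  qed
  have "Y \<otimes> (B \<otimes> A [^] ((\<alpha> - 1) * E)) = B [^] (\<beta> ^ (q + k + 1)) \<otimes> (Y \<otimes> A [^] ((\<alpha> - 1) * E))"
    using YB by (simp flip: m_assoc)
  also have "\<dots> = B [^] (F - \<beta> * F) \<otimes> (Y \<otimes> B)"
    unfolding YA YB by (simp add: int_pow_mult_r add.commute)
  also have "\<dots> = Y \<otimes> (A [^] ((\<alpha> - 1) * E) \<otimes> B)"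
    using YA by (simp flip: m_assoc)
  finally show comm: "B \<otimes> A [^] ((\<alpha> - 1) * E) = A [^] ((\<alpha> - 1) * E) \<otimes> B" by simp
  let ?z = "A [^] ((\<alpha> - 1) * E)"
  have zA: "A \<otimes> ?z = ?z \<otimes> A"
    using int_pow_mult[of A 1 "(\<alpha> - 1) * E"] int_pow_mult[of A "(\<alpha> - 1) * E" 1] by (simp add: add.commute)
  have "B \<otimes> (A \<otimes> (C \<otimes> ?z)) = A \<otimes> B \<otimes> ?z" unfolding AB by (simp add: m_assoc)
  also have "\<dots> = ?z \<otimes> (A \<otimes> B)" by (metis A B comm int_pow_closed m_assoc zA)
  also have "\<dots> = ?z \<otimes> (B \<otimes> (A \<otimes> C))" unfolding AB by (simp add: m_assoc)
  also have "\<dots> = B \<otimes> (A \<otimes> (?z \<otimes> C))" by (metis A B C comm int_pow_closed m_assoc m_closed zA)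
  finally have "C \<otimes> ?z = ?z \<otimes> C" by simp
  also have "\<dots> = C \<otimes> A [^] (\<alpha> * ((\<alpha> - 1) * E))" by (rule A_C)
  finally have "?z = A [^] (\<alpha> * ((\<alpha> - 1) * E))" by simp
  also have "\<dots> = ?z \<otimes> A [^] ((\<alpha> - 1) * ((\<alpha> - 1) * E))"
    by (simp add: int_pow_mult[symmetric] algebra_simps)
  finally show "A [^] ((\<alpha> - 1) * ((\<alpha> - 1) * E)) = \<one>" by simp
qed

end

section \<open>Finiteness of the generators\<close>

context macdonald
begin

text \<open>\<open>C\<close> conjugates \<open>A^i\<close> to \<open>A^(\<alpha> i)\<close>. The
  consequence of interest is that \<open>\<alpha>\<close> is prime to the order of
  \<open>A\<close>.\<close>

lemma A_pow_eq_1_of_mult: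
  assumes "A [^] (\<alpha> * i) = \<one>" shows "A [^] i = \<one>"
  using A_C[of i] assms by (metis A C int_pow_closed l_one one_closed r_cancel r_one)

text \<open>The case \<open>k = 2\<close> of \<open>A_central_power\<close> kills \<open>A\<close>
  by \<open>(\<alpha> - 1)^2 * E\<close>, and \<open>E = 0\<close> would make
  \<open>\<alpha>\<close> a divisor of 1.\<close>

lemma ord_A_pos:
  assumes "\<alpha> \<noteq> 0" "\<alpha> \<noteq> 1" "\<alpha> \<noteq> -1"
  shows "group.ord G A > 0"
proof -
  define p where "p = nat (\<alpha>\<^sup>2)"
  define E where "E = \<alpha> * geom \<alpha> p - \<alpha> ^ (p + 2)"
  have p: "int p = \<alpha> ^ 2" "int (nat (\<beta>\<^sup>2)) = \<beta> ^ 2" unfolding p_def by simp_all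
  have "A [^] ((\<alpha> - 1) * ((\<alpha> - 1) * E)) = \<one>"
    unfolding E_def by (rule A_central_power(2)[OF p])
  moreover have "E \<noteq> 0"
  proof
    assume "E = 0"
    then have eq: "geom \<alpha> p = \<alpha> * \<alpha> ^ p" using assms(1) unfolding E_def by (simp add: power_add power2_eq_square)
    have "p > 0" using assms(1) unfolding p_def by simp
    then obtain n where "p = 1 + n" by (metis Suc_eq_plus1_left gr0_conv_Suc)
    then have "geom \<alpha> p = 1 + \<alpha> * geom \<alpha> n" by (simp only: geom_add) (simp add: geom_def)
    with eq have "1 = \<alpha> * (\<alpha> ^ p - geom \<alpha> n)" by (simp add: algebra_simps)
    then have "\<alpha> dvd 1" by (metis dvd_triv_left)
    then show False using assms by auto
  qed
  ultimately have "int (group.ord G A) \<noteq> 0"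
    using assms by (auto simp: int_pow_eq_id)
  then show ?thesis by simp
qed

lemma prime_dvd_ord_A_coprime:
  assumes "group.ord G A > 0" "Factorial_Ring.prime p" "p dvd group.ord G A"
  shows "\<not> int p dvd \<alpha>"
proof
  assume "int p dvd \<alpha>"
  obtain k where k: "group.ord G A = p * k" using assms(3) by (auto simp: dvd_def)
  have "int (group.ord G A) dvd \<alpha> * int k" unfolding k using \<open>int p dvd \<alpha>\<close> by simp
  then have "A [^] (\<alpha> * int k) = \<one>" by (subst int_pow_eq_id) simp_all
  then have "A [^] int k = \<one>" by (rule A_pow_eq_1_of_mult)
  then have "int (group.ord G A) dvd int k" by (subst (asm) int_pow_eq_id) simp_all
  then have "p * k dvd k" unfolding k by presburger
  then show False using assms(1,2) k by auto
qed

lemma C_pow_ord_A: "C [^] (int (group.ord G A)) \<otimes> A [^] (\<alpha> * geom \<alpha> (group.ord G A)) = \<one>"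
proof -
  have "A [^] (int (group.ord G A)) = \<one>" by (simp add: int_pow_eq_id)
  then have "B = B \<otimes> (C [^] (int (group.ord G A)) \<otimes> A [^] (\<alpha> * geom \<alpha> (group.ord G A)))"
    using An_B[of "group.ord G A"] by simp
  then show ?thesis by simp
qed

text \<open>With \<open>N\<close> the order of \<open>A\<close>, \<open>C_pow_ord_A\<close> shows
  that \<open>C^N\<close> is a power of \<open>A\<close> and so commutes with \<open>A\<close>; yet
  it conjugates \<open>A\<close> to \<open>A^(\<alpha>^N)\<close>.\<close>

lemma ord_A_dvd: "int (group.ord G A) dvd \<alpha> ^ group.ord G A - 1"
proof -
  define N where "N = group.ord G A"
  have "C [^] (int N) = A [^] (- (\<alpha> * geom \<alpha> N))"
    using C_pow_ord_A unfolding N_def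
    by (metis A C inv_equality int_pow_closed int_pow_neg inv_inv)
  then have "A [^] (1::int) \<otimes> A [^] (- (\<alpha> * geom \<alpha> N)) = A [^] (- (\<alpha> * geom \<alpha> N)) \<otimes> A [^] (\<alpha> ^ N)"
    using A_Cn[of 1 N] by simp
  also have "\<dots> = A [^] (\<alpha> ^ N) \<otimes> A [^] (- (\<alpha> * geom \<alpha> N))"
    by (simp only: int_pow_mult[symmetric] A add.commute)
  finally have "A [^] (1::int) = A [^] (\<alpha> ^ N)" by simp
  then have "A [^] (\<alpha> ^ N - 1) = \<one>"
    by (metis A int_pow_closed int_pow_diff r_inv)
  then show ?thesis unfolding N_def by (subst (asm) int_pow_eq_id) simp_all
qed

text \<open>If \<open>p\<close> divides the order of \<open>A\<close> but not \<open>\<alpha> - 1\<close>, comparing the exponents \<open>E\<close>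
  of the central powers of \<open>A\<close> modulo \<open>p\<close> for \<open>k = 0\<close> and \<open>k = totient o\<close>, with \<open>o\<close> the multiplicative
  order of \<open>\<alpha>\<close> modulo \<open>p\<close>, forces \<open>o\<close> to divide its own totient.\<close>

lemma prime_dvd_ord_A_pos:
  assumes pos: "\<alpha> > 0" "\<beta> > 0" and N: "group.ord G A > 0"
    and p: "Factorial_Ring.prime p" "p dvd group.ord G A"
  shows "int p dvd \<alpha> - 1"
proof (rule ccontr)
  assume np: "\<not> int p dvd \<alpha> - 1"
  define N where "N = group.ord G A"
  define a where "a = nat \<alpha>"
  have a: "int a = \<alpha>" using pos by (simp add: a_def)
  define q where "q = Pocklington.ord p a"
  have q_iff: "int p dvd \<alpha> ^ n - 1 \<longleftrightarrow> q dvd n" for n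
    unfolding q_def ord_divides[symmetric] a[symmetric] 
    by (metis cong_iff_dvd_diff cong_int_iff of_nat_1 of_nat_power)
  have "int p dvd \<alpha> ^ N - 1"
    using ord_A_dvd p(2) unfolding N_def by (meson dvd_trans int_dvd_int_iff)
  then have qN: "q dvd N" by (simp add: q_iff)
  \<comment> \<open>\<open>q\<close> divides the order of \<open>A\<close>, and by
    \<open>prime_dvd_ord_A_coprime\<close> no prime factor of that order divides
    \<open>\<alpha>\<close>.\<close>
  have "coprime a q"
  proof (rule ccontr)
    assume "\<not> coprime a q"
    then obtain r where r: "Factorial_Ring.prime r" "r dvd a" "r dvd q"
      by (meson coprime_iff_gcd_eq_1 gcd_dvd1 gcd_dvd2 dvd_trans prime_factor_nat)
    then have "r dvd group.ord G A" using qN N_def by (meson dvd_trans)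
    then have "\<not> int r dvd \<alpha>" using prime_dvd_ord_A_coprime[OF N r(1)] by simp
    then show False using r(2) a by (metis int_dvd_int_iff)
  qed
  \<comment> \<open>Euler's theorem gives \<open>P = a ^ k = 1\<close> modulo \<open>q\<close>,
    hence \<open>\<alpha> ^ P = \<alpha>\<close> modulo \<open>p\<close>. Modulo \<open>p\<close>
    the exponent \<open>(\<alpha> - 1) * E\<close> then collapses to
    \<open>- \<alpha> * (\<alpha> - 1) * (\<alpha> ^ k - 1)\<close>.\<close>
  define k where "k = totient q"
  define P where "P = a ^ k"
  have "[a ^ k = 1] (mod q)" unfolding k_def by (rule euler_theorem) fact
  then have "int q dvd \<alpha> ^ k - 1" unfolding a[symmetric]
    by (metis cong_iff_dvd_diff cong_int_iff of_nat_1 of_nat_power)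
  moreover have P: "int P = \<alpha> ^ k" unfolding P_def by (simp add: a)
  moreover have "P \<ge> 1" using pos by (simp add: P_def a_def Suc_le_eq)
  ultimately have "q dvd P - 1" by (metis int_dvd_int_iff of_nat_1 of_nat_diff)
  then have "int p dvd \<alpha> ^ (P - 1) - 1" by (simp add: q_iff)
  then have "int p dvd \<alpha> * (\<alpha> ^ (P - 1) - 1)" by simp
  then have aP: "int p dvd \<alpha> ^ P - \<alpha>"
    using \<open>P \<ge> 1\<close> by (simp add: right_diff_distrib flip: power_Suc)
  define E where "E = \<alpha> * geom \<alpha> P - \<alpha> ^ (P + k)"
  have "A [^] ((\<alpha> - 1) * ((\<alpha> - 1) * E)) = \<one>"
    unfolding E_def using pos by (intro A_central_power(2)[OF P, of "nat (\<beta> ^ k)"]) simp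
  then have "int N dvd (\<alpha> - 1) * ((\<alpha> - 1) * E)" unfolding N_def by (subst (asm) int_pow_eq_id) simp_all
  then have "int p dvd (\<alpha> - 1) * ((\<alpha> - 1) * E)" using p(2) N_def by (meson dvd_trans int_dvd_int_iff)
  moreover have pp: "Factorial_Ring.prime (int p)" using p(1) by simp
  ultimately have "int p dvd (\<alpha> - 1) * E" using np by (auto simp: prime_dvd_mult_iff)
  moreover have "(\<alpha> - 1) * E = \<alpha> * (\<alpha> ^ P - 1) - (\<alpha> - 1) * (\<alpha> ^ P * \<alpha> ^ k)"
    unfolding E_def geom_mult[symmetric] by (simp add: algebra_simps power_add)
  moreover have "\<dots> = (\<alpha> ^ P - \<alpha>) * (\<alpha> - (\<alpha> - 1) * \<alpha> ^ k) - \<alpha> * ((\<alpha> - 1) * (\<alpha> ^ k - 1))"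
    by (simp add: algebra_simps)
  ultimately have "int p dvd (\<alpha> ^ P - \<alpha>) * (\<alpha> - (\<alpha> - 1) * \<alpha> ^ k) - \<alpha> * ((\<alpha> - 1) * (\<alpha> ^ k - 1))"
    by simp
  moreover have "int p dvd (\<alpha> ^ P - \<alpha>) * (\<alpha> - (\<alpha> - 1) * \<alpha> ^ k)" using aP by simp
  ultimately have "int p dvd \<alpha> * ((\<alpha> - 1) * (\<alpha> ^ k - 1))" using dvd_diff_right_iff by blast
  then have "int p dvd \<alpha> ^ k - 1"
    using np prime_dvd_ord_A_coprime[OF N p] pp by (auto simp: prime_dvd_mult_iff)
  then have "q dvd k" by (simp add: q_iff)
  moreover have "q > 0" using qN N N_def by (auto intro: Nat.gr0I)
  ultimately have "q = 1"
    unfolding k_def using totient_less[of q] dvd_imp_le[of q "totient q"] by (cases "q = 1") auto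
  then show False using q_iff[of 1] np by simp
qed

text \<open>Reduction to positive exponents: \<open>\<alpha> mod N + N\<close> is positive, defines
  the same power of \<open>A\<close>, and agrees with \<open>\<alpha>\<close> modulo every divisor
  of the order \<open>N\<close>.\<close>

lemma prime_dvd_ord_A:
  assumes N: "group.ord G A > 0" and M: "group.ord G B > 0"
    and p: "Factorial_Ring.prime p" "p dvd group.ord G A"
  shows "int p dvd \<alpha> - 1"
proof -
  define N where "N = int (group.ord G A)"
  define M where "M = int (group.ord G B)"
  have pos: "N > 0" "M > 0" using N M by (simp_all add: N_def M_def)
  have eq: "A [^] (\<alpha> mod N + N) = A [^] \<alpha>" "B [^] (\<beta> mod M + M) = B [^] \<beta>"
  proof -
    have "N dvd (\<alpha> mod N + N) - \<alpha>" "M dvd (\<beta> mod M + M) - \<beta>"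
      by (simp_all add: minus_mod_eq_mult_div[symmetric] mod_eq_dvd_iff[symmetric])
    moreover have "A [^] N = \<one>" "B [^] M = \<one>" by (simp_all add: N_def M_def int_pow_eq_id)
    ultimately show "A [^] (\<alpha> mod N + N) = A [^] \<alpha>" "B [^] (\<beta> mod M + M) = B [^] \<beta>"
      by (auto intro: int_pow_cong_mod)
  qed
  interpret m: macdonald G A B C "\<alpha> mod N + N" "\<beta> mod M + M"
    by (rule change_exponents) (rule eq)+
  have "\<alpha> mod N + N > 0" "\<beta> mod M + M > 0"
    using pos by (simp_all add: add_nonneg_pos)
  then have 1: "int p dvd \<alpha> mod N + N - 1"
    using m.prime_dvd_ord_A_pos[OF _ _ N p] by simp
  have "N dvd \<alpha> - \<alpha> mod N" "N dvd N" by (simp_all add: minus_mod_eq_mult_div)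
  then have "N dvd (\<alpha> - \<alpha> mod N) - N" by (rule dvd_diff)
  moreover have "int p dvd N" using p(2) by (simp add: N_def)
  ultimately have "int p dvd (\<alpha> - \<alpha> mod N) - N" by (metis dvd_trans)
  from dvd_add[OF 1 this] show ?thesis by simp
qed

lemma C_pow_ord_A_eq_1:
  assumes "group.ord G A > 0" "group.ord G B > 0"
  shows "C [^] (int (group.ord G A)) = \<one>"
proof -
  have "int (group.ord G A) dvd geom \<alpha> (group.ord G A)"
    using dvd_geom_self prime_dvd_ord_A assms by blast
  then have "A [^] (\<alpha> * geom \<alpha> (group.ord G A)) = \<one>" by (subst int_pow_eq_id) simp_all
  then show ?thesis using C_pow_ord_A by simp
qed

end

section \<open>Splitting off the Sylow 2-subgroup\<close>

context group
begin

lemma inv_cancel_left: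
  "x \<in> carrier G \<Longrightarrow> w \<in> carrier G \<Longrightarrow> inv x \<otimes> (x \<otimes> w) = w"
  "x \<in> carrier G \<Longrightarrow> w \<in> carrier G \<Longrightarrow> x \<otimes> (inv x \<otimes> w) = w"
  by (simp_all flip: m_assoc)

lemma mem_set_multI: "x \<in> H \<Longrightarrow> y \<in> K \<Longrightarrow> x \<otimes> y \<in> H <#> K"
  by (auto simp: set_mult_def)

lemma mem_set_multE:
  assumes "z \<in> H <#> K" obtains x y where "x \<in> H" "y \<in> K" "z = x \<otimes> y"
  using assms by (auto simp: set_mult_def)

text \<open>All fibres of the multiplication map on \<open>H \<times> K\<close> are in bijection
  with \<open>H \<inter> K\<close>; the product set itself may fail to be a subgroup.\<close>

lemma card_set_mult_dvd:
  assumes H: "subgroup H G" and K: "subgroup K G" and fin: "finite H" "finite K"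
  shows "card (H <#> K) dvd card H * card K"
proof -
  interpret H: subgroup H G by fact
  interpret K: subgroup K G by fact
  let ?f = "\<lambda>(h, k). h \<otimes> k"
  have im: "H <#> K = ?f ` (H \<times> K)" by (auto simp: set_mult_def)
  have fib: "card {x \<in> H \<times> K. ?f x = z} = card (H \<inter> K)" if "z \<in> H <#> K" for z
  proof -
    from that obtain h k where hk: "h \<in> H" "k \<in> K" "z = h \<otimes> k" by (auto simp: set_mult_def)
    have "bij_betw (\<lambda>d. (h \<otimes> d, inv d \<otimes> k)) (H \<inter> K) {x \<in> H \<times> K. ?f x = z}"
    proof (rule bij_betw_byWitness[where f' = "\<lambda>(a, b). inv h \<otimes> a"])
      show "\<forall>d\<in>H \<inter> K. (\<lambda>(a, b). inv h \<otimes> a) (h \<otimes> d, inv d \<otimes> k) = d"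
        using hk by (auto simp: m_assoc[symmetric])
      show "(\<lambda>d. (h \<otimes> d, inv d \<otimes> k)) ` (H \<inter> K) \<subseteq> {x \<in> H \<times> K. ?f x = z}"
        using hk by (auto simp: m_assoc) (auto simp: m_assoc[symmetric])
      have *: "inv h \<otimes> a = k \<otimes> inv b" if "a \<in> H" "b \<in> K" "a \<otimes> b = h \<otimes> k" for a b
        using that hk by (metis H.mem_carrier K.mem_carrier inv_closed inv_solve_left inv_solve_right m_assoc m_closed)
      show "\<forall>x\<in>{x \<in> H \<times> K. ?f x = z}. (h \<otimes> (case x of (a, b) \<Rightarrow> inv h \<otimes> a), inv (case x of (a, b) \<Rightarrow> inv h \<otimes> a) \<otimes> k) = x"
      proof
        fix x assume "x \<in> {x \<in> H \<times> K. ?f x = z}"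
        then obtain a b where x: "x = (a, b)" and ab: "a \<in> H" "b \<in> K" "a \<otimes> b = h \<otimes> k"
          using hk(3) by auto
        have "inv (k \<otimes> inv b) \<otimes> k = b" using ab hk by (simp add: inv_mult_group m_assoc)
        moreover have "h \<otimes> (inv h \<otimes> a) = a" using ab hk by (simp add: m_assoc[symmetric])
        ultimately show "(h \<otimes> (case x of (a, b) \<Rightarrow> inv h \<otimes> a), inv (case x of (a, b) \<Rightarrow> inv h \<otimes> a) \<otimes> k) = x"
          using *[OF ab] by (simp add: x)
      qed
      show "(\<lambda>(a, b). inv h \<otimes> a) ` {x \<in> H \<times> K. ?f x = z} \<subseteq> H \<inter> K"
      proof
        fix w assume "w \<in> (\<lambda>(a, b). inv h \<otimes> a) ` {x \<in> H \<times> K. ?f x = z}"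
        then obtain a b where w: "w = inv h \<otimes> a" and ab: "a \<in> H" "b \<in> K" "a \<otimes> b = h \<otimes> k"
          using hk(3) by auto
        have "k \<otimes> inv b \<in> K" "inv h \<otimes> a \<in> H" using ab hk by simp_all
        then show "w \<in> H \<inter> K" using *[OF ab] w by simp
      qed
    qed
    then show ?thesis by (simp add: bij_betw_same_card)
  qed
  have "card H * card K = card (H \<times> K)" by (simp add: card_cartesian_product)
  also have "\<dots> = (\<Sum>z\<in>H <#> K. card {x \<in> H \<times> K. ?f x = z})"
    using sum.image_gen[OF finite_cartesian_product[OF fin], of "\<lambda>_. 1::nat" ?f] unfolding im by simp
  also have "\<dots> = card (H <#> K) * card (H \<inter> K)" using fib by simp
  finally show ?thesis by simp
qed

text \<open>Taking inverses turns one inclusion between the two products into the other, so a single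
  commutation rule suffices.\<close>

lemma subgroup_set_mult:
  assumes H: "subgroup H G" and K: "subgroup K G" and sub: "H <#> K \<subseteq> K <#> H"
  shows "subgroup (K <#> H) G" and "H <#> K = K <#> H"
proof -
  interpret H: subgroup H G by fact
  interpret K: subgroup K G by fact
  have "k \<otimes> h \<in> H <#> K" if "k \<in> K" "h \<in> H" for k h
  proof -
    have "inv h \<otimes> inv k \<in> H <#> K" using that by (auto simp: set_mult_def)
    with sub have "inv h \<otimes> inv k \<in> K <#> H" by blast
    then obtain k' h' where "k' \<in> K" "h' \<in> H" "inv h \<otimes> inv k = k' \<otimes> h'" by (auto simp: set_mult_def)
    moreover from this have "k \<otimes> h = inv h' \<otimes> inv k'"
      using that by (metis H.mem_carrier K.mem_carrier inv_closed inv_inv inv_mult_group)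
    ultimately show ?thesis by (auto simp: set_mult_def)
  qed
  then have "K <#> H \<subseteq> H <#> K" by (auto simp: set_mult_def)
  with sub show eq: "H <#> K = K <#> H" by simp
  show "subgroup (K <#> H) G"
  proof (rule subgroupI)
    show "K <#> H \<subseteq> carrier G" by (auto simp: set_mult_def)
    show "K <#> H \<noteq> {}" using H.one_closed K.one_closed unfolding set_mult_def by blast
    fix x assume "x \<in> K <#> H"
    then obtain k h where "k \<in> K" "h \<in> H" "x = k \<otimes> h" by (auto simp: set_mult_def)
    then have "inv x \<in> H <#> K" by (auto simp: set_mult_def inv_mult_group)
    then show "inv x \<in> K <#> H" by (simp add: eq)
    fix y assume "y \<in> K <#> H"
    then obtain k2 h2 where 2: "k2 \<in> K" "h2 \<in> H" "y = k2 \<otimes> h2" by (auto simp: set_mult_def)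
    have "h \<otimes> k2 \<in> K <#> H" using mem_set_multI[OF \<open>h \<in> H\<close> 2(1)] unfolding eq .
    then obtain k3 h3 where 3: "k3 \<in> K" "h3 \<in> H" "h \<otimes> k2 = k3 \<otimes> h3" by (auto simp: set_mult_def)
    have "x \<otimes> y = k \<otimes> (h \<otimes> k2) \<otimes> h2" using \<open>x = k \<otimes> h\<close> 2 \<open>k \<in> K\<close> \<open>h \<in> H\<close> by (simp add: m_assoc)
    also have "\<dots> = (k \<otimes> k3) \<otimes> (h3 \<otimes> h2)" using 3 \<open>k \<in> K\<close> 2 by (simp add: m_assoc)
    finally show "x \<otimes> y \<in> K <#> H" using 3 2 \<open>k \<in> K\<close> by (auto simp: set_mult_def)
  qed
qed

definition cyc :: "'a \<Rightarrow> 'a set" where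
  "cyc x = range (\<lambda>i::int. x [^] i)"

lemma cyc_eq_generate: "x \<in> carrier G \<Longrightarrow> cyc x = generate G {x}"
  by (auto simp: cyc_def generate_pow)

lemma cyc_subgroup: "x \<in> carrier G \<Longrightarrow> subgroup (cyc x) G"
  by (simp add: cyc_eq_generate generate_is_subgroup)

lemma cyc_finite_card:
  assumes "x \<in> carrier G" "x [^] (n::nat) = \<one>" "n > 0"
  shows "finite (cyc x)" "card (cyc x) dvd n"
proof -
  have "group.ord G x dvd n" using assms by (simp add: pow_eq_id)
  moreover have c: "group.ord G x = card (cyc x)"
    using assms(1) by (simp add: cyc_eq_generate generate_pow_card)
  ultimately show "card (cyc x) dvd n" by simp
  then show "finite (cyc x)" using assms(3) by (metis card.infinite dvd_0_left less_irrefl)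
qed

lemma cyc_inv: "x \<in> carrier G \<Longrightarrow> cyc (inv x) = cyc x"
proof -
  assume x: "x \<in> carrier G"
  have "cyc (inv x) \<subseteq> cyc x" if "x \<in> carrier G" for x
    using that by (auto simp: cyc_def int_pow_inv simp flip: int_pow_neg)
  from this[OF x] this[of "inv x"] show ?thesis using x by simp
qed

text \<open>Conjugation by a generator maps the finite set \<open>S\<close> injectively into itself,
  hence onto itself; so only one direction of conjugation has to be tested.\<close>

lemma normal_of_generators:
  assumes S: "subgroup S G" "finite S" and gen: "carrier G = generate G T" "T \<subseteq> carrier G"
    and inv: "\<And>t x. t \<in> T \<Longrightarrow> x \<in> S \<Longrightarrow> inv t \<otimes> x \<otimes> t \<in> S"
  shows "S \<lhd> G"
proof -
  interpret S: subgroup S G by fact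
  define N where "N = {g \<in> carrier G. \<forall>x\<in>S. inv g \<otimes> x \<otimes> g \<in> S}"
  have "subgroup N G"
  proof (rule subgroupI)
    show "N \<subseteq> carrier G" by (auto simp: N_def)
    show "N \<noteq> {}" unfolding N_def by (rule ex_in_conv[THEN iffD1], rule exI[of _ \<one>]) auto
    fix g assume g: "g \<in> N"
    then have gc: "g \<in> carrier G" by (simp add: N_def)
    have "inj_on (\<lambda>x. inv g \<otimes> x \<otimes> g) S" using gc by (auto simp: inj_on_def)
    moreover have "(\<lambda>x. inv g \<otimes> x \<otimes> g) ` S \<subseteq> S" using g by (auto simp: N_def)
    ultimately have im: "(\<lambda>x. inv g \<otimes> x \<otimes> g) ` S = S" using S(2) by (simp add: endo_inj_surj)
    have "g \<otimes> x \<otimes> inv g \<in> S" if "x \<in> S" for x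
    proof -
      from that im obtain y where y: "y \<in> S" "x = inv g \<otimes> y \<otimes> g" by blast
      then have "g \<otimes> x \<otimes> inv g = y"
        using gc S.mem_carrier by (simp add: m_assoc inv_cancel_left)
      then show ?thesis using y by simp
    qed
    then show "inv g \<in> N" using gc by (simp add: N_def)
    fix h assume h: "h \<in> N"
    then have hc: "h \<in> carrier G" by (simp add: N_def)
    have "inv (g \<otimes> h) \<otimes> x \<otimes> (g \<otimes> h) = inv h \<otimes> (inv g \<otimes> x \<otimes> g) \<otimes> h" if "x \<in> S" for x
      using that gc hc by (simp add: inv_mult_group m_assoc)
    then show "g \<otimes> h \<in> N" using g h gc hc by (simp add: N_def)
  qed
  moreover have "T \<subseteq> N" using inv gen(2) by (auto simp: N_def)
  ultimately have "carrier G \<subseteq> N" unfolding gen(1) by (rule generate_subgroup_incl[rotated])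
  then have *: "inv g \<otimes> x \<otimes> g \<in> S" if "g \<in> carrier G" "x \<in> S" for g x using that by (auto simp: N_def)
  show ?thesis by (intro normal_invI S) (metis * inv_closed inv_inv)
qed

lemma normal_disjoint_commute:
  assumes P: "P \<lhd> G" and Q: "Q \<lhd> G" and PQ: "P \<inter> Q = {\<one>}" and xy: "x \<in> P" "y \<in> Q"
  shows "x \<otimes> y = y \<otimes> x"
proof -
  interpret P: normal P G by fact
  interpret Q: normal Q G by fact
  have [simp]: "x \<in> carrier G" "y \<in> carrier G" using xy by auto
  have "x \<otimes> (y \<otimes> inv x \<otimes> inv y) \<in> P"
    using xy P.inv_op_closed2[of y "inv x"] by simp
  moreover have "(x \<otimes> y \<otimes> inv x) \<otimes> inv y \<in> Q"
    using xy Q.inv_op_closed2[of x y] by simp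
  ultimately have "x \<otimes> y \<otimes> inv x \<otimes> inv y \<in> P \<inter> Q" by (simp add: m_assoc)
  then have "x \<otimes> y \<otimes> inv x \<otimes> inv y = \<one>" using PQ by simp
  then show ?thesis
    by (metis \<open>x \<in> carrier G\<close> \<open>y \<in> carrier G\<close> inv_closed inv_solve_right l_one m_closed one_closed)
qed

end

section \<open>Decomposition into a normal 2-group and a normal group of odd order\<close>

locale two_part_decomposition = group G for G (structure) +
  fixes P Q :: "'a set" and e :: nat
  assumes P: "P \<lhd> G" and Q: "Q \<lhd> G"
    and cP: "card P = 2 ^ e" and cQ: "odd (card Q)"
    and PQ: "\<And>g. g \<in> carrier G \<Longrightarrow> \<exists>x\<in>P. \<exists>y\<in>Q. g = x \<otimes> y"
begin

sublocale P: normal P G by (rule P)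
sublocale Q: normal Q G by (rule Q)

lemma finite_P: "finite P" using cP by (metis card.infinite power_eq_0_iff zero_neq_numeral)
lemma finite_Q: "finite Q" using cQ by (metis card.infinite even_zero)

lemma ord_dvd_card:
  assumes "subgroup H G" "finite H" "x \<in> H" shows "group.ord G x dvd card H"
proof -
  interpret H: subgroup H G by fact
  interpret HG: group "G\<lparr>carrier := H\<rparr>" by (rule H.subgroup_is_group) (rule is_group)
  have "x [^] card H = x [^]\<^bsub>G\<lparr>carrier := H\<rparr>\<^esub> card H" by (rule nat_pow_consistent)
  also have "\<dots> = \<one>" using HG.pow_order_eq_1[of x] assms(2,3) by (simp add: order_def)
  finally show ?thesis using assms(3) by (simp add: pow_eq_id[symmetric])
qed

lemma ord_P: "x \<in> P \<Longrightarrow> \<exists>k. group.ord G x = 2 ^ k"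
  using ord_dvd_card[OF P.subgroup_axioms finite_P] cP
  by (metis divides_primepow_nat two_is_prime_nat)

lemma ord_Q: "y \<in> Q \<Longrightarrow> odd (group.ord G y)"
  using ord_dvd_card[OF Q.subgroup_axioms finite_Q] cQ by (metis dvd_trans)

lemma eq_one_of_pow:
  assumes "y \<in> carrier G" "odd (group.ord G y)" "y [^] (2 ^ k :: nat) = \<one>" shows "y = \<one>"
proof -
  have "group.ord G y dvd 2 ^ k" using assms(1,3) by (simp add: pow_eq_id)
  then have "group.ord G y = 1" using assms(2) by (metis divides_primepow_nat even_power power_0 two_is_prime_nat dvd_refl gr0I)
  then show ?thesis using assms(1) ord_eq_1 by blast
qed

lemma P_Int_Q: "P \<inter> Q = {\<one>}"
proof -
  have "x = \<one>" if "x \<in> P" "x \<in> Q" for x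
  proof -
    have c: "x \<in> carrier G" using that by auto
    from ord_P[OF that(1)] obtain k where "group.ord G x = 2 ^ k" by auto
    then have "x [^] (2 ^ k :: nat) = \<one>" by (metis c pow_ord_eq_1)
    then show ?thesis using eq_one_of_pow[OF c ord_Q[OF that(2)]] by simp
  qed
  then show ?thesis by auto
qed

lemma PQ_commute: "x \<in> P \<Longrightarrow> y \<in> Q \<Longrightarrow> x \<otimes> y = y \<otimes> x"
  by (rule normal_disjoint_commute[OF P Q P_Int_Q])

lemma PQ_unique:
  assumes "x \<in> P" "y \<in> Q" "x' \<in> P" "y' \<in> Q" "x \<otimes> y = x' \<otimes> y'"
  shows "x = x'" "y = y'"
proof -
  have c: "x \<in> carrier G" "y \<in> carrier G" "x' \<in> carrier G" "y' \<in> carrier G" using assms by auto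
  have "inv x' \<otimes> x = y' \<otimes> inv y"
    using assms(5) c by (metis inv_closed inv_solve_left inv_solve_right m_assoc m_closed)
  then have "inv x' \<otimes> x \<in> P \<inter> Q" using assms by (metis IntI P.m_closed P.m_inv_closed Q.m_closed Q.m_inv_closed)
  then have "inv x' \<otimes> x = \<one>" using P_Int_Q by simp
  then show "x = x'" using c by (metis inv_closed inv_equality inv_inv)
  then show "y = y'" using assms(5) c by simp
qed

lemma sylow2_set_eq: "sylow2_set G = P"
proof -
  have "g \<in> P" if g: "g \<in> carrier G" "group.ord G g = 2 ^ k" for g k
  proof -
    obtain x y where xy: "x \<in> P" "y \<in> Q" "g = x \<otimes> y" using PQ[OF g(1)] by blast
    have c: "x \<in> carrier G" "y \<in> carrier G" using xy by auto
    have "g [^] (2 ^ k :: nat) = \<one>" using g by (metis pow_ord_eq_1)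
    then have "x [^] (2 ^ k :: nat) \<otimes> y [^] (2 ^ k :: nat) = \<one> \<otimes> \<one>"
      using xy c by (simp add: pow_mult_distrib[OF PQ_commute])
    moreover have "x [^] (2 ^ k :: nat) \<in> P" "y [^] (2 ^ k :: nat) \<in> Q"
      using xy subgroup_int_pow_closed[OF P.subgroup_axioms] subgroup_int_pow_closed[OF Q.subgroup_axioms]
      by (metis int_pow_int)+
    ultimately have "y [^] (2 ^ k :: nat) = \<one>"
      using PQ_unique(2)[of "x [^] (2 ^ k :: nat)" "y [^] (2 ^ k :: nat)" \<one> \<one>] by auto
    then have "y = \<one>" using eq_one_of_pow ord_Q xy c by blast
    then show ?thesis using xy c by simp
  qed
  then show ?thesis using ord_P P.mem_carrier by (auto simp: sylow2_set_def)
qed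

lemma odd_part_set_eq: "odd_part_set G = Q"
proof -
  have "g \<in> Q" if g: "g \<in> carrier G" "odd (group.ord G g)" for g
  proof -
    obtain x y where xy: "x \<in> P" "y \<in> Q" "g = x \<otimes> y" using PQ[OF g(1)] by blast
    have c: "x \<in> carrier G" "y \<in> carrier G" using xy by auto
    define n where "n = group.ord G g"
    have "g [^] n = \<one>" using g by (simp add: n_def)
    then have "x [^] n \<otimes> y [^] n = \<one> \<otimes> \<one>"
      using xy c by (simp add: pow_mult_distrib[OF PQ_commute])
    moreover have "x [^] n \<in> P" "y [^] n \<in> Q"
      using xy subgroup_int_pow_closed[OF P.subgroup_axioms] subgroup_int_pow_closed[OF Q.subgroup_axioms]
      by (metis int_pow_int)+
    ultimately have "x [^] n = \<one>"
      using PQ_unique(1)[of "x [^] n" "y [^] n" \<one> \<one>] by auto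
    then have "group.ord G x dvd n" using c by (simp add: pow_eq_id)
    moreover obtain k where k: "group.ord G x = 2 ^ k" using ord_P[OF xy(1)] by auto
    ultimately have "k = 0" using g(2) unfolding n_def by (metis dvd_trans even_power dvd_refl gr0I)
    then have "x = \<one>" using k c ord_eq_1 by (metis power_0)
    then show ?thesis using xy c by simp
  qed
  then show ?thesis using ord_Q Q.mem_carrier by (auto simp: odd_part_set_def)
qed

lemma proj2_eq:
  assumes "x \<in> P" "y \<in> Q" shows "proj2 G (x \<otimes> y) = x"
  unfolding proj2_def sylow2_set_eq odd_part_set_eq
  by (rule the_equality) (use assms PQ_unique in blast)+

end

locale macdonald_part = macdonald +
  fixes s s' n :: nat
  assumes ord_A: "group.ord G A > 0" and ord_B: "group.ord G B > 0"
    and A_dvd: "group.ord G A dvd s * s'" and B_dvd: "group.ord G B dvd s * s'"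
    and coprime: "coprime s s'" and n1: "int s dvd int n - 1" and n0: "s' dvd n"
begin

abbreviation "a \<equiv> A [^] int n"
abbreviation "b \<equiv> B [^] int n"
abbreviation "c \<equiv> C [^] int n"

text \<open>Since \<open>n\<close> is 1 modulo \<open>s\<close> and 0 modulo \<open>s'\<close>, the
  elements \<open>a\<close>, \<open>b\<close>, \<open>c\<close> are the \<open>s\<close>-parts of
  \<open>A\<close>, \<open>B\<close>, \<open>C\<close>. The construction serves twice: with
  \<open>s\<close> the 2-part and with \<open>s\<close> the odd part of the product of the two
  orders.\<close>

definition "S = cyc b <#> (cyc c <#> cyc a)"

lemma swapped_part: "macdonald_part G B A (inv C) \<beta> \<alpha> s s' n"
  by (intro macdonald_part.intro swapped macdonald_part_axioms.intro ord_A ord_B A_dvd B_dvd coprime n1 n0)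

text \<open>The order of \<open>A\<close> divides the product of its common divisors with
  \<open>s\<close> and \<open>s'\<close>. The first divides \<open>n - 1\<close> and the second
  divides \<open>x\<close>, so \<open>A^x = A^(n x)\<close>.\<close>

lemma A_pow_mem:
  assumes "int (gcd (group.ord G A) s') dvd x"
  shows "A [^] x \<in> cyc a"
proof -
  let ?N = "group.ord G A"
  obtain d d' where xy: "?N = d * d'" "d dvd s" "d' dvd s'" using division_decomp[OF A_dvd] by blast
  then have "d dvd gcd ?N s" "d' dvd gcd ?N s'" by auto
  then have "?N dvd gcd ?N s * gcd ?N s'" using xy(1) by (metis mult_dvd_mono)
  then have "int ?N dvd int (gcd ?N s) * int (gcd ?N s')" by (metis int_dvd_int_iff of_nat_mult)
  moreover have "int (gcd ?N s) dvd int n - 1"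
    using n1 by (meson dvd_trans gcd_dvd2 int_dvd_int_iff)
  ultimately have "int ?N dvd (int n - 1) * x" using assms by (meson dvd_trans mult_dvd_mono)
  then have "int ?N dvd int n * x - x" by (simp add: left_diff_distrib)
  then have "A [^] (int n * x) = A [^] x"
    by (intro int_pow_cong_mod[of A "int ?N"]) (simp_all add: int_pow_eq_id)
  then have "A [^] x = a [^] x" by (simp add: int_pow_pow)
  then show ?thesis by (auto simp: cyc_def)
qed

lemma C_pow_A: "C [^] int (group.ord G A) = \<one>"
  by (rule C_pow_ord_A_eq_1[OF ord_A ord_B])

lemma a_pow_s: "a [^] s = \<one>" and c_pow_s: "c [^] s = \<one>"
proof -
  have d: "int (group.ord G A) dvd int n * int s"
    using A_dvd n0 by (metis dvd_trans dvd_refl int_dvd_int_iff mult.commute mult_dvd_mono of_nat_mult)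
  have "A [^] (int n * int s) = \<one>" by (subst int_pow_eq_id) (use d in simp_all)
  then show "a [^] s = \<one>" by (simp add: int_pow_pow flip: int_pow_int)
  have "C [^] (int n * int s) = C [^] (0::int)"
    by (rule int_pow_cong_mod[OF C C_pow_A]) (use d in simp)
  then show "c [^] s = \<one>" by (simp add: int_pow_pow flip: int_pow_int)
qed

text \<open>The commutation rules for powers of \<open>C\<close> contain \<open>\<alpha>^k\<close>
  or \<open>\<beta>^k\<close> and are available for natural \<open>k\<close> only; finite order
  makes every exponent natural.\<close>

lemma c_pow_nat: obtains t where "c [^] (k::int) = C [^] int (n * t)"
proof
  let ?N = "int (group.ord G A)"
  have "c [^] k = c [^] (k mod ?N)"
  proof (rule int_pow_cong_mod[of c ?N])
    have "c [^] ?N = (C [^] ?N) [^] int n" by (simp add: int_pow_pow mult.commute)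
    then show "c [^] ?N = \<one>" by (simp add: C_pow_A)
  qed (simp_all add: minus_mod_eq_mult_div)
  also have "k mod ?N = int (nat (k mod ?N))" using ord_A by simp
  finally show "c [^] k = C [^] int (n * nat (k mod ?N))" by (simp add: int_pow_pow)
qed

lemma b_pow_nat: obtains t where "b [^] (j::int) = B [^] int t"
proof
  let ?M = "int (group.ord G B)"
  have "b [^] j = b [^] (j mod ?M)"
  proof (rule int_pow_cong_mod[of b ?M])
    have "b [^] ?M = (B [^] ?M) [^] int n" by (simp add: int_pow_pow mult.commute)
    then show "b [^] ?M = \<one>" by (simp add: int_pow_int)
  qed (simp_all add: minus_mod_eq_mult_div)
  also have "j mod ?M = int (nat (j mod ?M))" using ord_B by simp
  finally show "b [^] j = B [^] int (n * nat (j mod ?M))" by (simp add: int_pow_pow)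
qed

lemma a_c_subset: "cyc a <#> cyc c \<subseteq> cyc c <#> cyc a"
proof
  fix z assume "z \<in> cyc a <#> cyc c"
  then obtain i k where z: "z = a [^] (i::int) \<otimes> c [^] (k::int)"
    by (auto simp: cyc_def elim: mem_set_multE)
  obtain t where t: "c [^] k = C [^] int (n * t)" by (rule c_pow_nat)
  have "z = c [^] k \<otimes> a [^] (\<alpha> ^ (n * t) * i)"
    unfolding z t by (simp only: int_pow_pow A A_Cn mult.left_commute)
  then show "z \<in> cyc c <#> cyc a" by (auto simp: cyc_def intro: mem_set_multI)
qed

lemma cyc_sub: "subgroup (cyc a) G" "subgroup (cyc b) G" "subgroup (cyc c) G"
  by (simp_all add: cyc_subgroup)

lemma H_sub: "subgroup (cyc c <#> cyc a) G"
  by (rule subgroup_set_mult(1)[OF cyc_sub(1,3) a_c_subset])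

text \<open>In \<open>A^n B = B C^n A^(\<alpha> * geom \<alpha> n)\<close> the last exponent is
  divisible by the \<open>s'\<close>-part of the order of \<open>A\<close>, because
  \<open>s'\<close> divides \<open>n\<close> and the primes involved divide
  \<open>\<alpha> - 1\<close>. So moving \<open>a\<close> past \<open>B\<close> does not lead out of
  the \<open>s\<close>-parts.\<close>

lemma a_B: obtains h where "h \<in> cyc c <#> cyc a" "a \<otimes> B = B \<otimes> h"
proof
  have "int (gcd (group.ord G A) s') dvd geom \<alpha> n"
  proof (rule dvd_geom(1))
    show "int p dvd \<alpha> - 1" if "Factorial_Ring.prime p" "p dvd gcd (group.ord G A) s'" for p
      using prime_dvd_ord_A[OF ord_A ord_B that(1)] that(2) by simp
    show "gcd (group.ord G A) s' dvd n" using n0 by (meson dvd_trans gcd_dvd2)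
  qed (use ord_A in simp)
  then have "A [^] (\<alpha> * geom \<alpha> n) \<in> cyc a" by (intro A_pow_mem) simp
  moreover have "c \<in> cyc c" unfolding cyc_def by (metis C UNIV_I image_eqI int_pow_1 int_pow_closed)
  ultimately show "c \<otimes> A [^] (\<alpha> * geom \<alpha> n) \<in> cyc c <#> cyc a" by (rule mem_set_multI[rotated])
  show "a \<otimes> B = B \<otimes> (c \<otimes> A [^] (\<alpha> * geom \<alpha> n))" by (rule An_B)
qed

lemma c_B: obtains b' where "b' \<in> cyc b" "c [^] (k::int) \<otimes> B = B \<otimes> (b' \<otimes> c [^] k)"
proof -
  obtain t where t: "c [^] k = C [^] int (n * t)" by (rule c_pow_nat)
  interpret sw: macdonald_part G B A "inv C" \<beta> \<alpha> s s' n by (rule swapped_part)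
  have "int (gcd (group.ord G B) s') dvd \<beta> ^ (n * t) - 1"
  proof (rule dvd_geom(2))
    show "int p dvd \<beta> - 1" if "Factorial_Ring.prime p" "p dvd gcd (group.ord G B) s'" for p
      using sw.prime_dvd_ord_A[OF ord_B ord_A that(1)] that(2) by simp
    show "gcd (group.ord G B) s' dvd n * t" using n0 by (meson dvd_trans gcd_dvd2 dvd_mult2)
  qed (use ord_B in simp)
  then have "B [^] (\<beta> ^ (n * t) - 1) \<in> cyc b" by (rule sw.A_pow_mem)
  moreover have "c [^] k \<otimes> B = B \<otimes> (B [^] (\<beta> ^ (n * t) - 1) \<otimes> c [^] k)"
  proof -
    have "c [^] k \<otimes> B [^] (1::int) = B [^] (1 + (\<beta> ^ (n * t) - 1)) \<otimes> c [^] k"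
      unfolding t by (simp only: Cn_B) simp
    then show ?thesis unfolding int_pow_mult[OF B] by (simp add: m_assoc)
  qed
  ultimately show thesis using that by blast
qed

lemma b_absorb: "x \<in> cyc b \<Longrightarrow> y \<in> S \<Longrightarrow> x \<otimes> y \<in> S"
proof -
  interpret b: subgroup "cyc b" G by (rule cyc_sub)
  interpret H: subgroup "cyc c <#> cyc a" G by (rule H_sub)
  assume x: "x \<in> cyc b" and "y \<in> S"
  then obtain b' h where "b' \<in> cyc b" "h \<in> cyc c <#> cyc a" "y = b' \<otimes> h"
    unfolding S_def by (auto elim: mem_set_multE)
  then show ?thesis using x unfolding S_def
    by (metis H.mem_carrier b.m_closed b.mem_carrier m_assoc mem_set_multI)
qed

lemma S_carrier: "y \<in> S \<Longrightarrow> y \<in> carrier G"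
  using cyc_sub H_sub unfolding S_def by (metis mem_set_multE m_closed subgroup.mem_carrier)

text \<open>\<open>B\<close> passes \<open>a\<close>, \<open>c\<close> and \<open>b\<close> in turn.
  The correction from \<open>c\<close> is a power of \<open>b\<close> and appears to its left, and
  the correction from \<open>a\<close> stays in the subgroup \<open>cyc c <#> cyc a\<close>, so the
  shape of \<open>S\<close> is preserved.\<close>

lemma S_B:
  assumes "x \<in> S" obtains y where "y \<in> S" "x \<otimes> B = B \<otimes> y"
proof -
  interpret b: subgroup "cyc b" G by (rule cyc_sub)
  interpret H: subgroup "cyc c <#> cyc a" G by (rule H_sub)
  obtain j k i where x: "x = b [^] (j::int) \<otimes> (c [^] (k::int) \<otimes> a [^] (i::int))"
    using assms unfolding S_def by (auto simp: cyc_def elim!: mem_set_multE)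
  obtain h where h: "h \<in> cyc c <#> cyc a" "a \<otimes> B = B \<otimes> h" by (rule a_B)
  obtain b' where b': "b' \<in> cyc b" "c [^] k \<otimes> B = B \<otimes> (b' \<otimes> c [^] k)" by (rule c_B)
  have hc: "h \<in> carrier G" "b' \<in> carrier G" using h b' by auto
  have ai: "a [^] i \<otimes> B = B \<otimes> h [^] i" using conj_int_pow[OF h(2)] hc by simp
  have hi: "h [^] i \<in> cyc c <#> cyc a" using subgroup_int_pow_closed[OF H_sub h(1)] .
  have ck: "c [^] k \<in> cyc c <#> cyc a"
    using mem_set_multI[of "c [^] k" "cyc c" \<one> "cyc a"] subgroup.one_closed[OF cyc_sub(1)]
    by (auto simp: cyc_def)
  have bj: "b [^] j \<otimes> B = B \<otimes> b [^] j"
    using int_pow_mult[of B 1 "int n * j"] int_pow_mult[of B "int n * j" 1]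
    by (simp add: int_pow_pow add.commute)
  have "x \<otimes> B = b [^] j \<otimes> (c [^] k \<otimes> (a [^] i \<otimes> B))" unfolding x by (simp add: m_assoc)
  also have "\<dots> = b [^] j \<otimes> ((c [^] k \<otimes> B) \<otimes> h [^] i)" unfolding ai using hc by (simp add: m_assoc)
  also have "\<dots> = (b [^] j \<otimes> B) \<otimes> (b' \<otimes> (c [^] k \<otimes> h [^] i))" unfolding b' using hc by (simp add: m_assoc)
  also have "\<dots> = B \<otimes> (b [^] j \<otimes> b' \<otimes> (c [^] k \<otimes> h [^] i))" unfolding bj using hc by (simp add: m_assoc)
  finally have "x \<otimes> B = B \<otimes> (b [^] j \<otimes> b' \<otimes> (c [^] k \<otimes> h [^] i))" .
  moreover have "b [^] j \<otimes> b' \<in> cyc b" using b' by (simp add: cyc_def b.m_closed[unfolded cyc_def])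
  then have "b [^] j \<otimes> b' \<otimes> (c [^] k \<otimes> h [^] i) \<in> S"
    unfolding S_def using hi ck by (auto intro: mem_set_multI[of _ _ "c [^] k \<otimes> h [^] i"])
  ultimately show thesis using that by blast
qed

lemma S_Bn:
  assumes "x \<in> S" obtains y where "y \<in> S" "x \<otimes> B [^] int t = B [^] int t \<otimes> y"
proof -
  have "\<exists>y\<in>S. x \<otimes> B [^] int t = B [^] int t \<otimes> y"
  proof (induction t)
    case 0
    then show ?case using assms S_carrier by auto
  next
    case (Suc t)
    then obtain y where y: "y \<in> S" "x \<otimes> B [^] int t = B [^] int t \<otimes> y" by blast
    obtain z where z: "z \<in> S" "y \<otimes> B = B \<otimes> z" using S_B[OF y(1)] by blast
    have B: "B [^] int (Suc t) = B [^] int t \<otimes> B"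
      using int_pow_mult[of B "int t" 1] by (simp add: add.commute)
    have "x \<otimes> B [^] int (Suc t) = B [^] int t \<otimes> (y \<otimes> B)"
      unfolding B using assms y by (metis B S_carrier int_pow_closed m_assoc macdonald.B macdonald_axioms)
    also have "\<dots> = B [^] int (Suc t) \<otimes> z"
      unfolding B z(2) using z(1) S_carrier by (simp add: m_assoc)
    finally show ?case using z(1) by blast
  qed
  then show thesis using that by blast
qed

text \<open>This is the inclusion required by \<open>subgroup_set_mult\<close>: a power of
  \<open>b\<close> is a natural power of \<open>B\<close>, and elements of \<open>S\<close> move
  past it one \<open>B\<close> at a time.\<close>

lemma H_b_subset: "(cyc c <#> cyc a) <#> cyc b \<subseteq> S"
proof
  interpret b: subgroup "cyc b" G by (rule cyc_sub)
  interpret H: subgroup "cyc c <#> cyc a" G by (rule H_sub)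
  fix z assume "z \<in> (cyc c <#> cyc a) <#> cyc b"
  then obtain h j where h: "h \<in> cyc c <#> cyc a" and z: "z = h \<otimes> b [^] (j::int)"
    by (auto simp: cyc_def elim: mem_set_multE)
  obtain t where t: "b [^] j = B [^] int t" by (rule b_pow_nat)
  have "\<one> \<otimes> h \<in> S" unfolding S_def using h by (intro mem_set_multI) auto
  then have "h \<in> S" using h by simp
  then obtain y where y: "y \<in> S" "h \<otimes> B [^] int t = B [^] int t \<otimes> y" by (rule S_Bn)
  have "b [^] j \<in> cyc b" by (simp add: cyc_def)
  then show "z \<in> S" unfolding z t y(2) using y(1) b_absorb t by simp
qed

lemma S_sub: "subgroup S G" and S_eq: "(cyc c <#> cyc a) <#> cyc b = S"
  using subgroup_set_mult[OF H_sub cyc_sub(2)] H_b_subset unfolding S_def by auto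

lemma S_finite: "finite S" and S_card: "s > 0 \<Longrightarrow> card S dvd s ^ 3"
proof -
  interpret sw: macdonald_part G B A "inv C" \<beta> \<alpha> s s' n by (rule swapped_part)
  have fa: "finite (cyc a)" and fb: "finite (cyc b)" and fc: "finite (cyc c)"
  proof -
    have *: "finite (cyc x)" if x: "x \<in> carrier G" "group.ord G x > 0" for x
      using cyc_finite_card(1)[of x "group.ord G x"] x by simp
    have p: "(x [^] int n) [^] (group.ord G A) = \<one>" if "x \<in> carrier G" "x [^] int (group.ord G A) = \<one>" for x
    proof -
      have "(x [^] int n) [^] int (group.ord G A) = (x [^] int (group.ord G A)) [^] int n"
        using that(1) by (simp only: int_pow_pow mult.commute)
      then show ?thesis using that(2) by (simp add: int_pow_int)
    qed
    show "finite (cyc a)" "finite (cyc c)"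
      using cyc_finite_card(1)[OF _ p ord_A] C_pow_A by (simp_all add: int_pow_eq_id)
    have "b [^] (group.ord G B) = \<one>"
    proof -
      have "b [^] int (group.ord G B) = (B [^] int (group.ord G B)) [^] int n"
        by (simp only: int_pow_pow mult.commute B)
      then show ?thesis by (simp add: int_pow_int)
    qed
    then show "finite (cyc b)" using cyc_finite_card(1)[of b] ord_B by simp
  qed
  have fm: "finite (U <#> V)" if "finite U" "finite V" for U V
    using that by (auto simp: set_mult_def)
  have fH: "finite (cyc c <#> cyc a)" by (rule fm[OF fc fa])
  show "finite S" unfolding S_def by (rule fm[OF fb fH])
  assume s: "s > 0"
  have "card (cyc a) dvd s" "card (cyc b) dvd s" "card (cyc c) dvd s"
    using cyc_finite_card(2)[OF _ a_pow_s s] cyc_finite_card(2)[OF _ sw.a_pow_s s] cyc_finite_card(2)[OF _ c_pow_s s]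
    by simp_all
  moreover have "card (cyc c <#> cyc a) dvd card (cyc c) * card (cyc a)"
    by (rule card_set_mult_dvd[OF cyc_sub(3,1) fc fa])
  moreover have "card S dvd card (cyc b) * card (cyc c <#> cyc a)"
    unfolding S_def by (rule card_set_mult_dvd[OF cyc_sub(2) H_sub fb fH])
  ultimately have "card S dvd s * (s * s)" by (meson dvd_trans mult_dvd_mono)
  then show "card S dvd s ^ 3" by (simp add: power3_eq_cube mult.assoc)
qed

text \<open>The three cyclic factors in reverse order form the same set, so invariance under
  \<open>A\<close> is the mirror image of invariance under \<open>B\<close>.\<close>

lemma S_swapped: "macdonald_part.S G B A (inv C) n = S"
proof -
  interpret sw: macdonald_part G B A "inv C" \<beta> \<alpha> s s' n by (rule swapped_part)
  have cc: "cyc (inv C [^] int n) = cyc c" by (simp add: int_pow_inv cyc_inv)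
  have sub: "cyc x \<subseteq> carrier G" if "x \<in> carrier G" for x
    using cyc_subgroup[OF that] by (rule subgroup.subset)
  have "sw.S = cyc a <#> (cyc c <#> cyc b)" unfolding sw.S_def cc ..
  also have "\<dots> = (cyc a <#> cyc c) <#> cyc b" by (simp add: set_mult_assoc sub)
  also have "cyc a <#> cyc c = cyc c <#> cyc a"
    by (rule subgroup_set_mult(2)[OF cyc_sub(1,3) a_c_subset])
  finally show ?thesis by (simp add: S_eq)
qed

lemma conj_B: "x \<in> S \<Longrightarrow> inv B \<otimes> x \<otimes> B \<in> S"
proof -
  assume x: "x \<in> S"
  then obtain y where y: "y \<in> S" "x \<otimes> B = B \<otimes> y" by (rule S_B)
  then have "inv B \<otimes> x \<otimes> B = y" using S_carrier x by (simp add: m_assoc inv_cancel_left)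
  then show ?thesis using y by simp
qed

lemma S_normal:
  assumes "carrier G = generate G {A, B}" shows "S \<lhd> G"
proof (rule normal_of_generators[OF S_sub S_finite assms])
  interpret sw: macdonald_part G B A "inv C" \<beta> \<alpha> s s' n by (rule swapped_part)
  show "inv t \<otimes> x \<otimes> t \<in> S" if "t \<in> {A, B}" "x \<in> S" for t x
    using that conj_B sw.conj_B[unfolded S_swapped] by auto
qed auto

lemma gens_mem_S: "a \<in> S" "b \<in> S" "c \<in> S"
proof -
  have self: "x \<in> cyc x" if "x \<in> carrier G" for x
    using that unfolding cyc_def by (metis UNIV_I image_eqI int_pow_1)
  have one: "\<one> \<in> cyc x" if "x \<in> carrier G" for x
    using cyc_subgroup[OF that] by (rule subgroup.one_closed)
  have "\<one> \<otimes> (\<one> \<otimes> a) \<in> S" "b \<otimes> (\<one> \<otimes> \<one>) \<in> S" "\<one> \<otimes> (c \<otimes> \<one>) \<in> S"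
    unfolding S_def by (intro mem_set_multI self one; simp)+
  then show "a \<in> S" "b \<in> S" "c \<in> S" by simp_all
qed

end

lemma chinese_idempotent:
  fixes s s' :: nat
  assumes "coprime s s'"
  obtains n where "int s dvd int n - 1" "s' dvd n"
proof -
  obtain n where n: "[n = 1] (mod s)" "[n = 0] (mod s')"
    using binary_chinese_remainder_nat[OF assms] by blast
  then have "[int n = int 1] (mod int s)" by (simp only: cong_int_iff)
  then show thesis using n(2) that by (auto simp: cong_iff_dvd_diff cong_0_iff)
qed

text \<open>The idempotents \<open>n\<close> and \<open>n'\<close> for the factors
  \<open>2 ^ t\<close> and \<open>r\<close> of \<open>L\<close> add up to 1 modulo \<open>L\<close>;
  hence the two normal products together contain the generators. Their orders divide
  \<open>(2 ^ t) ^ 3\<close> and \<open>r ^ 3\<close>.\<close>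

lemma (in macdonald) two_part_decomposition_exists:
  assumes ord_A: "group.ord G A > 0" and ord_B: "group.ord G B > 0"
    and gen: "carrier G = generate G {A, B}"
  obtains P Q e t n where "two_part_decomposition G P Q e"
    "A [^] int n \<in> P" "B [^] int n \<in> P" "C [^] int n \<in> P"
    "A [^] (1 - int n) \<in> Q" "B [^] (1 - int n) \<in> Q" "C [^] (1 - int n) \<in> Q"
    "(A [^] int n) [^] (2 ^ t :: nat) = \<one>" "(B [^] int n) [^] (2 ^ t :: nat) = \<one>" 
    "(C [^] int n) [^] (2 ^ t :: nat) = \<one>"
    "\<And>g. g \<in> P \<Longrightarrow> \<exists>(i::int) (j::int) (k::int). g = (B [^] int n) [^] i \<otimes> ((C [^] int n) [^] j \<otimes> (A [^] int n) [^] k)"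
proof -
  define L where "L = group.ord G A * group.ord G B"
  have "L > 0" using ord_A ord_B by (simp add: L_def)
  define t where "t = multiplicity 2 L"
  obtain r where r: "L = 2 ^ t * r" "odd r"
    using \<open>L > 0\<close> unfolding t_def by (metis multiplicity_decompose' not_gr_zero odd_one)
  have cop: "coprime (2 ^ t) r" "coprime r (2 ^ t)" using r(2) by simp_all
  obtain n where n: "int (2 ^ t) dvd int n - 1" "r dvd n" by (rule chinese_idempotent[OF cop(1)])
  obtain n' where n': "int r dvd int n' - 1" "2 ^ t dvd n'" by (rule chinese_idempotent[OF cop(2)])
  interpret p: macdonald_part G A B C \<alpha> \<beta> "2 ^ t" r n
    using ord_A ord_B cop n r(1) by unfold_locales (auto simp: L_def simp flip: r(1))
  interpret q: macdonald_part G A B C \<alpha> \<beta> r "2 ^ t" n'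
    using ord_A ord_B cop n' r(1) by unfold_locales (auto simp: L_def mult.commute[of r] simp flip: r(1))
  have d: "int L dvd int n' - (1 - int n)"
  proof -
    have 1: "int (2 ^ t) dvd int n' + (int n - 1)" using n(1) n'(2) by (meson dvd_add int_dvd_int_iff)
    have 2: "int r dvd int n + (int n' - 1)" using n(2) n'(1) by (meson dvd_add int_dvd_int_iff)
    have "coprime (int (2 ^ t)) (int r)" using cop(1) by (simp only: coprime_int_iff)
    then have "int (2 ^ t) * int r dvd int n + int n' - 1"
      using 1 2 by (intro divides_mult) (simp_all add: algebra_simps)
    then show ?thesis unfolding r(1) by (simp add: algebra_simps)
  qed
  have n'_eq: "x [^] (1 - int n) = x [^] int n'" if "x \<in> carrier G" "x [^] int L = \<one>" for x
    using int_pow_cong_mod[OF that d] by simp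
  have AL: "A [^] int L = \<one>" "B [^] int L = \<one>" unfolding L_def by (simp_all add: int_pow_eq_id)
  have CL: "C [^] int L = \<one>"
    using int_pow_cong_mod[OF C p.C_pow_A, of "int L" 0] by (simp add: L_def)
  have "card p.S dvd (2 ^ t) ^ 3" by (rule p.S_card) simp
  then have "card p.S dvd 2 ^ (t * 3)" by (simp add: power_mult)
  then obtain e where e: "card p.S = 2 ^ e"
    using divides_primepow_nat[OF two_is_prime_nat] by blast
  have "r > 0" using r(2) by (cases r) auto
  then have "odd (card q.S)" using q.S_card r(2) by (metis dvd_trans even_power)
  interpret P: normal p.S G by (rule p.S_normal[OF gen])
  interpret Q: normal q.S G by (rule q.S_normal[OF gen])
  have "p.S <#> q.S \<subseteq> q.S <#> p.S"
  proof
    fix z assume "z \<in> p.S <#> q.S"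
    then obtain x y where xy: "x \<in> p.S" "y \<in> q.S" "z = x \<otimes> y" by (rule mem_set_multE)
    then have "z = (x \<otimes> y \<otimes> inv x) \<otimes> x" by (simp add: m_assoc)
    moreover have "x \<otimes> y \<otimes> inv x \<in> q.S" using xy by (simp add: Q.inv_op_closed2)
    ultimately show "z \<in> q.S <#> p.S" using xy mem_set_multI by metis
  qed
  from subgroup_set_mult[OF P.subgroup_axioms Q.subgroup_axioms this]
  have sub: "subgroup (p.S <#> q.S) G" by simp
  have mem: "x \<in> p.S <#> q.S" if "x [^] int n \<in> p.S" "x [^] (1 - int n) \<in> q.S" "x \<in> carrier G" for x
  proof -
    have "x = x [^] int n \<otimes> x [^] (1 - int n)"
      using that(3) by (simp add: int_pow_mult[symmetric])
    then show ?thesis using that mem_set_multI by metis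
  qed
  have Q_mem: "A [^] (1 - int n) \<in> q.S" "B [^] (1 - int n) \<in> q.S" "C [^] (1 - int n) \<in> q.S"
    using q.gens_mem_S AL CL by (simp_all add: n'_eq)
  have "{A, B} \<subseteq> p.S <#> q.S" using mem Q_mem p.gens_mem_S by auto
  then have "carrier G \<subseteq> p.S <#> q.S" unfolding gen by (rule generate_subgroup_incl[OF _ sub])
  then have PQ: "\<exists>x\<in>p.S. \<exists>y\<in>q.S. g = x \<otimes> y" if "g \<in> carrier G" for g
    using that by (metis mem_set_multE subsetD)
  have dec: "two_part_decomposition G p.S q.S e"
    by unfold_locales (use e \<open>odd (card q.S)\<close> PQ P.normal_axioms Q.normal_axioms in auto)
  interpret sw: macdonald_part G B A "inv C" \<beta> \<alpha> "2 ^ t" r n by (rule p.swapped_part)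
  show thesis
  proof (rule that[OF dec p.gens_mem_S Q_mem p.a_pow_s sw.a_pow_s p.c_pow_s])
    show "\<exists>(i::int) (j::int) (k::int). g = (B [^] int n) [^] i \<otimes> ((C [^] int n) [^] j \<otimes> (A [^] int n) [^] k)" if "g \<in> p.S" for g
    proof -
      from that obtain x h where x: "x \<in> cyc p.b" and "h \<in> cyc p.c <#> cyc p.a" and g: "g = x \<otimes> h"
        unfolding p.S_def by (rule mem_set_multE)
      then obtain y z where "y \<in> cyc p.c" "z \<in> cyc p.a" "h = y \<otimes> z" by (elim mem_set_multE)
      with x g obtain i j k :: int where "g = p.b [^] i \<otimes> (p.c [^] j \<otimes> p.a [^] k)"
        unfolding cyc_def by auto
      then show ?thesis by (intro exI)
    qed
  qed
qed

section \<open>A permutation model\<close>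

text \<open>Intended for \<open>e = 2^(m-2)\<close> and \<open>D = 2^(l-2)\<close>;
  \<open>e * h1\<close>, \<open>e * g1\<close> and \<open>D * d1\<close> are then
  \<open>(\<alpha>-1)/4\<close>, \<open>(\<beta>-1)/4\<close> and
  \<open>(\<alpha>-\<beta>)/4\<close>. With these values \<open>W = 2^(l+m+1)\<close> and
  \<open>V = 2^(2m)\<close> are the expected orders of \<open>A\<close> and \<open>C\<close>, while
  \<open>w\<close> and \<open>V1\<close> are their halves. The assumptions \<open>eD\<close> and
  \<open>De\<close> say \<open>m < l\<close> and \<open>l + 3 \<le> 2m\<close>.\<close>

locale model =
  fixes e D h1 g1 d1 th :: int and t :: nat
  assumes eD: "2 * e dvd D" and De: "2 * D dvd e\<^sup>2"
    and diff: "e * (h1 - g1) = D * d1"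
    and odds: "odd h1" "odd g1" "odd d1"
    and W_pow: "32 * D * e = 2 ^ t"
    and th: "32 * D * e dvd 3 * th - 1"
begin

definition "h = e * h1"
definition "g = e * g1"
definition "W = 32 * D * e"
definition "w = 16 * D * e"
definition "V = 16 * e\<^sup>2"
definition "V1 = 8 * e\<^sup>2"

text \<open>By \<open>De\<close>, \<open>32 * D * e\<close> divides \<open>16 * e ^ 3\<close>. This
  is why the third-order error terms in the computations with \<open>pal\<close>, \<open>tau\<close>
  and the orbits vanish.\<close>

lemma W_e3: "W dvd 16 * e ^ 3 * x"
proof -
  obtain y where "e\<^sup>2 = 2 * D * y" using De by (auto simp: dvd_def)
  then have "16 * e ^ 3 * x = W * (y * x)" unfolding W_def power3_eq_cube power2_eq_square by (simp add: mult_ac)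
  then show ?thesis by (metis dvd_triv_left)
qed

lemma W_cubic: "W dvd 16 * h ^ 3 * x" "W dvd 16 * h\<^sup>2 * g * x" "W dvd 16 * h * g\<^sup>2 * x" "W dvd 16 * g ^ 3 * x"
proof -
  have "16 * h ^ 3 * x = 16 * e ^ 3 * (h1 ^ 3 * x)" "16 * h\<^sup>2 * g * x = 16 * e ^ 3 * (h1\<^sup>2 * g1 * x)"
    "16 * h * g\<^sup>2 * x = 16 * e ^ 3 * (h1 * g1\<^sup>2 * x)" "16 * g ^ 3 * x = 16 * e ^ 3 * (g1 ^ 3 * x)"
    unfolding h_def g_def by (simp_all add: power3_eq_cube power2_eq_square)
  then show "W dvd 16 * h ^ 3 * x" "W dvd 16 * h\<^sup>2 * g * x" "W dvd 16 * h * g\<^sup>2 * x" "W dvd 16 * g ^ 3 * x"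
    using W_e3 by metis+
qed

lemma V_quadratic: "V dvd 16 * h\<^sup>2 * x" "V dvd 16 * h * g * x" "V dvd 16 * g\<^sup>2 * x"
  unfolding V_def h_def g_def by (simp_all add: power2_eq_square)

lemma W_th: "W dvd (3 * th - 1) * x"
  using th unfolding W_def by simp

lemma even_th: "even (3 * th - 1)"
  using th by (metis dvd_trans dvd_triv_left mult.assoc dvd_mult2 even_numeral)

lemma dvd_basics:
  "V1 dvd w" "V1 dvd W" "V dvd w" "V dvd W" "4 * D dvd V1" "4 * D dvd V" "W = 2 * w" "V = 2 * V1"
proof -
  obtain y where y: "D = 2 * e * y" using eD by (auto simp: dvd_def)
  obtain x where x: "e\<^sup>2 = 2 * D * x" using De by (auto simp: dvd_def)
  show "W = 2 * w" "V = 2 * V1" by (simp_all add: W_def w_def V_def V1_def)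
  have "w = V * (2 * y)" unfolding w_def V_def using y by (simp add: power2_eq_square)
  then show "V dvd w" by simp
  then show "V dvd W" "V1 dvd w" "V1 dvd W" unfolding \<open>W = 2 * w\<close> \<open>V = 2 * V1\<close> by auto
  have "V1 = 4 * D * (4 * x)" unfolding V1_def x by simp
  then show "4 * D dvd V1" by simp
  then show "4 * D dvd V" unfolding \<open>V = 2 * V1\<close> by simp
qed

text \<open>A state \<open>(i, k, j)\<close> stands for \<open>A\<^bsup>i\<^esup> C\<^bsup>-k\<^esup> B\<^bsup>j\<^esup>\<close>, on which the group acts by right
  multiplication. With \<open>\<alpha> = 1 + 4 h\<close>, \<open>\<beta> = 1 + 4 g\<close> and \<open>th\<close> an inverse of \<open>3\<close> modulo \<open>W\<close>, the
  polynomials \<open>pal k\<close> and \<open>tau j\<close> are the binomial expansions of \<open>\<alpha>\<^bsup>k\<^esup>\<close> and of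
  \<open>\<beta> + \<dots> + \<beta>\<^bsup>j\<^esup>\<close> (the exponent in \<open>B\<^bsup>j\<^esup> A = A C\<^bsup>-j\<^esup> B\<^bsup>tau j\<^esup>\<close>) up to multiples of \<open>W\<close>. Two states
  are identified when their difference lies in the lattice \<open>inL\<close>.\<close>

definition pal :: "int \<Rightarrow> int" where
  "pal k = 1 + 4 * h * k + 8 * h\<^sup>2 * (k * (k - 1))"

definition tau :: "int \<Rightarrow> int" where
  "tau j = j + 2 * g * (j * (j + 1)) + 8 * th * g\<^sup>2 * (j ^ 3 - j)"

text \<open>\<open>s\<close>, \<open>p\<close> and \<open>q\<close> are the coefficients of
  \<open>A^(8h^2) B^(8g^2) = C^(4(h-g))\<close>, \<open>A^w = C^V1\<close> and
  \<open>B^w = C^V1\<close>; here \<open>8h^2 = (\<alpha>-1)^2/2\<close> and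
  \<open>4(h-g) = \<alpha>-\<beta>\<close>.\<close>

definition inL :: "int \<Rightarrow> int \<Rightarrow> int \<Rightarrow> bool" where
  "inL x y z \<longleftrightarrow> (\<exists>s p q. W dvd x - (s * (8 * h\<^sup>2) + p * w)
      \<and> V dvd y - (s * (4 * (h - g)) + (p + q) * V1)
      \<and> W dvd z - (s * (8 * g\<^sup>2) + q * w))"

lemma inL_0 [simp]: "inL 0 0 0"
  unfolding inL_def by (rule exI[of _ 0])+ simp

lemma inL_add: assumes "inL x y z" "inL x' y' z'" shows "inL (x + x') (y + y') (z + z')"
proof -
  obtain s p q where 1: "W dvd x - (s * (8 * h\<^sup>2) + p * w)"
      "V dvd y - (s * (4 * (h - g)) + (p + q) * V1)" "W dvd z - (s * (8 * g\<^sup>2) + q * w)"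
    using assms(1) by (auto simp: inL_def)
  obtain s' p' q' where 2: "W dvd x' - (s' * (8 * h\<^sup>2) + p' * w)"
      "V dvd y' - (s' * (4 * (h - g)) + (p' + q') * V1)" "W dvd z' - (s' * (8 * g\<^sup>2) + q' * w)"
    using assms(2) by (auto simp: inL_def)
  show ?thesis unfolding inL_def
    using dvd_add[OF 1(1) 2(1)] dvd_add[OF 1(2) 2(2)] dvd_add[OF 1(3) 2(3)]
    by (intro exI[of _ "s + s'"] exI[of _ "p + p'"] exI[of _ "q + q'"]) (simp add: algebra_simps)
qed

lemma inL_minus: assumes "inL x y z" shows "inL (- x) (- y) (- z)"
proof -
  obtain s p q where 1: "W dvd x - (s * (8 * h\<^sup>2) + p * w)"
      "V dvd y - (s * (4 * (h - g)) + (p + q) * V1)" "W dvd z - (s * (8 * g\<^sup>2) + q * w)"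
    using assms(1) by (auto simp: inL_def)
  have "W dvd - (x - (s * (8 * h\<^sup>2) + p * w))"
      "V dvd - (y - (s * (4 * (h - g)) + (p + q) * V1))" "W dvd - (z - (s * (8 * g\<^sup>2) + q * w))"
    using 1 by (simp_all only: dvd_minus_iff)
  then show ?thesis unfolding inL_def
    by (intro exI[of _ "- s"] exI[of _ "- p"] exI[of _ "- q"]) (simp add: algebra_simps)
qed

lemma inL_multiples: "W dvd x \<Longrightarrow> V dvd y \<Longrightarrow> W dvd z \<Longrightarrow> inL x y z"
  unfolding inL_def by (rule exI[of _ 0])+ simp

lemma inL_cong:
  assumes "inL x y z" "W dvd x' - x" "V dvd y' - y" "W dvd z' - z" shows "inL x' y' z'"
  using inL_add[OF assms(1) inL_multiples[OF assms(2-4)]] by simp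

text \<open>These divisibilities make \<open>pal\<close> and \<open>tau\<close> affine modulo
  \<open>W\<close> on lattice cosets, as \<open>pal_diff\<close> and \<open>tau_diff\<close>
  show.\<close>

lemma inL_dvd: assumes "inL x y z" shows "4 * D dvd y" "V1 dvd z"
proof -
  obtain s p q where 1: "V dvd y - (s * (4 * (h - g)) + (p + q) * V1)" "W dvd z - (s * (8 * g\<^sup>2) + q * w)"
    using assms(1) by (auto simp: inL_def)
  have "h - g = D * d1" using diff unfolding h_def g_def by (simp add: algebra_simps)
  then have "4 * D dvd s * (4 * (h - g)) + (p + q) * V1" using dvd_basics(5) by (auto intro!: dvd_add)
  moreover have "4 * D dvd y - (s * (4 * (h - g)) + (p + q) * V1)" using 1(1) dvd_basics(6) dvd_trans by blast
  ultimately show "4 * D dvd y" by (metis diff_add_cancel dvd_add)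
  have "V1 dvd 8 * g\<^sup>2" unfolding V1_def g_def by (simp add: power_mult_distrib)
  then have "V1 dvd s * (8 * g\<^sup>2) + q * w" using dvd_basics(1) by (auto intro!: dvd_add)
  moreover have "V1 dvd z - (s * (8 * g\<^sup>2) + q * w)" using 1(2) dvd_basics(2) dvd_trans by blast
  ultimately show "V1 dvd z" by (metis diff_add_cancel dvd_add)
qed

text \<open>To first order \<open>A\<close> acts on differences of states by the case
  \<open>r = 1\<close> of this shear. The first generator goes to itself plus \<open>r\<close> times
  the second, because \<open>16 * h * (h - g)\<close> is an odd multiple of \<open>w\<close> and
  \<open>8 * g^2\<close> an odd multiple of \<open>V1\<close>; whence the coefficient
  \<open>p + r * s\<close>. The other two generators are fixed modulo
  \<open>(W, V, W)\<close>.\<close>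

lemma inL_shear: 
  assumes "inL x y z" shows "inL (x + r * (4 * h * y)) (y + r * z) z"
proof -
  obtain s p q where 1: "W dvd x - (s * (8 * h\<^sup>2) + p * w)"
      "V dvd y - (s * (4 * (h - g)) + (p + q) * V1)" "W dvd z - (s * (8 * g\<^sup>2) + q * w)"
    using assms(1) by (auto simp: inL_def)
  have hg: "h - g = D * d1" using diff unfolding h_def g_def by (simp add: algebra_simps)
  obtain c where c: "h1 * d1 = 2 * c + 1" using odds by (metis even_mult_iff oddE)
  have e1: "W dvd 4 * h * (s * (4 * (h - g)) + (p + q) * V1) - s * w"
  proof -
    have "4 * h * (s * (4 * (h - g)) + (p + q) * V1) - s * w
      = W * (s * c) + 16 * e ^ 3 * (2 * h1 * (p + q)) + s * w * (h1 * d1 - 2 * c - 1)"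
      unfolding hg unfolding h_def W_def w_def V1_def
      by (simp add: algebra_simps power2_eq_square power3_eq_cube)
    moreover have "W dvd W * (s * c) + 16 * e ^ 3 * (2 * h1 * (p + q))" by (intro dvd_add W_e3) simp
    ultimately show ?thesis using c by simp
  qed
  have e2: "W dvd 4 * h * (y - (s * (4 * (h - g)) + (p + q) * V1))"
  proof -
    obtain k where "y - (s * (4 * (h - g)) + (p + q) * V1) = V * k" using 1(2) by (auto simp: dvd_def)
    then have "4 * h * (y - (s * (4 * (h - g)) + (p + q) * V1)) = 16 * e ^ 3 * (4 * h1 * k)"
      unfolding V_def h_def by (simp add: power2_eq_square power3_eq_cube)
    then show ?thesis using W_e3 by metis
  qed
  have "W dvd (x - (s * (8 * h\<^sup>2) + p * w)) + r * ((4 * h * (s * (4 * (h - g)) + (p + q) * V1) - s * w)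
      + 4 * h * (y - (s * (4 * (h - g)) + (p + q) * V1)))"
    using 1(1) e1 e2 by (meson dvd_add dvd_mult)
  then have A: "W dvd x + r * (4 * h * y) - (s * (8 * h\<^sup>2) + (p + r * s) * w)" by (simp add: algebra_simps)
  obtain c2 where c2: "g1\<^sup>2 = 2 * c2 + 1" using odds by (metis even_power oddE)
  have "8 * g\<^sup>2 - V1 = V * c2" unfolding g_def V1_def V_def power_mult_distrib c2 by (simp add: algebra_simps)
  then have e3: "V dvd s * (8 * g\<^sup>2 - V1) + q * w" using dvd_basics(3) by (auto intro!: dvd_add)
  have "V dvd (y - (s * (4 * (h - g)) + (p + q) * V1)) + r * ((z - (s * (8 * g\<^sup>2) + q * w)) + (s * (8 * g\<^sup>2 - V1) + q * w))"
    using 1(2) e3 dvd_trans[OF dvd_basics(4) 1(3)] by (meson dvd_add dvd_mult)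
  then have B: "V dvd y + r * z - (s * (4 * (h - g)) + (p + r * s + q) * V1)" by (simp add: algebra_simps)
  show ?thesis unfolding inL_def using A B 1(3) by blast
qed

lemma inL_shear_inv: assumes "inL (x + 4 * h * y) (y + z) z" shows "inL x y z"
proof -
  have W: "W dvd 4 * h * z"
  proof -
    obtain r where "z = V1 * r" using inL_dvd(2)[OF assms] by (auto simp: dvd_def)
    then have "4 * h * z = 16 * e ^ 3 * (2 * h1 * r)"
      unfolding V1_def h_def by (simp add: power2_eq_square power3_eq_cube)
    then show ?thesis using W_e3 by metis
  qed
  show ?thesis
    using inL_shear[OF assms, of "-1"] by (rule inL_cong) (use W in \<open>simp_all add: algebra_simps\<close>)
qed

lemma tau_diff: assumes "V1 dvd j - j'" shows "W dvd tau j - tau j' - (j - j')"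
proof -
  obtain r where r: "j - j' = V1 * r" using assms by (auto simp: dvd_def)
  have "tau j - tau j' - (j - j')
      = (j - j') * (2 * g * (j + j' + 1) + 8 * th * g\<^sup>2 * (j\<^sup>2 + j * j' + j'\<^sup>2 - 1))"
    unfolding tau_def by (simp add: algebra_simps power2_eq_square power3_eq_cube)
  also have "\<dots> = 16 * e ^ 3 * (r * g1 * (j + j' + 1) + 4 * r * th * g1 * g * (j\<^sup>2 + j * j' + j'\<^sup>2 - 1))"
    unfolding r V1_def g_def by (simp add: algebra_simps power2_eq_square power3_eq_cube)
  finally show ?thesis using W_e3 by metis
qed

lemma pal_diff: assumes "4 * D dvd k - k'" shows "W dvd pal k - pal k' - 4 * h * (k - k')"
proof -
  obtain r where r: "k - k' = 4 * D * r" using assms by (auto simp: dvd_def)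
  have "pal k - pal k' - 4 * h * (k - k') = (k - k') * (8 * h\<^sup>2 * (k + k' - 1))"
    unfolding pal_def by (simp add: algebra_simps power2_eq_square)
  also have "\<dots> = W * (r * h1 * h * (k + k' - 1))"
    unfolding r W_def h_def by (simp add: power2_eq_square)
  finally show ?thesis by simp
qed

type_synonym state = "int \<times> int \<times> int"

fun rel :: "state \<Rightarrow> state \<Rightarrow> bool" where
  "rel (i, k, j) (i', k', j') = inL (i - i') (k - k') (j - j')"

lemma rel_refl [simp]: "rel x x" by (cases x) simp

lemma rel_sym: "rel x y \<Longrightarrow> rel y x"
  by (cases x; cases y) (auto dest: inL_minus)

lemma rel_trans: "rel x y \<Longrightarrow> rel y z \<Longrightarrow> rel x z"
  by (cases x; cases y; cases z) (auto dest: inL_add)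

fun fA :: "state \<Rightarrow> state" where "fA (i, k, j) = (i + pal k, k + j, tau j)"
fun fB :: "state \<Rightarrow> state" where "fB (i, k, j) = (i, k, j + 1)"
fun fBi :: "state \<Rightarrow> state" where "fBi (i, k, j) = (i, k, j - 1)"
text \<open>This is right multiplication by the inverse of \<open>C\<close>, since
  \<open>B^j C^-1 = C^-1 B^(\<beta> j)\<close>. A direct formula for \<open>C\<close> would have to
  divide by \<open>\<beta>\<close>.\<close>

fun fD :: "state \<Rightarrow> state" where "fD (i, k, j) = (i, k + 1, (1 + 4 * g) * j)"

text \<open>Forwards, \<open>pal\<close> and \<open>tau\<close> are linearised and the shear
  applies. The converse makes the inverse action well defined on classes; there
  \<open>tau j - tau j'\<close> is an odd multiple of \<open>j - j'\<close>, so divisibility by the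
  power of two \<open>V1\<close> passes back to \<open>j - j'\<close>.\<close>

lemma rel_fA_iff: "rel (fA x) (fA y) \<longleftrightarrow> rel x y"
proof (cases x, cases y)
  fix i k j i' k' j' assume x: "x = (i, k, j)" and y: "y = (i', k', j')"
  let ?x = "i - i'" and ?y = "k - k'" and ?z = "j - j'"
  have fwd: "inL (i + pal k - (i' + pal k')) (k + j - (k' + j')) (tau j - tau j')"
    if "inL ?x ?y ?z"
    using inL_shear[OF that, of 1]
  proof (rule inL_cong)
    show "W dvd i + pal k - (i' + pal k') - (?x + 1 * (4 * h * ?y))"
      using pal_diff[OF inL_dvd(1)[OF that]] by (simp add: algebra_simps)
    show "W dvd tau j - tau j' - ?z" by (rule tau_diff[OF inL_dvd(2)[OF that]])
  qed simp
  have bwd: "inL ?x ?y ?z" if L: "inL (i + pal k - (i' + pal k')) (k + j - (k' + j')) (tau j - tau j')"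
  proof -
    have V1z: "V1 dvd ?z"
    proof -
      have "tau j - tau j' = ?z * (1 + 2 * (g * (j + j' + 1) + 4 * th * g\<^sup>2 * (j\<^sup>2 + j * j' + j'\<^sup>2 - 1)))"
        unfolding tau_def by (simp add: algebra_simps power2_eq_square power3_eq_cube)
      then have "V1 dvd ?z * (1 + 2 * (g * (j + j' + 1) + 4 * th * g\<^sup>2 * (j\<^sup>2 + j * j' + j'\<^sup>2 - 1)))"
        using inL_dvd(2)[OF L] by simp
      moreover have "coprime V1 (1 + 2 * c)" for c
      proof -
        have "coprime (2 ^ t) (1 + 2 * c)" by simp
        moreover have "V1 dvd 2 ^ t" using dvd_basics(2) W_pow unfolding W_def by simp
        ultimately show ?thesis using coprime_divisors dvd_refl by blast
      qed
      ultimately show ?thesis by (metis coprime_dvd_mult_left_iff)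
    qed
    have z: "W dvd tau j - tau j' - ?z" by (rule tau_diff[OF V1z])
    have "4 * D dvd (k + j - (k' + j')) - ?z"
      using inL_dvd(1)[OF L] V1z dvd_basics(5) by (meson dvd_diff dvd_trans)
    then have "4 * D dvd ?y" by (simp add: algebra_simps)
    then have p: "W dvd pal k - pal k' - 4 * h * ?y" by (rule pal_diff)
    have "inL (?x + 4 * h * ?y) (?y + ?z) ?z"
    proof (rule inL_cong[OF L])
      show "W dvd ?x + 4 * h * ?y - (i + pal k - (i' + pal k'))"
        using p by (subst dvd_minus_iff[symmetric]) (simp add: algebra_simps)
      show "W dvd ?z - (tau j - tau j')" using z by (subst dvd_minus_iff[symmetric]) (simp add: algebra_simps)
    qed simp
    then show ?thesis by (rule inL_shear_inv)
  qed
  show ?thesis unfolding x y using fwd bwd by (auto simp: algebra_simps)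
qed

lemma rel_fB: "rel x y \<Longrightarrow> rel (fB x) (fB y)" by (cases x; cases y) simp
lemma rel_fBi: "rel x y \<Longrightarrow> rel (fBi x) (fBi y)" by (cases x; cases y) simp
lemma fB_fBi [simp]: "fB (fBi x) = x" "fBi (fB x) = x" by (cases x; simp)+

lemma rel_fD: "rel x y \<Longrightarrow> rel (fD x) (fD y)"
proof (cases x, cases y)
  fix i k j i' k' j' assume x: "x = (i, k, j)" and y: "y = (i', k', j')" and r: "rel x y"
  then have L: "inL (i - i') (k - k') (j - j')" by simp
  obtain r where r: "j - j' = V1 * r" using inL_dvd(2)[OF L] by (auto simp: dvd_def)
  have "(1 + 4 * g) * j - (1 + 4 * g) * j' - (j - j') = 4 * g * (j - j')" by (simp add: algebra_simps)
  also have "\<dots> = 16 * e ^ 3 * (2 * g1 * r)"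
    unfolding r V1_def g_def by (simp add: power2_eq_square power3_eq_cube)
  finally have "W dvd (1 + 4 * g) * j - (1 + 4 * g) * j' - (j - j')" using W_e3 by metis
  then show ?thesis unfolding x y using inL_cong[OF L, of "i - i'" "k - k'"] by simp
qed

text \<open>The difference quotients of \<open>tau\<close> are odd and \<open>W\<close> is a power
  of 2, so \<open>tau\<close> is injective modulo \<open>W\<close> and therefore bijective.\<close>

lemma tau_surj: "\<exists>j. W dvd tau j - J"
proof -
  have W0: "W > 0" using W_pow unfolding W_def by simp
  let ?f = "\<lambda>j. tau j mod W"
  have "inj_on ?f {0..<W}"
  proof (rule inj_onI)
    fix j j' assume j: "j \<in> {0..<W}" "j' \<in> {0..<W}" and eq: "tau j mod W = tau j' mod W"
    have "W dvd tau j - tau j'" using eq by (simp add: mod_eq_dvd_iff)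
    moreover have "tau j - tau j' = (j - j') * (1 + 2 * (g * (j + j' + 1) + 4 * th * g\<^sup>2 * (j\<^sup>2 + j * j' + j'\<^sup>2 - 1)))"
      unfolding tau_def by (simp add: algebra_simps power2_eq_square power3_eq_cube)
    moreover have "coprime W (1 + 2 * c)" for c using W_pow unfolding W_def by simp
    ultimately have "W dvd j - j'" by (metis coprime_dvd_mult_left_iff)
    then show "j = j'" using j by (metis atLeastLessThan_iff mod_eq_dvd_iff mod_pos_pos_trivial)
  qed
  moreover have "?f ` {0..<W} \<subseteq> {0..<W}" using W0 by auto
  ultimately have "?f ` {0..<W} = {0..<W}" by (simp add: endo_inj_surj)
  moreover have "J mod W \<in> {0..<W}" using W0 by simp
  ultimately have "J mod W \<in> ?f ` {0..<W}" by simp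
  then obtain j where "tau j mod W = J mod W" by auto
  then show ?thesis by (metis mod_eq_dvd_iff)
qed

definition "taui = (SOME f. \<forall>J. W dvd tau (f J) - J)"

lemma taui: "W dvd tau (taui J) - J"
  using someI_ex[OF choice[of "\<lambda>J j. W dvd tau j - J"]] tau_surj unfolding taui_def by blast

fun fAi :: "state \<Rightarrow> state" where
  "fAi (i, k, j) = (i - pal (k - taui j), k - taui j, taui j)"

lemma fA_fAi: "rel (fA (fAi x)) x"
  by (cases x) (simp add: inL_multiples taui)

lemma fAi_fA: "rel (fAi (fA x)) x"
  using fA_fAi[of "fA x"] by (simp add: rel_fA_iff)

lemma rel_fAi: "rel x y \<Longrightarrow> rel (fAi x) (fAi y)"
  using fA_fAi rel_fA_iff rel_trans rel_sym by meson

end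

section \<open>Closed formulas for powers of A, and the relations in the action\<close>

lemma four_dvd: "(4::int) dvd n * (n - 1) * (j * (j + 1))"
proof -
  have "2 dvd n * (n - 1)" "2 dvd j * (j + 1)" by simp_all
  from mult_dvd_mono[OF this] show ?thesis by simp
qed

context model
begin

text \<open>Closed forms, modulo the lattice, for the \<open>n\<close>-fold action of \<open>A\<close> on \<open>(0, 0, j)\<close>; being
  polynomials they also make sense for negative \<open>n\<close>.\<close>

definition "orbj n j = j + 2 * g * n * (j * (j + 1)) + 8 * th * g\<^sup>2 * n * (j ^ 3 - j)
   + 2 * g\<^sup>2 * (n * (n - 1) * (j * (j + 1))) * (2 * j + 1)"

definition "orbk n j = n * j + g * (n * (n - 1) * (j * (j + 1)))
   + 2 * g\<^sup>2 * th * (n * (n - 1) * (j * (j + 1))) * (n - 2) * (2 * j + 1)"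

definition "orbi n j = n + 2 * h * n * (n - 1) * j + 4 * th * h * g * (n * (n - 1) * (j * (j + 1))) * (n - 2)
   + 4 * th * h\<^sup>2 * j\<^sup>2 * n * (n - 1) * (2 * n - 1) - 4 * h\<^sup>2 * j * n * (n - 1)"

text \<open>In terms of the integers \<open>q = j(j+1)/2\<close> and \<open>c = n(n-1)q/2\<close>
  the difference becomes \<open>16 * g ^ 3\<close> times an integer.\<close>

lemma orbj_step: "W dvd tau (orbj n j) - orbj (n + 1) j"
proof -
  obtain q where q: "j * (j + 1) = 2 * q" by (metis dvd_def even_mult_iff odd_even_add odd_one)
  obtain c where c: "n * (n - 1) * (2 * q) = 4 * c" using four_dvd[of n j] unfolding q by (auto simp: dvd_def)
  define x where "x = j ^ 3 - j"
  define r where "r = 2 * j + 1"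
  define \<delta>' where "\<delta>' = n * q + 2 * th * g * n * x + 2 * g * c * r"
  have J: "orbj n j = j + 4 * g * \<delta>'"
    unfolding orbj_def q c \<delta>'_def x_def r_def by (simp add: algebra_simps power2_eq_square)
  have c': "(n + 1) * n * (2 * q) = 4 * c + 4 * n * q"
    unfolding c[symmetric] by (simp add: algebra_simps)
  have J1: "orbj (n + 1) j = orbj n j + 4 * g * q + 8 * th * g\<^sup>2 * x + 8 * g\<^sup>2 * n * q * r"
    unfolding orbj_def q c add_diff_cancel_right' c' x_def r_def by (simp add: algebra_simps)
  let ?y = "3 * j\<^sup>2 + 12 * j * g * \<delta>' + 16 * g\<^sup>2 * \<delta>'\<^sup>2 - 1"
  have t1: "tau (orbj n j) = orbj n j + 2 * g * ((j + 4 * g * \<delta>') * (j + 4 * g * \<delta>' + 1))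
      + 8 * th * g\<^sup>2 * ((j + 4 * g * \<delta>') ^ 3 - (j + 4 * g * \<delta>'))"
    unfolding tau_def J ..
  have t2: "(j + 4 * g * \<delta>') * (j + 4 * g * \<delta>' + 1) = 2 * q + 4 * g * \<delta>' * r + 16 * g\<^sup>2 * \<delta>'\<^sup>2"
    unfolding q[symmetric] by (simp add: r_def algebra_simps power2_eq_square)
  have t3: "8 * g\<^sup>2 * \<delta>' * r = 8 * g\<^sup>2 * n * q * r + 16 * g ^ 3 * (th * n * x * r + c * r * r)"
    by (simp add: \<delta>'_def algebra_simps power2_eq_square power3_eq_cube)
  have t4: "(j + 4 * g * \<delta>') ^ 3 - (j + 4 * g * \<delta>') = x + 4 * g * \<delta>' * ?y"
    by (simp add: x_def algebra_simps power2_eq_square power3_eq_cube)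
  have "tau (orbj n j) - orbj (n + 1) j
      = (8 * g\<^sup>2 * \<delta>' * r) - 8 * g\<^sup>2 * n * q * r + 16 * g ^ 3 * (2 * \<delta>'\<^sup>2 + 2 * th * \<delta>' * ?y)"
    unfolding t1 t2 t4 J1 by (simp add: algebra_simps power2_eq_square power3_eq_cube)
  also have "\<dots> = 16 * g ^ 3 * (th * n * x * r + c * r * r + 2 * \<delta>'\<^sup>2 + 2 * th * \<delta>' * ?y)"
    unfolding t3 by (simp add: algebra_simps)
  finally show ?thesis using W_cubic(4) by metis
qed

text \<open>The middle coordinate counts only modulo \<open>V\<close>, so for the remaining term
  \<open>8 g^2 c (2j+1) (3 th - 1)\<close> it is enough that \<open>3 * th - 1\<close> is
  even.\<close>

lemma orbk_step: "V dvd orbk n j + orbj n j - orbk (n + 1) j"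
proof -
  obtain q where q: "j * (j + 1) = 2 * q" by (metis dvd_def even_mult_iff odd_even_add odd_one)
  obtain c where c: "n * (n - 1) * (2 * q) = 4 * c" using four_dvd[of n j] unfolding q by (auto simp: dvd_def)
  obtain y where y: "3 * th - 1 = 2 * y" using even_th by (auto simp: dvd_def)
  have c': "(n + 1) * n * (2 * q) = 4 * c + 4 * n * q"
    unfolding c[symmetric] by (simp add: algebra_simps)
  have c2: "4 * n * q * (n - 1) = 8 * c" using c by (simp add: algebra_simps)
  have "orbk n j + orbj n j - orbk (n + 1) j
    = 16 * g\<^sup>2 * (th * n * q * (j - 1)) - 8 * g\<^sup>2 * c * (2 * j + 1) * (3 * th - 1)"
  proof -
    have K1: "orbk (n + 1) j = n * j + j + g * (4 * c + 4 * n * q) + 2 * g\<^sup>2 * th * (4 * c + 4 * n * q) * (n - 1) * (2 * j + 1)"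
      unfolding orbk_def q add_diff_cancel_right' c' by (simp add: algebra_simps)
    have K0: "orbk n j = n * j + g * (4 * c) + 2 * g\<^sup>2 * th * (4 * c) * (n - 2) * (2 * j + 1)"
      unfolding orbk_def q c ..
    have x: "j ^ 3 - j = 2 * q * (j - 1)" unfolding q[symmetric] by (simp add: algebra_simps power3_eq_cube)
    have J0: "orbj n j = j + 4 * g * n * q + 16 * th * g\<^sup>2 * n * q * (j - 1) + 8 * g\<^sup>2 * c * (2 * j + 1)"
      unfolding orbj_def x q c by (simp add: algebra_simps)
    have "2 * g\<^sup>2 * th * (4 * c + 4 * n * q) * (n - 1) * (2 * j + 1)
        = 2 * g\<^sup>2 * th * (4 * c * (n - 1) + 4 * n * q * (n - 1)) * (2 * j + 1)" by (simp add: algebra_simps)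
    then show ?thesis unfolding K1 K0 J0 c2 by (simp add: algebra_simps)
  qed
  also have "\<dots> = 16 * g\<^sup>2 * (th * n * q * (j - 1) - c * (2 * j + 1) * y)"
    unfolding y by (simp add: algebra_simps)
  finally show ?thesis using V_quadratic(3) by metis
qed

lemma pal_mult: "W dvd pal k * pal k' - pal (k + k')"
proof -
  have "pal k * pal k' - pal (k + k')
    = 16 * h ^ 3 * (2 * k * k' * (k' - 1) + 2 * k * (k - 1) * k' + 4 * h * k * (k - 1) * k' * (k' - 1))"
    unfolding pal_def by (simp add: algebra_simps power2_eq_square power3_eq_cube)
  then show ?thesis using W_cubic(1) by metis
qed

lemma orbi_step: "W dvd pal (orbk n j) - (orbi (n + 1) j - orbi n j)"
proof -
  obtain c where c: "n * (n - 1) * (j * (j + 1)) = 4 * c" using four_dvd[of n j] by (auto simp: dvd_def)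
  define p where "p = j * (j + 1)"
  define \<kappa> where "\<kappa> = c + 2 * g * th * c * (n - 2) * (2 * j + 1)"
  have K: "orbk n j = n * j + 4 * g * \<kappa>"
    unfolding orbk_def c \<kappa>_def by (simp add: algebra_simps power2_eq_square)
  have F: "orbi (n + 1) j - orbi n j = 1 + 4 * h * n * j + 12 * th * h * g * (n * (n - 1) * p)
      + 24 * th * h\<^sup>2 * j\<^sup>2 * n\<^sup>2 - 8 * h\<^sup>2 * j * n"
    unfolding orbi_def p_def[symmetric] by (simp add: algebra_simps power2_eq_square)
  have "pal (orbk n j) = 1 + 4 * h * (n * j) + 16 * h * g * \<kappa> + 8 * h\<^sup>2 * (n\<^sup>2 * j\<^sup>2 - n * j)
      + 16 * h\<^sup>2 * g * (2 * \<kappa> * (2 * n * j + 4 * g * \<kappa> - 1))"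
    unfolding pal_def K by (simp add: algebra_simps power2_eq_square)
  then have "pal (orbk n j) - (orbi (n + 1) j - orbi n j)
     = 16 * h * g\<^sup>2 * (2 * th * c * (n - 2) * (2 * j + 1))
       + 16 * h\<^sup>2 * g * (2 * \<kappa> * (2 * n * j + 4 * g * \<kappa> - 1))
       + (3 * th - 1) * (- 16 * h * g * c - 8 * h\<^sup>2 * n\<^sup>2 * j\<^sup>2)"
    unfolding F c[folded p_def] \<kappa>_def by (simp add: algebra_simps power2_eq_square)
  then show ?thesis using W_cubic W_th by (metis dvd_add)
qed

text \<open>By \<open>C^(-k) A^x = A^(\<alpha>^k x) C^(-k)\<close> the action of \<open>A^n\<close>
  on \<open>(i, k, j)\<close> reduces to its action on \<open>(0, 0, j)\<close>; this is the source
  of the factor \<open>pal k\<close>.\<close>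

fun orbit :: "state \<Rightarrow> int \<Rightarrow> state" where
  "orbit (i, k, j) n = (i + pal k * orbi n j, k + orbk n j, orbj n j)"

lemma orbit_0: "orbit x 0 = x"
  by (cases x) (simp add: orbi_def orbk_def orbj_def)

lemma orbit_Suc: "rel (fA (orbit x n)) (orbit x (n + 1))"
proof (cases x)
  case (fields i k j)
  have "W dvd - (pal k * pal (orbk n j) - pal (k + orbk n j)) + pal k * (pal (orbk n j) - (orbi (n + 1) j - orbi n j))"
    by (intro dvd_add dvd_mult orbi_step) (simp only: dvd_minus_iff pal_mult)
  then have "W dvd i + pal k * orbi n j + pal (k + orbk n j) - (i + pal k * orbi (n + 1) j)"
    by (simp add: algebra_simps)
  moreover have "V dvd k + orbk n j + orbj n j - (k + orbk (n + 1) j)"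
    using orbk_step[of n j] by (simp add: algebra_simps)
  ultimately show ?thesis unfolding fields using orbj_step by (simp add: inL_multiples)
qed

text \<open>The relation \<open>A\<^bsup>C\<^esup> = A\<^bsup>\<alpha>\<^esup>\<close> in the form \<open>C\<^sup>-\<^sup>1 A = A\<^bsup>\<alpha>\<^esup> C\<^sup>-\<^sup>1\<close>; this is what dictates the lattice.\<close>

lemma rel_AC: "rel (fA (fD x)) (fD (orbit x (1 + 4 * h)))"
proof (cases x)
  case (fields i k j)
  obtain q where q: "j * (j + 1) = 2 * q" by (metis dvd_def even_mult_iff odd_even_add odd_one)
  let ?a = "1 + 4 * h"
  have hg: "h - g = D * d1" using diff unfolding h_def g_def by (simp add: algebra_simps)
  have F: "orbi ?a j = ?a + 8 * h\<^sup>2 * j + 16 * h\<^sup>2 * g * (2 * th * ?a * q * (4 * h - 1))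
       + 16 * h ^ 3 * (2 * j + th * j\<^sup>2 * ?a * (2 * ?a - 1) - j * ?a)"
    unfolding orbi_def q by (simp add: algebra_simps power2_eq_square power3_eq_cube)
  have x: "W dvd (i + pal k * orbi ?a j) - (i + pal (k + 1)) - j * (8 * h\<^sup>2)"
  proof -
    have "(i + pal k * orbi ?a j) - (i + pal (k + 1)) - j * (8 * h\<^sup>2)
      = (pal k * pal 1 - pal (k + 1)) 
        + pal k * (16 * h\<^sup>2 * g * (2 * th * ?a * q * (4 * h - 1)) + 16 * h ^ 3 * (2 * j + th * j\<^sup>2 * ?a * (2 * ?a - 1) - j * ?a))
        + 16 * h ^ 3 * (2 * k * j + 4 * h * j * (k * (k - 1)))"
      unfolding F by (simp add: pal_def algebra_simps power2_eq_square power3_eq_cube)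
    moreover have "W dvd \<dots>" by (intro dvd_add pal_mult dvd_mult W_cubic)
    ultimately show ?thesis by (simp only:)
  qed
  have y: "V dvd (k + orbk ?a j + 1) - (k + 1 + (1 + 4 * g) * j) - (j * (4 * (h - g)) + q * V1)"
  proof -
    obtain c where c: "h1 * g1 = 2 * c + 1" using odds by (metis even_mult_iff oddE)
    have gh: "8 * g * h = V1 + V * c"
    proof -
      have "8 * g * h = V1 * (h1 * g1)" unfolding g_def h_def V1_def by (simp add: power2_eq_square)
      then show ?thesis unfolding c dvd_basics(8) by (simp add: algebra_simps)
    qed
    have "orbk ?a j = ?a * j + 8 * g * h * q + 16 * g * h * (2 * h * q) + 16 * g\<^sup>2 * (th * ?a * h * q * (4 * h - 1) * (2 * j + 1))"
      unfolding orbk_def q by (simp add: algebra_simps power2_eq_square)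
    then have "(k + orbk ?a j + 1) - (k + 1 + (1 + 4 * g) * j) - (j * (4 * (h - g)) + q * V1)
      = (8 * g * h - V1) * q + 16 * h * g * (2 * h * q) + 16 * g\<^sup>2 * (th * ?a * h * q * (4 * h - 1) * (2 * j + 1))"
      by (simp add: algebra_simps)
    also have "V dvd \<dots>" unfolding gh by (intro dvd_add V_quadratic) simp
    finally show ?thesis .
  qed
  have z: "W dvd (1 + 4 * g) * orbj ?a j - tau ((1 + 4 * g) * j) - (j * (8 * g\<^sup>2) + q * w)"
  proof -
    obtain c where c: "g1 * d1 = 2 * c + 1" using odds by (metis even_mult_iff oddE)
    have gd: "16 * g * (h - g) = w + W * c"
    proof -
      have "16 * g * (h - g) = w * (g1 * d1)" unfolding hg unfolding g_def w_def by simp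
      then show ?thesis unfolding c dvd_basics(7) by (simp add: algebra_simps)
    qed
    define cb where "cb = j ^ 3 - j"
    have cb': "((1 + 4 * g) * j) ^ 3 - (1 + 4 * g) * j = cb + 4 * g * (2 * j ^ 3 + cb + 12 * g * j ^ 3 + 16 * g\<^sup>2 * j ^ 3)"
      unfolding cb_def by (simp add: algebra_simps power2_eq_square power3_eq_cube)
    have J: "orbj ?a j = j + 4 * g * ?a * q + 8 * th * g\<^sup>2 * ?a * cb + 16 * g\<^sup>2 * h * (?a * q * (2 * j + 1))"
      unfolding orbj_def q cb_def[symmetric] by (simp add: algebra_simps)
    have p: "((1 + 4 * g) * j) * ((1 + 4 * g) * j + 1) = 2 * q + 8 * g * (2 * q) - 4 * g * j + 16 * g\<^sup>2 * j\<^sup>2"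
      unfolding q[symmetric] by (simp add: algebra_simps power2_eq_square)
    have "(1 + 4 * g) * orbj ?a j - tau ((1 + 4 * g) * j) - (j * (8 * g\<^sup>2) + q * w)
      = (16 * g * (h - g) - w) * q 
        + 16 * h * g\<^sup>2 * (4 * q + 2 * th * cb + (1 + 4 * g) * (?a * q * (2 * j + 1)))
        + 16 * g ^ 3 * (2 * th * cb * ?a - 2 * j\<^sup>2 - 2 * th * (2 * j ^ 3 + cb + 12 * g * j ^ 3 + 16 * g\<^sup>2 * j ^ 3))"
      unfolding tau_def cb' p J by (simp add: algebra_simps power2_eq_square power3_eq_cube)
    also have "W dvd \<dots>" unfolding gd by (intro dvd_add W_cubic) simp
    finally show ?thesis .
  qed
  \<comment> \<open>The discrepancy is \<open>j\<close> times the first lattice generator plus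
    \<open>j(j+1)/2\<close> times the third, whence the witnesses \<open>j\<close>,
    \<open>0\<close>, \<open>q\<close>.\<close>
  have "inL ((i + pal k * orbi ?a j) - (i + pal (k + 1))) ((k + orbk ?a j + 1) - (k + 1 + (1 + 4 * g) * j))
     ((1 + 4 * g) * orbj ?a j - tau ((1 + 4 * g) * j))"
    unfolding inL_def using x y z by (intro exI[of _ j] exI[of _ 0] exI[of _ q]) simp
  then have "rel (fD (orbit x ?a)) (fA (fD x))" unfolding fields by simp
  then show ?thesis by (rule rel_sym)
qed

text \<open>The relation \<open>B A = A B C^-1\<close>, read from left to right as a right action.
  Its content is \<open>tau (j + 1) = \<beta> * (tau j + 1)\<close> modulo \<open>W\<close>.\<close>

lemma rel_BA: "rel (fA (fB x)) (fD (fB (fA x)))"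
proof (cases x)
  case (fields i k j)
  obtain q where q: "j * (j + 1) = 2 * q" by (metis dvd_def even_mult_iff odd_even_add odd_one)
  have x: "j ^ 3 - j = 2 * q * (j - 1)" unfolding q[symmetric] by (simp add: algebra_simps power3_eq_cube)
  have "tau (j + 1) - (1 + 4 * g) * (tau j + 1)
    = (3 * th - 1) * (16 * g\<^sup>2 * q) - 16 * g ^ 3 * (2 * th * (2 * q * (j - 1)))
      + 8 * g\<^sup>2 * (3 * th - 1) * (j * (j + 1) - 2 * q)"
    unfolding tau_def x[symmetric] by (simp add: algebra_simps power2_eq_square power3_eq_cube)
  also have "\<dots> = (3 * th - 1) * (16 * g\<^sup>2 * q) - 16 * g ^ 3 * (2 * th * (2 * q * (j - 1)))"
    unfolding q by simp
  also have "W dvd \<dots>" by (intro dvd_diff W_th W_cubic)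
  finally show ?thesis unfolding fields by (simp add: inL_multiples)
qed

end

section \<open>Words acting on states, and triviality of the relators\<close>

context model
begin

definition act :: "letter \<Rightarrow> state \<Rightarrow> state" where
  "act l = (if fst l then if snd l then fBi else fB else if snd l then fAi else fA)"

definition actw :: "word \<Rightarrow> state \<Rightarrow> state" where
  "actw wd x = foldl (\<lambda>x l. act l x) x wd"

lemma actw_simps [simp]: "actw [] x = x" "actw (l # u) x = actw u (act l x)"
  "actw (u @ v) x = actw v (actw u x)"
  by (simp_all add: actw_def)

lemma rel_act: "rel x y \<Longrightarrow> rel (act l x) (act l y)"
  by (simp add: act_def rel_fA_iff rel_fAi rel_fB rel_fBi)

lemma rel_actw: "rel x y \<Longrightarrow> rel (actw wd x) (actw wd y)"
  by (induction wd arbitrary: x y) (simp_all add: rel_act)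

lemma act_letter_inv: "rel (act (letter_inv l) (act l x)) x"
  by (auto simp: act_def letter_inv_def fA_fAi fAi_fA)

lemma actw_word_inv: "rel (actw (word_inv wd) (actw wd x)) x"
proof (induction wd arbitrary: x)
  case (Cons l wd)
  have "rel (actw (word_inv wd) (actw wd (act l x))) (act l x)" by (rule Cons)
  then show ?case
    using rel_trans[OF rel_act act_letter_inv] by (simp add: word_inv_def)
qed (simp add: word_inv_def)

lemma word_inv_word_inv: "word_inv (word_inv wd) = wd"
  by (simp add: word_inv_def rev_map comp_def letter_inv_def)

lemma actw_word_inv': "rel (actw wd (actw (word_inv wd) x)) x"
  using actw_word_inv[of "word_inv wd" x] by (simp add: word_inv_word_inv)

lemma pres_eq_actw:
  assumes "pres_eq R u v" "\<And>r x. r \<in> R \<Longrightarrow> rel (actw r x) x"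
  shows "rel (actw u x) (actw v x)"
  using assms(1)
proof (induction arbitrary: x)
  case (cancel u l v)
  show ?case using rel_actw[OF act_letter_inv] by simp
next
  case (relator r u v)
  show ?case using rel_actw[OF assms(2)[OF relator]] by simp
next
  case (sym u v)
  then show ?case using rel_sym by blast
next
  case (trans u v u')
  then show ?case using rel_trans by meson
qed simp

text \<open>\<open>\<phi>\<close> is a two-sided trajectory of the word. As the hypothesis covers
  negative \<open>n\<close>, the inverse word runs along it backwards, which settles negative
  exponents.\<close>

lemma actw_word_pow:
  assumes "\<And>n::int. rel (actw wd (\<phi> n)) (\<phi> (n + 1))"
  shows "rel (actw (word_pow wd k) (\<phi> n)) (\<phi> (n + k))"
proof -
  have pos: "rel (actw (concat (replicate t wd)) (\<phi> n)) (\<phi> (n + int t))" for t n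
  proof (induction t arbitrary: n)
    case (Suc t)
    have "rel (actw (concat (replicate t wd)) (actw wd (\<phi> n))) (actw (concat (replicate t wd)) (\<phi> (n + 1)))"
      by (rule rel_actw[OF assms])
    from rel_trans[OF this Suc] show ?case by (simp add: add_ac)
  qed simp
  have inv: "rel (actw (word_inv wd) (\<phi> n)) (\<phi> (n - 1))" for n
  proof -
    have "rel (\<phi> n) (actw wd (\<phi> (n - 1)))" using assms[of "n - 1"] by (simp add: rel_sym)
    from rel_trans[OF rel_actw[OF this] actw_word_inv] show ?thesis .
  qed
  have neg: "rel (actw (concat (replicate t (word_inv wd))) (\<phi> n)) (\<phi> (n - int t))" for t n
  proof (induction t arbitrary: n)
    case (Suc t)
    have "rel (actw (concat (replicate t (word_inv wd))) (actw (word_inv wd) (\<phi> n)))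
        (actw (concat (replicate t (word_inv wd))) (\<phi> (n - 1)))"
      by (rule rel_actw[OF inv])
    from rel_trans[OF this Suc] show ?case by (simp add: algebra_simps)
  qed simp
  show ?thesis
    using pos[of "nat k" n] neg[of "nat (- k)" n] by (auto simp: word_pow_def)
qed

lemma actw_A: "actw wA x = fA x" and actw_B: "actw wB x = fB x"
  by (simp_all add: wA_def wB_def act_def)

text \<open>The word is \<open>B^-1 A^-1 B A\<close>. Applying \<open>rel_BA\<close> after
  \<open>B^-1 A^-1\<close> replaces its end \<open>B A\<close> by \<open>A B C^-1\<close>, whose
  first two letters undo the beginning.\<close>

lemma actw_C_inv: "rel (actw (word_inv wC) x) (fD x)"
proof -
  have wC: "actw (word_inv wC) x = fA (fB (fAi (fBi x)))"
    by (simp add: wC_def word_inv_def wA_def wB_def letter_inv_def act_def)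
  define y where "y = fAi (fBi x)"
  have "rel (fB (fA y)) x" using rel_fB[OF fA_fAi[of "fBi x"]] by (simp add: y_def)
  from rel_trans[OF rel_BA rel_fD[OF this]] show ?thesis by (simp add: wC y_def)
qed

lemma actw_C_fD: "rel (actw wC (fD x)) x"
  using rel_trans[OF rel_actw[OF rel_sym[OF actw_C_inv]] actw_word_inv'] .

lemma fD_actw_C: "rel (fD (actw wC x)) x"
  using rel_trans[OF rel_sym[OF actw_C_inv] actw_word_inv] .

lemma relators_trivial:
  assumes "r \<in> G_relators (1 + 4 * h) (1 + 4 * g)"
  shows "rel (actw r x) x"
proof -
  consider "r = word_inv wC @ wA @ wC @ word_pow wA (- (1 + 4 * h))"
    | "r = wC @ wB @ word_inv wC @ word_pow wB (- (1 + 4 * g))"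
    using assms by (auto simp: G_relators_def)
  then show ?thesis
  proof cases
    case 1
    let ?p = "word_pow wA (- (1 + 4 * h))"
    have "rel (fA (actw (word_inv wC) x)) (fD (orbit x (1 + 4 * h)))"
      by (rule rel_trans[OF _ rel_AC]) (simp add: rel_fA_iff actw_C_inv)
    from rel_trans[OF rel_actw[OF this, of wC] actw_C_fD]
    have "rel (actw wC (fA (actw (word_inv wC) x))) (orbit x (1 + 4 * h))" .
    from rel_actw[OF this, of ?p]
    have "rel (actw r x) (actw ?p (orbit x (1 + 4 * h)))" by (simp add: 1 actw_A)
    moreover have "rel (actw ?p (orbit x (1 + 4 * h))) (orbit x (1 + 4 * h + - (1 + 4 * h)))"
      by (rule actw_word_pow) (simp add: actw_A orbit_Suc)
    ultimately show ?thesis using rel_trans by (simp add: orbit_0)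
  next
    case 2
    let ?p = "word_pow wB (- (1 + 4 * g))"
    define y where "y = actw wC x"
    obtain i k j where f: "fD y = (i, k, j)" by (cases "fD y")
    have 1: "fD (fB y) = (i, k, j + (1 + 4 * g))" using f by (cases y) (auto simp: algebra_simps)
    have "rel (actw (word_inv wC) (fB y)) (i, k, j + (1 + 4 * g))" using actw_C_inv[of "fB y"] 1 by simp
    from rel_actw[OF this, of ?p]
    have a: "rel (actw r x) (actw ?p (i, k, j + (1 + 4 * g)))" by (simp add: 2 actw_B y_def)
    have "rel (actw ?p ((\<lambda>n. (i, k, j + n)) (1 + 4 * g))) ((\<lambda>n. (i, k, j + n)) (1 + 4 * g + - (1 + 4 * g)))"
      by (rule actw_word_pow) (simp add: actw_B add.assoc)
    then have b: "rel (actw ?p (i, k, j + (1 + 4 * g))) (i, k, j)" by simp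
    have "rel (i, k, j) x" using fD_actw_C[of x] f y_def by simp
    then show ?thesis using a b rel_trans by blast
  qed
qed

lemma actw_normal_form: "rel (actw (word_pow wA i @ word_pow wC k @ word_pow wB j) (0, 0, 0)) (i, - k, j)"
proof -
  have a: "rel (actw (word_pow wA i) ((\<lambda>n. (n, 0, 0)) 0)) ((\<lambda>n. (n, 0, 0)) (0 + i))"
    by (rule actw_word_pow) (simp add: actw_A pal_def tau_def)
  have c: "rel (actw (word_pow wC k) ((\<lambda>n. (i, - n, 0)) 0)) ((\<lambda>n. (i, - n, 0)) (0 + k))"
  proof (rule actw_word_pow)
    fix n :: int
    show "rel (actw wC (i, - n, 0)) (i, - (n + 1), 0)"
      using actw_C_fD[of "(i, - (n + 1), 0)"] by simp
  qed
  have b: "rel (actw (word_pow wB j) ((\<lambda>n. (i, - k, n)) 0)) ((\<lambda>n. (i, - k, n)) (0 + j))"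
    by (rule actw_word_pow) (simp add: actw_B)
  have "rel (actw (word_pow wC k) (actw (word_pow wA i) (0, 0, 0))) (i, - k, 0)"
    using rel_trans[OF rel_actw[of _ _ "word_pow wC k"]] a c by simp
  then show ?thesis using rel_trans[OF rel_actw[of _ _ "word_pow wB j"]] b by simp
qed

lemma normal_form_separation:
  assumes "pres_eq (G_relators (1 + 4 * h) (1 + 4 * g))
     (word_pow wA i @ word_pow wC k @ word_pow wB j) (word_pow wA i' @ word_pow wC k' @ word_pow wB j')"
  shows "inL (i - i') (k' - k) (j - j')"
proof -
  have "rel (i, - k, j) (i', - k', j')"
    using pres_eq_actw[OF assms relators_trivial] actw_normal_form rel_sym rel_trans by meson
  then show ?thesis by simp
qed

end

section \<open>Separation of normal forms by the lattice\<close>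

context model
begin

text \<open>With \<open>r = D / (2 * e)\<close>, the \<open>4 * r\<close>-fold of the first
  generator is \<open>(w, 0, w)\<close> modulo \<open>(W, V, W)\<close>; its middle entry vanishes
  by the assumption on \<open>D^2\<close>. If an outer coordinate is 0, then \<open>s\<close> is a
  multiple of \<open>4 * r\<close>, and only multiples of the third or of the second generator
  survive.\<close>

lemma inL_axis:
  assumes "2 * e ^ 3 dvd D\<^sup>2"
  shows "inL 0 y z \<Longrightarrow> \<exists>k. V dvd y - k * V1 \<and> W dvd z - k * w"
    and "inL x y 0 \<Longrightarrow> \<exists>k. V dvd y - k * V1 \<and> W dvd x - k * w"
proof -
  obtain r where r: "D = 2 * e * r" using eD by (auto simp: dvd_def)
  have e0: "e \<noteq> 0" using W_pow by auto
  have w4: "w = V1 * (4 * r)" unfolding w_def V1_def using r by (simp add: power2_eq_square)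
  have W8: "W = V1 * (8 * r)" unfolding W_def V1_def using r by (simp add: power2_eq_square)
  have V10: "V1 \<noteq> 0" using e0 by (simp add: V1_def)
  have r0: "r \<noteq> 0" using W_pow r by auto
  have cop: "coprime (4 * r) (c\<^sup>2)" if "odd c" for c
  proof -
    have "W = 4 * r * (2 * V1)" unfolding W8 by simp
    then have "4 * r dvd W" by (metis dvd_triv_left)
    then have "4 * r dvd 2 ^ t" using W_pow unfolding W_def by simp
    moreover have "coprime (2 ^ t) (c\<^sup>2)" using that by simp
    ultimately show ?thesis using coprime_divisors dvd_refl by blast
  qed
  have hg: "h - g = D * d1" using diff unfolding h_def g_def by (simp add: algebra_simps)
  have yD: "V dvd 4 * r * s * (4 * (h - g))" for s
  proof -
    obtain k where "D\<^sup>2 = 2 * e ^ 3 * k" using assms by (auto simp: dvd_def)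
    then have "2 * e * (r * D) = 2 * e * (e\<^sup>2 * k)" using r by (simp add: power2_eq_square power3_eq_cube mult_ac)
    then have "r * D = e\<^sup>2 * k" using e0 by simp
    moreover have "4 * r * s * (4 * (h - g)) = 16 * (r * D) * (s * d1)" unfolding hg by simp
    ultimately have "4 * r * s * (4 * (h - g)) = V * (k * s * d1)" unfolding V_def by simp
    then show ?thesis by (metis dvd_triv_left)
  qed
  have key: "\<exists>s'. s = 4 * r * s' \<and> even (s' + p)" if "W dvd s * (V1 * c\<^sup>2) + p * w" "odd c" for s p c
  proof -
    have "s * (V1 * c\<^sup>2) + p * w = V1 * (s * c\<^sup>2 + 4 * r * p)" unfolding w4 by (simp add: algebra_simps)
    then have "V1 * (8 * r) dvd V1 * (s * c\<^sup>2 + 4 * r * p)" using that W8 by simp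
    then have 8: "8 * r dvd s * c\<^sup>2 + 4 * r * p" using V10 by simp
    have "4 * r dvd 8 * r" by (rule dvdI[of _ _ 2]) simp
    then have "4 * r dvd s * c\<^sup>2 + 4 * r * p" using 8 dvd_trans by blast
    then have "4 * r dvd s * c\<^sup>2" by (simp add: dvd_add_left_iff)
    then have "4 * r dvd s" using cop[OF that(2)] by (metis coprime_dvd_mult_left_iff)
    then obtain s' where s': "s = 4 * r * s'" by (auto simp: dvd_def)
    have "4 * r * 2 dvd 4 * r * (s' * c\<^sup>2 + p)" using 8 unfolding s' by (simp add: algebra_simps)
    then have "2 dvd s' * c\<^sup>2 + p" using r0 by (subst (asm) dvd_mult_cancel_left) simp
    then have "even (s' + p)" using that(2) by simp
    then show ?thesis using s' by blast
  qed
  have h2: "8 * h\<^sup>2 = V1 * h1\<^sup>2" "8 * g\<^sup>2 = V1 * g1\<^sup>2"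
    unfolding h_def g_def V1_def by (simp_all add: power_mult_distrib)
  have oth: "W dvd s * (V1 * c\<^sup>2) + q * w - (s' + q) * w" if "s = 4 * r * s'" "odd c" for s s' q c
  proof -
    from that(2) obtain k where k: "c\<^sup>2 = 2 * k + 1" by (metis even_power oddE)
    have "s * (V1 * c\<^sup>2) + q * w - (s' + q) * w = W * (s' * k)"
      unfolding that(1) k W8 w4 by (simp add: algebra_simps)
    then show ?thesis by simp
  qed
  have ev: "V dvd a * V1 - b * V1" if "even (a + b)" for a b
  proof -
    have "even (a - b)" using that by simp
    then obtain k where "a - b = 2 * k" by (auto simp: dvd_def)
    then have "a * V1 - b * V1 = V * k" unfolding dvd_basics(8) by (simp flip: left_diff_distrib)
    then show ?thesis by simp
  qed
  show "\<exists>k. V dvd y - k * V1 \<and> W dvd z - k * w" if "inL 0 y z"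
  proof -
    obtain s p q where 1: "W dvd 0 - (s * (8 * h\<^sup>2) + p * w)"
      "V dvd y - (s * (4 * (h - g)) + (p + q) * V1)" "W dvd z - (s * (8 * g\<^sup>2) + q * w)"
      using \<open>inL 0 y z\<close> by (auto simp: inL_def)
    have "W dvd s * (V1 * h1\<^sup>2) + p * w" using 1(1) unfolding h2 by (metis diff_0 dvd_minus_iff)
    then obtain s' where s': "s = 4 * r * s'" "even (s' + p)" using key odds(1) by blast
    have "W dvd z - (s' + q) * w"
      using dvd_add[OF 1(3)[unfolded h2] oth[OF s'(1) odds(2), of q]] by simp
    moreover have "V dvd y - (s' + q) * V1"
    proof -
      have "even ((p + q) + (s' + q))" using s'(2) by simp
      from dvd_add[OF dvd_add[OF 1(2) yD[of s']] ev[OF this]] show ?thesis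
        unfolding s' by (simp add: algebra_simps)
    qed
    ultimately show ?thesis by blast
  qed
  show "\<exists>k. V dvd y - k * V1 \<and> W dvd x - k * w" if "inL x y 0"
  proof -
    obtain s p q where 1: "W dvd x - (s * (8 * h\<^sup>2) + p * w)"
      "V dvd y - (s * (4 * (h - g)) + (p + q) * V1)" "W dvd 0 - (s * (8 * g\<^sup>2) + q * w)"
      using \<open>inL x y 0\<close> by (auto simp: inL_def)
    have "W dvd s * (V1 * g1\<^sup>2) + q * w" using 1(3) unfolding h2 by (metis diff_0 dvd_minus_iff)
    then obtain s' where s': "s = 4 * r * s'" "even (s' + q)" using key odds(2) by blast
    have "W dvd x - (s' + p) * w"
      using dvd_add[OF 1(1)[unfolded h2] oth[OF s'(1) odds(1), of p]] by simp
    moreover have "V dvd y - (s' + p) * V1"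
    proof -
      have "even ((p + q) + (s' + p))" using s'(2) by simp
      from dvd_add[OF dvd_add[OF 1(2) yD[of s']] ev[OF this]] show ?thesis
        unfolding s' by (simp add: algebra_simps)
    qed
    ultimately show ?thesis by blast
  qed
qed

text \<open>For the last claim, first coordinates of lattice points are multiples of
  \<open>V1\<close>, so \<open>x = 0\<close> and \<open>inL_axis\<close> applies. A box with sides
  \<open>V1\<close>, \<open>V\<close>, \<open>w\<close> thus meets each class at most once, and
  \<open>V1 * V * w\<close> is the expected group order.\<close>

lemma inL_separation:
  assumes "2 * e ^ 3 dvd D\<^sup>2"
  shows "inL x 0 0 \<Longrightarrow> W dvd x" "inL 0 y 0 \<Longrightarrow> V dvd y" "inL 0 0 z \<Longrightarrow> W dvd z"
    and "inL x y z \<Longrightarrow> \<bar>x\<bar> < V1 \<Longrightarrow> \<bar>y\<bar> < V \<Longrightarrow> \<bar>z\<bar> < w \<Longrightarrow> x = 0 \<and> y = 0 \<and> z = 0"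
proof -
  have W0: "W > 0" using W_pow unfolding W_def by simp
  then have w0: "w > 0" "w \<noteq> 0" using dvd_basics(7) by auto
  have V10: "V1 \<noteq> 0" using w0 dvd_basics(1) by auto
  have kw: "even k" if "W dvd k * w" for k using that w0 unfolding dvd_basics(7) by simp
  have kV: "even k" if "V dvd k * V1" for k using that V10 unfolding dvd_basics(8) by simp
  have Wk: "W dvd k * w" if "even k" for k using that unfolding dvd_basics(7) by (simp add: mult_dvd_mono)
  have Vk: "V dvd k * V1" if "even k" for k using that unfolding dvd_basics(8) by (simp add: mult_dvd_mono)
  have a1: "W dvd b" if "V dvd 0 - k * V1" "W dvd b - k * w" for k b
  proof -
    have "V dvd k * V1" using that(1) by (metis diff_0 dvd_minus_iff)
    then have "W dvd k * w" using kV Wk by blast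
    then show ?thesis using that(2) by (metis diff_add_cancel dvd_add)
  qed
  have a2: "V dvd b" if "V dvd b - k * V1" "W dvd 0 - k * w" for k b
  proof -
    have "W dvd k * w" using that(2) by (metis diff_0 dvd_minus_iff)
    then have "V dvd k * V1" using kw Vk by blast
    then show ?thesis using that(1) by (metis diff_add_cancel dvd_add)
  qed
  show "W dvd x" if "inL x 0 0" using inL_axis(2)[OF assms that] a1 by blast
  show "W dvd z" if "inL 0 0 z" using inL_axis(1)[OF assms that] a1 by blast
  show y: "V dvd y" if "inL 0 y 0" for y using inL_axis(1)[OF assms that] a2 by blast
  show "x = 0 \<and> y = 0 \<and> z = 0" if L: "inL x y z" and small: "\<bar>x\<bar> < V1" "\<bar>y\<bar> < V" "\<bar>z\<bar> < w"
  proof -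
    have "V1 dvd x"
    proof -
      obtain s p where "W dvd x - (s * (8 * h\<^sup>2) + p * w)" using L by (auto simp: inL_def)
      then have "V1 dvd x - (s * (8 * h\<^sup>2) + p * w)" using dvd_basics(2) dvd_trans by blast
      moreover have "V1 dvd s * (8 * h\<^sup>2) + p * w"
        using dvd_basics(1) unfolding V1_def h_def by (intro dvd_add) (simp_all add: power_mult_distrib)
      ultimately show ?thesis by (metis diff_add_cancel dvd_add)
    qed
    then have x0: "x = 0" using small(1) by (metis abs_dvd_iff dvd_abs_iff zdvd_not_zless abs_ge_zero abs_eq_0 order_le_less)
    then obtain k where k: "V dvd y - k * V1" "W dvd z - k * w" using inL_axis(1)[OF assms] L by blast
    have "w dvd z - k * w" using k(2) unfolding dvd_basics(7) by (metis dvd_mult_right)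
    then have "w dvd z" by (metis diff_add_cancel dvd_add dvd_triv_right)
    then have z0: "z = 0" using small(3) by (metis abs_dvd_iff dvd_abs_iff zdvd_not_zless abs_ge_zero abs_eq_0 order_le_less)
    then have "V dvd y" using k a2 by blast
    then have "y = 0" using small(2) by (metis abs_dvd_iff dvd_abs_iff zdvd_not_zless abs_ge_zero abs_eq_0 order_le_less)
    then show ?thesis using x0 z0 by simp
  qed
qed

end

section \<open>Relations in the Sylow 2-subgroup\<close>

text \<open>\<open>C\<^bsup>\<alpha>-1\<^esup> A\<^bsup>mexp \<alpha>\<^esup> = B\<^bsup>-mexp \<beta>\<^esup> C\<^bsup>\<beta>-1\<^esup>\<close> is the fundamental relation with \<open>k = 1\<close>;
  2-adically \<open>mexp \<alpha> \<approx> -(\<alpha> - 1)\<^sup>2/2\<close>.\<close>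

definition mexp :: "int \<Rightarrow> int" where
  "mexp a = geom a (nat a) - a ^ nat a"

text \<open>Multiplication by \<open>u\<close> turns the geometric sum into a power of
  \<open>1 + u\<close>, whose double is known modulo \<open>2 ^ (4 * m)\<close>; cancelling
  \<open>u\<close> again costs \<open>2 ^ m\<close>.\<close>

lemma mexp_approx:
  assumes "u = 2 ^ m * u'" "odd u'" "u > 0" "m \<ge> 1"
  shows "2 ^ (3 * m) dvd 2 * mexp (1 + u) + u\<^sup>2"
proof -
  define n where "n = nat u"
  have n: "int n = u" using assms(3) by (simp add: n_def)
  have "int (2 ^ m) dvd int n" unfolding n assms(1) by simp
  then have "2 ^ m dvd n" by (simp only: int_dvd_int_iff)
  then obtain k where k: "n = 2 ^ m * k" by (auto simp: dvd_def)
  have du: "2 ^ m dvd u" unfolding assms(1) by simp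
  define Y where "Y = (1 + u) ^ n"
  have "2 ^ (m + 3 * m) dvd 2 * (Y - 1 - u * u) - u\<^sup>2 * u * (u - 1)"
    using binomial_second_order[OF du assms(4), of m k] unfolding k[symmetric] n Y_def .
  then obtain z where z: "2 * (Y - 1 - u * u) - u\<^sup>2 * u * (u - 1) = 2 ^ (4 * m) * z" by (auto simp: dvd_def)
  then have Y: "2 * Y = 2 + 2 * u\<^sup>2 + u ^ 3 * (u - 1) + 2 ^ (4 * m) * z"
    by (simp add: algebra_simps power2_eq_square power3_eq_cube)
  have a: "(1 + u) ^ nat (1 + u) = (1 + u) * Y"
    using assms(3) unfolding Y_def n_def by (simp add: nat_add_distrib)
  have "u * mexp (1 + u) = (1 + u) ^ nat (1 + u) - 1 - u * (1 + u) ^ nat (1 + u)"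
    unfolding mexp_def using geom_mult[of "1 + u" "nat (1 + u)"] by (simp add: right_diff_distrib)
  also have "\<dots> = (1 - u) * ((1 + u) * Y) - 1" unfolding a by (simp add: algebra_simps)
  finally have "u * (2 * mexp (1 + u)) = (1 - u\<^sup>2) * (2 * Y) - 2"
    by (simp add: algebra_simps power2_eq_square)
  also have "\<dots> = - u * u\<^sup>2 + u ^ 4 * (- 1 + u - u\<^sup>2) + 2 ^ (4 * m) * (z * (1 - u\<^sup>2))"
    unfolding Y by (simp add: algebra_simps power2_eq_square power3_eq_cube power4_eq_xxxx)
  finally have "u * (2 * mexp (1 + u) + u\<^sup>2) = u ^ 4 * (- 1 + u - u\<^sup>2) + 2 ^ (4 * m) * (z * (1 - u\<^sup>2))"
    by (simp add: algebra_simps)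
  also have "u ^ 4 = 2 ^ (4 * m) * u' ^ 4"
    unfolding assms(1) power_mult_distrib by (metis mult.commute power_mult)
  finally have "2 ^ (4 * m) dvd u * (2 * mexp (1 + u) + u\<^sup>2)" by (simp add: mult.assoc flip: distrib_left)
  moreover have "(2::int) ^ (4 * m) = 2 ^ m * 2 ^ (3 * m)" by (simp flip: power_add)
  ultimately have "2 ^ m * 2 ^ (3 * m) dvd 2 ^ m * (u' * (2 * mexp (1 + u) + u\<^sup>2))"
    unfolding assms(1) by (simp only: mult.assoc)
  then have "2 ^ (3 * m) dvd u' * (2 * mexp (1 + u) + u\<^sup>2)" by (subst (asm) dvd_mult_cancel_left) simp
  moreover have "coprime (2 ^ (3 * m)) u'" using assms(2) by simp
  ultimately show ?thesis by (metis coprime_dvd_mult_right_iff)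
qed

lemma mexp_valuation:
  assumes "u = 2 ^ m * u'" "odd u'" "u > 0" "m \<ge> 1"
  obtains e' where "odd e'" "mexp (1 + u) = 2 ^ (2 * m - 1) * e'"
    "2 ^ (3 * m - 1) dvd mexp (1 + u) + 2 ^ (2 * m - 1) * u'\<^sup>2"
proof -
  obtain z where z: "2 * mexp (1 + u) + u\<^sup>2 = 2 ^ (3 * m) * z"
    using mexp_approx[OF assms] by (auto simp: dvd_def)
  have p: "(2::int) ^ (2 * m) = 2 * 2 ^ (2 * m - 1)" "(2::int) ^ (3 * m) = 2 * 2 ^ (3 * m - 1)"
    "(2::int) ^ (3 * m - 1) = 2 ^ (2 * m - 1) * 2 ^ m"
  proof -
    have "2 * m = Suc (2 * m - 1)" "3 * m = Suc (3 * m - 1)" "3 * m - 1 = (2 * m - 1) + m" using assms(4) by auto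
    then show "(2::int) ^ (2 * m) = 2 * 2 ^ (2 * m - 1)" "(2::int) ^ (3 * m) = 2 * 2 ^ (3 * m - 1)"
      "(2::int) ^ (3 * m - 1) = 2 ^ (2 * m - 1) * 2 ^ m"
      by (metis power_Suc power_add)+
  qed
  have "u\<^sup>2 = 2 ^ (2 * m) * u'\<^sup>2" unfolding assms(1) power_mult_distrib by (metis mult.commute power_mult)
  with z p have "2 * (mexp (1 + u) + 2 ^ (2 * m - 1) * u'\<^sup>2) = 2 * (2 ^ (3 * m - 1) * z)" by simp
  then have e: "mexp (1 + u) + 2 ^ (2 * m - 1) * u'\<^sup>2 = 2 ^ (3 * m - 1) * z" by simp
  show thesis
  proof (rule that)
    show "odd (2 ^ m * z - u'\<^sup>2)" using assms(2,4) by simp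
    show "mexp (1 + u) = 2 ^ (2 * m - 1) * (2 ^ m * z - u'\<^sup>2)" using e p(3) by (simp add: algebra_simps)
    show "2 ^ (3 * m - 1) dvd mexp (1 + u) + 2 ^ (2 * m - 1) * u'\<^sup>2" unfolding e by simp
  qed
qed

text \<open>The expression is the exponent \<open>g\<close> in \<open>[A^n, B] = C^n A^g\<close>. To
  leading order \<open>2 * g = u * n\<close>, which has valuation \<open>3 * m - 1\<close>.\<close>

lemma commutator_exponent_valuation:
  assumes "u = 2 ^ m * u'" "odd u'" "m \<ge> 2" "int n = 2 ^ (2 * m - 1) * n'" "odd n'"
  obtains g' where "odd g'" "(1 + u) * geom (1 + u) n - int n * (1 + u) ^ n = 2 ^ (3 * m - 2) * g'"
proof -
  define N where "N = int n"
  define g where "g = (1 + u) * geom (1 + u) n - N * (1 + u) ^ n"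
  have "int (2 ^ (2 * m - 1)) dvd int n" unfolding assms(4) by simp
  then have "2 ^ (2 * m - 1) dvd n" by (simp only: int_dvd_int_iff)
  then obtain k where k: "n = 2 ^ (2 * m - 1) * k" by (auto simp: dvd_def)
  have du: "2 ^ m dvd u" and m1: "m \<ge> 1" using assms by simp_all
  define Y where "Y = (1 + u) ^ n - 1"
  have "2 ^ (2 * m - 1 + 3 * m) dvd 2 * (Y - N * u) - u\<^sup>2 * N * (N - 1)"
    using binomial_second_order[OF du m1, of "2 * m - 1" k] unfolding k[symmetric] Y_def N_def by simp
  then obtain z where z: "2 * (Y - N * u) - u\<^sup>2 * N * (N - 1) = 2 ^ (2 * m - 1 + 3 * m) * z" by (auto simp: dvd_def)
  let ?P = "(2::int) ^ (2 * m - 1 + 3 * m)"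
  have P: "?P = 2 ^ m * 2 ^ (4 * m - 1)" "?P = 2 ^ (2 * m - 1) * 2 ^ (3 * m)"
    "(2::int) ^ (4 * m - 1) = 2 * 2 ^ (3 * m - 2) * 2 ^ m"
    "(2::int) ^ m * 2 ^ (2 * m - 1) = 2 * 2 ^ (3 * m - 2)"
  proof -
    have "2 * m - 1 + 3 * m = m + (4 * m - 1)" "4 * m - 1 = Suc (3 * m - 2 + m)" "m + (2 * m - 1) = Suc (3 * m - 2)"
      using assms(3) by auto
    then show "?P = 2 ^ m * 2 ^ (4 * m - 1)" "?P = 2 ^ (2 * m - 1) * 2 ^ (3 * m)"
      "(2::int) ^ (4 * m - 1) = 2 * 2 ^ (3 * m - 2) * 2 ^ m"
      "(2::int) ^ m * 2 ^ (2 * m - 1) = 2 * 2 ^ (3 * m - 2)"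
      by (metis power_add power_Suc mult.assoc)+
  qed
  have Y: "2 * Y = 2 * N * u + u\<^sup>2 * N * (N - 1) + ?P * z" using z by (simp add: algebra_simps)
  have gm: "u * geom (1 + u) n = Y" unfolding Y_def using geom_mult[of "1 + u" n] by simp
  have "u * (2 * g) = 2 * (1 + u) * (u * geom (1 + u) n) - 2 * u * N * (Y + 1)"
    unfolding g_def Y_def by (simp add: algebra_simps)
  also have "\<dots> = (1 + u) * (2 * Y) - 2 * u * N * (Y + 1)" unfolding gm by simp
  also have "\<dots> = (2 * Y) * (1 + u - u * N) - 2 * u * N" by (simp add: algebra_simps)
  also have "\<dots> = u * u * N + u ^ 3 * N * (- 1 + 2 * N - N\<^sup>2) - u\<^sup>2 * N\<^sup>2 + ?P * (z * (1 + u - u * N))"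
    unfolding Y by (simp add: algebra_simps power2_eq_square power3_eq_cube)
  finally have ug: "u * (2 * g - u * N) = u ^ 3 * N * (- 1 + 2 * N - N\<^sup>2) - u\<^sup>2 * N\<^sup>2 + ?P * (z * (1 + u - u * N))"
    by (simp add: algebra_simps)
  have "?P dvd u ^ 3 * N"
  proof -
    have "u ^ 3 = 2 ^ (3 * m) * u' ^ 3" unfolding assms(1) power_mult_distrib by (metis mult.commute power_mult)
    then show ?thesis unfolding N_def assms(4) P(2) by simp
  qed
  moreover have "?P dvd u\<^sup>2 * N\<^sup>2"
  proof -
    have "u\<^sup>2 * N\<^sup>2 = 2 ^ (2 * m) * 2 ^ (2 * (2 * m - 1)) * (u' * n')\<^sup>2"
      unfolding assms(1) N_def assms(4) power_mult_distrib by (simp add: mult.commute flip: power_mult)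
    also have "(2::int) ^ (2 * m) * 2 ^ (2 * (2 * m - 1)) = ?P * 2 ^ (m - 1)"
    proof -
      have "2 * m + 2 * (2 * m - 1) = 2 * m - 1 + 3 * m + (m - 1)" using assms(3) by simp
      then show ?thesis by (metis power_add)
    qed
    finally show ?thesis by simp
  qed
  ultimately have "?P dvd u * (2 * g - u * N)" unfolding ug by (intro dvd_add dvd_diff) auto
  then have "2 ^ m * 2 ^ (4 * m - 1) dvd 2 ^ m * (u' * (2 * g - u * N))"
    unfolding P(1) assms(1) by (simp only: mult.assoc)
  then have "2 ^ (4 * m - 1) dvd u' * (2 * g - u * N)" by (subst (asm) dvd_mult_cancel_left) simp
  moreover have "coprime (2 ^ (4 * m - 1)) u'" using assms(2) by simp
  ultimately have "2 ^ (4 * m - 1) dvd 2 * g - u * N" by (metis coprime_dvd_mult_right_iff)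
  then obtain w where w: "2 * g - u * N = 2 ^ (4 * m - 1) * w" by (auto simp: dvd_def)
  have "u * N = (2 ^ m * 2 ^ (2 * m - 1)) * (u' * n')" unfolding assms(1) N_def assms(4) by simp
  then have "2 * g = 2 * (2 ^ (3 * m - 2) * (u' * n' + 2 ^ m * w))"
    using w unfolding P(3,4) by (simp add: algebra_simps)
  then have g: "g = 2 ^ (3 * m - 2) * (u' * n' + 2 ^ m * w)" by simp
  show thesis
  proof (rule that)
    show "odd (u' * n' + 2 ^ m * w)" using assms by simp
    show "(1 + u) * geom (1 + u) n - int n * (1 + u) ^ n = 2 ^ (3 * m - 2) * (u' * n' + 2 ^ m * w)"
      using g unfolding g_def N_def .
  qed
qed

text \<open>Exponents above 1 make \<open>\<alpha>\<close> and \<open>\<beta>\<close> themselves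
  natural numbers, so the fundamental relation is available for \<open>k = 1\<close>. The order
  bound \<open>2 ^ t\<close> is provisional and is lowered to \<open>2 ^ (3 * m - 1)\<close> by
  \<open>improved\<close>.\<close>

locale macdonald2 = macdonald +
  fixes m l t :: nat and u' v' d' :: int
  assumes A_ord: "A [^] ((2::int) ^ t) = \<one>" and B_ord: "B [^] ((2::int) ^ t) = \<one>"
    and C_ord: "C [^] ((2::int) ^ t) = \<one>"
    and \<alpha>_pos: "\<alpha> > 1" and \<beta>_pos: "\<beta> > 1"
    and \<alpha>: "\<alpha> = 1 + 2 ^ m * u'" and \<beta>: "\<beta> = 1 + 2 ^ m * v'" and \<alpha>\<beta>: "\<alpha> - \<beta> = 2 ^ l * d'"
    and odds: "odd u'" "odd v'" "odd d'"
    and m3: "3 \<le> m" and ml: "m < l" and l2m: "l + 3 \<le> 2 * m" and l3m: "3 * m < 2 * l + 1"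
    and t: "3 * m - 1 \<le> t"
begin

lemma swapped2: "macdonald2 G B A (inv C) \<beta> \<alpha> m l t v' u' (- d')"
proof (intro macdonald2.intro swapped macdonald2_axioms.intro)
  show "inv C [^] ((2::int) ^ t) = \<one>" using C_ord by (simp add: int_pow_inv)
  show "\<beta> - \<alpha> = 2 ^ l * - d'" using \<alpha>\<beta> by simp
qed (use A_ord B_ord \<alpha>_pos \<beta>_pos \<alpha> \<beta> odds m3 ml l2m l3m t in auto)

abbreviation "e \<equiv> mexp \<alpha>"

lemma e_obtain:
  obtains e' where "odd e'" "e = 2 ^ (2 * m - 1) * e'" "2 ^ (3 * m - 1) dvd e + 2 ^ (2 * m - 1) * u'\<^sup>2"
  using mexp_valuation[of "2 ^ m * u'" m u'] \<alpha> \<alpha>_pos odds m3 by auto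

lemma relation1: "B [^] (- mexp \<beta>) \<otimes> C [^] (\<beta> - 1) = C [^] (\<alpha> - 1) \<otimes> A [^] e"
proof -
  let ?p = "nat \<alpha>" and ?q = "nat \<beta>"
  have p: "int ?p = \<alpha> ^ 1" "int ?q = \<beta> ^ 1" using \<alpha>_pos \<beta>_pos by simp_all
  \<comment> \<open>The common factors \<open>\<alpha>\<close> and \<open>\<beta>\<close> are
    exactly what conjugation by one \<open>C\<close> produces: both sides take the form
    \<open>C x C\<close>, and the outer letters cancel.\<close>
  have E: "\<alpha> * geom \<alpha> ?p - \<alpha> ^ (?p + 1) = \<alpha> ^ 1 * e" by (simp add: mexp_def algebra_simps)
  have F: "int ?q * \<beta> ^ ?q - \<beta> * geom \<beta> ?q = \<beta> ^ 1 * (- mexp \<beta>)"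
    using \<beta>_pos by (simp add: mexp_def algebra_simps)
  have q1: "int (?q + 1) = 1 + ((\<beta> - 1) + 1)" and p1: "int (?p + 1) = (\<alpha> - 1) + 1 + 1"
    using \<alpha>_pos \<beta>_pos by simp_all
  have "B [^] (\<beta> ^ 1 * (- mexp \<beta>)) \<otimes> C [^] (int (?q + 1)) = C [^] (int (?p + 1)) \<otimes> A [^] (\<alpha> ^ 1 * e)"
    using fundamental_relation[OF p] unfolding E F .
  moreover have "B [^] (\<beta> ^ 1 * (- mexp \<beta>)) \<otimes> C [^] (int (?q + 1))
      = C \<otimes> (B [^] (- mexp \<beta>) \<otimes> C [^] (\<beta> - 1)) \<otimes> C"
    using Cn_B[of 1 "- mexp \<beta>"] unfolding q1 int_pow_mult[OF C] by (simp add: m_assoc flip: m_assoc)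
  moreover have "C [^] (int (?p + 1)) \<otimes> A [^] (\<alpha> ^ 1 * e) = C \<otimes> (C [^] (\<alpha> - 1) \<otimes> A [^] e) \<otimes> C"
  proof -
    have "C [^] (\<alpha> - 1) \<otimes> C = C \<otimes> C [^] (\<alpha> - 1)"
      using int_pow_mult[of C "\<alpha> - 1" 1] int_pow_mult[of C 1 "\<alpha> - 1"] by simp
    then have "C [^] (int (?p + 1)) = C \<otimes> C [^] (\<alpha> - 1) \<otimes> C"
      unfolding p1 int_pow_mult[OF C] by simp
    then show ?thesis using A_Cn[of e 1] by (simp add: m_assoc)
  qed
  ultimately show ?thesis by simp
qed

lemma B_pow_power_cong:
  assumes "[int a = int b] (mod 2 ^ t)" shows "B [^] (\<beta> ^ a) = B [^] (\<beta> ^ b)"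
proof -
  have "C [^] int a = C [^] int b"
    using int_pow_cong_mod[OF C C_ord] assms by (simp add: cong_iff_dvd_diff)
  then show ?thesis using Cn_B[of a 1] Cn_B[of b 1] by simp
qed

text \<open>A natural representative of \<open>\<alpha> - \<beta>\<close> modulo
  \<open>2 ^ t\<close>, so that \<open>\<beta> ^ n\<close> makes sense.\<close>

definition "n = nat ((\<alpha> - \<beta>) mod 2 ^ t)"

lemma int_n: "int n = (\<alpha> - \<beta>) mod 2 ^ t" by (simp add: n_def)

lemma n_cong: "2 ^ t dvd int n - (\<alpha> - \<beta>)"
  unfolding int_n by (simp add: mod_eq_dvd_iff[symmetric])

lemma n_dvd: "2 ^ l dvd n"
proof -
  have "(2::int) ^ l dvd 2 ^ t" using t ml l2m by (simp add: le_imp_power_dvd)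
  then have "(2::int) ^ l dvd int n - (\<alpha> - \<beta>)" using n_cong dvd_trans by blast
  then have "(2::int) ^ l dvd (int n - (\<alpha> - \<beta>)) + (\<alpha> - \<beta>)" by (rule dvd_add) (simp add: \<alpha>\<beta>)
  then have "int (2 ^ l) dvd int n" by simp
  then show ?thesis by (simp only: int_dvd_int_iff)
qed

text \<open>By \<open>relation1\<close>, \<open>Y = C^(\<alpha>-1) A^e\<close> is also a power of
  \<open>B\<close> times \<open>C^(\<beta>-1)\<close>. Hence \<open>A^e\<close> acts on
  \<open>B\<close> as \<open>C^(\<beta>-\<alpha>)\<close> does and normalises the cyclic group of
  \<open>B\<close>.\<close>

lemma B_A_e: "B \<otimes> A [^] e = A [^] e \<otimes> B [^] (\<beta> ^ n)"
proof -
  define Y where "Y = C [^] (\<alpha> - 1) \<otimes> A [^] e"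
  have [simp]: "Y \<in> carrier G" by (simp add: Y_def)
  have Y: "Y = B [^] (- mexp \<beta>) \<otimes> C [^] (\<beta> - 1)" using relation1 by (simp add: Y_def)
  define a b where "a = nat (\<alpha> - 1)" and "b = nat (\<beta> - 1)"
  have ab: "int a = \<alpha> - 1" "int b = \<beta> - 1" using \<alpha>_pos \<beta>_pos by (simp_all add: a_def b_def)
  have "C [^] (\<alpha> - 1) \<otimes> (B \<otimes> A [^] e) = (C [^] int a \<otimes> B [^] (1::int)) \<otimes> A [^] e"
    by (simp add: ab m_assoc)
  also have "\<dots> = B [^] (\<beta> ^ a) \<otimes> Y" unfolding Cn_B Y_def by (simp add: ab m_assoc)
  also have "B [^] (\<beta> ^ a) = B [^] (\<beta> ^ (b + n))"
  proof (rule B_pow_power_cong)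
    have "2 ^ t dvd - (int n - (\<alpha> - \<beta>))" using n_cong by (simp only: dvd_minus_iff)
    moreover have "int a - int (b + n) = - (int n - (\<alpha> - \<beta>))" using ab by simp
    ultimately show "[int a = int (b + n)] (mod 2 ^ t)" by (simp only: cong_iff_dvd_diff)
  qed
  also have "B [^] (\<beta> ^ (b + n)) \<otimes> Y = B [^] (- mexp \<beta>) \<otimes> (B [^] (\<beta> ^ b * \<beta> ^ n) \<otimes> C [^] int b)"
    unfolding Y by (simp add: ab int_pow_mult_r power_add add.commute)
  also have "\<dots> = Y \<otimes> B [^] (\<beta> ^ n)"
    unfolding Cn_B[symmetric] Y by (simp add: ab m_assoc)
  also have "\<dots> = C [^] (\<alpha> - 1) \<otimes> (A [^] e \<otimes> B [^] (\<beta> ^ n))" unfolding Y_def by (simp add: m_assoc)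
  finally show ?thesis by simp
qed

lemma B_A_e_pow: "B \<otimes> A [^] (e * int r) = A [^] (e * int r) \<otimes> B [^] (\<beta> ^ (n * r))"
proof (induction r)
  case (Suc r)
  have b: "B [^] (\<beta> ^ (n * r)) \<otimes> A [^] e = A [^] e \<otimes> B [^] (\<beta> ^ n * \<beta> ^ (n * r))"
    using conj_int_pow[OF B_A_e] by (simp add: int_pow_pow)
  have "B \<otimes> A [^] (e * int (Suc r)) = (B \<otimes> A [^] (e * int r)) \<otimes> A [^] e"
    by (simp add: m_assoc int_pow_mult[symmetric] algebra_simps)
  also have "\<dots> = A [^] (e * int r) \<otimes> (A [^] e \<otimes> B [^] (\<beta> ^ n * \<beta> ^ (n * r)))"
    unfolding Suc using b by (simp add: m_assoc)
  also have "\<dots> = A [^] (e * int (Suc r)) \<otimes> B [^] (\<beta> ^ (n * Suc r))"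
    by (simp add: int_pow_mult_r algebra_simps power_add)
  finally show ?case .
qed simp

text \<open>\<open>e\<close> is negative, whereas \<open>An_B\<close> needs a natural
  exponent.\<close>

definition "e1 = nat (e mod 2 ^ t)"

lemma int_e1: "int e1 = e mod 2 ^ t" by (simp add: e1_def)

lemma e1_cong: "2 ^ t dvd int e1 - e"
  unfolding int_e1 by (simp add: mod_eq_dvd_iff[symmetric])

lemma A_e1: "A [^] int e1 = A [^] e" and C_e1: "C [^] int e1 = C [^] e"
  using int_pow_cong_mod[OF A A_ord e1_cong] int_pow_cong_mod[OF C C_ord e1_cong] by simp_all

lemma e1_obtain: obtains e' where "odd e'" "int e1 = 2 ^ (2 * m - 1) * e'"
proof -
  obtain e' where e': "odd e'" "e = 2 ^ (2 * m - 1) * e'" by (rule e_obtain)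
  obtain z where z: "int e1 - e = 2 ^ t * z" using e1_cong by (auto simp: dvd_def)
  have tm: "t = (2 * m - 1) + Suc (t - 2 * m)" using t m3 by simp
  have "(2::int) ^ t = 2 ^ (2 * m - 1) * (2 * 2 ^ (t - 2 * m))" by (subst tm) (simp add: power_add)
  then have "int e1 = 2 ^ (2 * m - 1) * (e' + 2 * (2 ^ (t - 2 * m) * z))" using z e'(2) by (simp add: algebra_simps)
  moreover have "odd (e' + 2 * (2 ^ (t - 2 * m) * z))" using e'(1) by simp
  ultimately show thesis using that by blast
qed

definition "gx = \<alpha> * geom \<alpha> e1 - int e1 * \<alpha> ^ e1"

lemma gx_obtain: obtains g' where "odd g'" "gx = 2 ^ (3 * m - 2) * g'"
proof -
  obtain e' where e': "odd e'" "int e1 = 2 ^ (2 * m - 1) * e'" by (rule e1_obtain)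
  have "m \<ge> 2" using m3 by simp
  then obtain g' where "odd g'" "(1 + 2 ^ m * u') * geom (1 + 2 ^ m * u') e1 - int e1 * (1 + 2 ^ m * u') ^ e1 = 2 ^ (3 * m - 2) * g'"
    by (rule commutator_exponent_valuation[OF HOL.refl odds(1) _ e'(2,1)])
  then show thesis using that[of g'] unfolding gx_def \<alpha>[symmetric] by simp
qed

text \<open>Both sides are the commutator \<open>[A^e, B]\<close>: the left one by
  \<open>An_B\<close>, the right one by \<open>B_A_e\<close>.\<close>

lemma relation2: "C [^] e \<otimes> A [^] gx = B [^] (1 - \<beta> ^ n)"
proof -
  have "B \<otimes> (C [^] int e1 \<otimes> A [^] (\<alpha> * geom \<alpha> e1)) = A [^] e \<otimes> B"
    using An_B[of e1] by (simp add: A_e1)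
  also have "\<dots> = B \<otimes> (A [^] e \<otimes> B [^] (1 - \<beta> ^ n))"
  proof -
    have "B \<otimes> (A [^] e \<otimes> B [^] (1 - \<beta> ^ n)) = A [^] e \<otimes> (B [^] (\<beta> ^ n) \<otimes> B [^] (1 - \<beta> ^ n))"
      using B_A_e by (simp flip: m_assoc)
    then show ?thesis by (simp add: int_pow_mult[symmetric])
  qed
  finally have "C [^] int e1 \<otimes> A [^] (\<alpha> * geom \<alpha> e1) = A [^] int e1 \<otimes> B [^] (1 - \<beta> ^ n)"
    by (simp add: A_e1)
  then have "B [^] (1 - \<beta> ^ n) = A [^] (- int e1) \<otimes> (C [^] int e1 \<otimes> A [^] (\<alpha> * geom \<alpha> e1))"
    by (simp add: int_pow_mult_r)
  also have "\<dots> = C [^] int e1 \<otimes> A [^] gx"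
    unfolding gx_def by (subst A_Cn_r) (simp_all add: int_pow_mult[symmetric] algebra_simps)
  finally show ?thesis by (simp add: C_e1)
qed

lemma B_pow_odd_one:
  assumes "B [^] (2 ^ k * r) = \<one>" "odd (r::int)" shows "B [^] ((2::int) ^ k) = \<one>"
proof -
  have "(B [^] ((2::int) ^ k)) [^] ((2::int) ^ t) = (B [^] ((2::int) ^ t)) [^] ((2::int) ^ k)"
    by (simp add: int_pow_pow mult.commute)
  then have "(B [^] ((2::int) ^ k)) [^] ((2::int) ^ t) = \<one>" by (simp add: B_ord)
  then obtain s where "odd s" "((B [^] ((2::int) ^ k)) [^] r) [^] (s::int) = B [^] ((2::int) ^ k)"
    by (rule pow_inverse_odd[OF int_pow_closed[OF B] _ assms(2)])
  then show ?thesis using assms(1) by (simp add: int_pow_pow)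
qed

lemma \<beta>_pow: "2 ^ k dvd r \<Longrightarrow> 2 ^ (k + 2 * m - 1) dvd \<beta> ^ r - 1 - int r * (2 ^ m * v')"
  using binomial_first_order[of m "2 ^ m * v'" k r] m3 \<beta> by simp

lemma \<beta>_pow_dvd: "2 ^ k dvd r \<Longrightarrow> 2 ^ (k + m) dvd \<beta> ^ r - 1"
proof -
  assume r: "2 ^ k dvd r"
  then have "int (2 ^ k) dvd int r" by (simp only: int_dvd_int_iff)
  then have "2 ^ (k + m) dvd int r * (2 ^ m * v')" by (auto simp: power_add intro: mult_dvd_mono)
  moreover have "2 ^ (k + m) dvd \<beta> ^ r - 1 - int r * (2 ^ m * v')"
    by (rule dvd_trans[OF le_imp_power_dvd \<beta>_pow[OF r]]) (use m3 in simp)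
  ultimately show ?thesis by (metis diff_add_cancel dvd_add)
qed

text \<open>By \<open>relation2\<close>, \<open>C^e A^gx\<close> is a power of \<open>B\<close> and
  centralises \<open>B\<close>. Its factors act on \<open>B\<close> through
  \<open>\<beta>^e1\<close> and, as \<open>A^gx\<close> is a power of \<open>A^e\<close>, through
  \<open>\<beta>^(n r)\<close>. So \<open>\<beta>^e1 - \<beta>^(n r)\<close> kills \<open>B\<close>;
  its valuation is exactly \<open>3 * m - 1\<close>, because \<open>\<beta>^(n r)\<close> is 1
  modulo \<open>2^(3m)\<close>.\<close>

lemma B_order_bound: "B [^] ((2::int) ^ (3 * m - 1)) = \<one>"
proof -
  obtain e' where e': "odd e'" "e = 2 ^ (2 * m - 1) * e'" by (rule e_obtain)
  obtain f' where f': "odd f'" "int e1 = 2 ^ (2 * m - 1) * f'" by (rule e1_obtain)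
  obtain g' where g': "odd g'" "gx = 2 ^ (3 * m - 2) * g'" by (rule gx_obtain)
  obtain s where "[e' * s = g'] (mod 2 ^ t)"
    using cong_solve_coprime_int[of e' "2 ^ t"] e'(1)
    by (metis cong_scalar_right coprime_power_right_iff coprime_right_2_iff_odd mult.assoc mult_1)
  then have s: "2 ^ t dvd g' - e' * s" by (metis cong_iff_dvd_diff cong_sym)
  define s1 where "s1 = nat (s mod 2 ^ t)"
  have "2 ^ t dvd s - int s1" unfolding s1_def by (simp add: minus_mod_eq_mult_div)
  then have s1: "2 ^ t dvd (g' - e' * s) + e' * (s - int s1)" using s by (intro dvd_add dvd_mult)
  \<comment> \<open>\<open>gx / e\<close> is \<open>2 ^ (m - 1)\<close> times the odd quotient
    \<open>g' / e'\<close>; \<open>s1\<close> represents that quotient modulo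
    \<open>2 ^ t\<close>.\<close>
  define r where "r = 2 ^ (m - 1) * s1"
  have p: "(2::int) ^ (3 * m - 2) = 2 ^ (2 * m - 1) * 2 ^ (m - 1)"
  proof -
    have "3 * m - 2 = (2 * m - 1) + (m - 1)" using m3 by simp
    then show ?thesis by (metis power_add)
  qed
  have "gx - e * int r = 2 ^ (3 * m - 2) * ((g' - e' * s) + e' * (s - int s1))"
    unfolding g' e' r_def p by (simp add: algebra_simps)
  then have "2 ^ t dvd gx - e * int r" using s1 by simp
  then have gr: "A [^] gx = A [^] (e * int r)" by (rule int_pow_cong_mod[OF A A_ord])
  have "B [^] (\<beta> ^ e1) \<otimes> (C [^] int e1 \<otimes> A [^] gx) = (C [^] int e1 \<otimes> B) \<otimes> A [^] gx"
    using Cn_B[of e1 1] by (simp add: m_assoc)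
  also have "\<dots> = (C [^] int e1 \<otimes> A [^] gx) \<otimes> B [^] (\<beta> ^ (n * r))"
    using B_A_e_pow[of r] unfolding gr by (simp add: m_assoc)
  also have "C [^] int e1 \<otimes> A [^] gx = B [^] (1 - \<beta> ^ n)" using relation2 by (simp add: C_e1)
  finally have "B [^] (\<beta> ^ e1) \<otimes> B [^] (1 - \<beta> ^ n) = B [^] (\<beta> ^ (n * r)) \<otimes> B [^] (1 - \<beta> ^ n)"
    by (simp add: int_pow_mult[symmetric] add.commute)
  then have eq: "B [^] (\<beta> ^ e1 - \<beta> ^ (n * r)) = \<one>"
    by (simp add: int_pow_diff)
  have d1: "2 ^ (2 * m - 1) dvd e1"
  proof -
    have "int (2 ^ (2 * m - 1)) dvd int e1" unfolding f' by simp
    then show ?thesis by (simp only: int_dvd_int_iff)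
  qed
  have "2 ^ (3 * m) dvd \<beta> ^ e1 - 1 - int e1 * (2 ^ m * v')"
    by (rule dvd_trans[OF le_imp_power_dvd \<beta>_pow[OF d1]]) (use m3 in simp)
  moreover have "2 ^ (l + (m - 1)) dvd n * r" unfolding r_def power_add using n_dvd by (simp add: mult_dvd_mono)
  from \<beta>_pow_dvd[OF this] have "2 ^ (3 * m) dvd \<beta> ^ (n * r) - 1"
    by (rule dvd_trans[OF le_imp_power_dvd, rotated]) (use m3 ml in simp)
  ultimately have "2 ^ (3 * m) dvd (\<beta> ^ e1 - 1 - int e1 * (2 ^ m * v')) - (\<beta> ^ (n * r) - 1)" by (rule dvd_diff)
  then obtain z where z: "\<beta> ^ e1 - \<beta> ^ (n * r) = int e1 * (2 ^ m * v') + 2 ^ (3 * m) * z"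
    by (auto simp: dvd_def algebra_simps)
  have "(2::int) ^ (3 * m) = 2 ^ (3 * m - 1) * 2" "(2::int) ^ (2 * m - 1) * 2 ^ m = 2 ^ (3 * m - 1)"
    using m3 by (simp_all flip: power_add power_Suc2)
  then have "\<beta> ^ e1 - \<beta> ^ (n * r) = 2 ^ (3 * m - 1) * (f' * v' + 2 * z)"
    using z unfolding f' by (simp add: algebra_simps)
  then show ?thesis using eq f' odds by (intro B_pow_odd_one[of _ "f' * v' + 2 * z"]) simp_all
qed

end

lemma (in group) commute_int_pow:
  assumes "x \<otimes> y = y \<otimes> x" "x \<in> carrier G" "y \<in> carrier G"
  shows "x [^] (i::int) \<otimes> y [^] (j::int) = y [^] j \<otimes> x [^] i"
proof -
  have 1: "x [^] i \<otimes> y = y \<otimes> x [^] i" by (rule conj_int_pow) (use assms in auto)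
  have "y [^] j \<otimes> x [^] i = x [^] i \<otimes> y [^] j"
    by (rule conj_int_pow) (use 1 assms in auto)
  then show ?thesis by simp
qed

context macdonald2
begin

lemma improved: "macdonald2 G A B C \<alpha> \<beta> m l (3 * m - 1) u' v' d'"
proof -
  interpret sw: macdonald2 G B A "inv C" \<beta> \<alpha> m l t v' u' "- d'" by (rule swapped2)
  let ?N = "2 ^ (3 * m - 1) :: nat"
  have A1: "A [^] ((2::int) ^ (3 * m - 1)) = \<one>" by (rule sw.B_order_bound)
  have "int ?N dvd geom \<alpha> ?N"
  proof (rule dvd_geom_self)
    show "int p dvd \<alpha> - 1" if "Factorial_Ring.prime p" "p dvd 2 ^ (3 * m - 1)" for p
    proof -
      have "p = 2" using that by (metis prime_dvd_power primes_dvd_imp_eq two_is_prime_nat)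
      then show ?thesis using m3 by (simp add: \<alpha>)
    qed
  qed simp
  then have "(2::int) ^ (3 * m - 1) dvd \<alpha> * geom \<alpha> ?N - 0" by simp
  from int_pow_cong_mod[OF A A1 this] have "A [^] (\<alpha> * geom \<alpha> ?N) = \<one>" by simp
  then have "C [^] ((2::int) ^ (3 * m - 1)) = \<one>"
    using An_B[of ?N] A1 by simp
  then show ?thesis
    by unfold_locales (use A1 B_order_bound \<alpha>_pos \<beta>_pos \<alpha> \<beta> \<alpha>\<beta> odds m3 ml l2m l3m in auto)
qed

end

text \<open>At this value of \<open>t\<close> exponents count modulo \<open>2 ^ (3 * m - 1)\<close>,
  the precision to which \<open>mexp \<alpha>\<close> and \<open>mexp \<beta>\<close> are
  known.\<close>

locale macdonald2t = macdonald2 +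
  assumes t_eq: "t = 3 * m - 1"
begin

lemma swapped2t: "macdonald2t G B A (inv C) \<beta> \<alpha> m l t v' u' (- d')"
  by (intro macdonald2t.intro swapped2 macdonald2t_axioms.intro t_eq)

text \<open>\<open>uu\<close> and \<open>vv\<close> are \<open>(\<alpha>-1)^2/2\<close> and
  \<open>(\<beta>-1)^2/2\<close>, the leading terms of \<open>- mexp \<alpha>\<close> and
  \<open>- mexp \<beta>\<close>. The element \<open>\<zeta>\<close> is the value of
  \<open>A^gx\<close>.\<close>

abbreviation "uu \<equiv> 2 ^ (2 * m - 1) * u'\<^sup>2"
abbreviation "vv \<equiv> 2 ^ (2 * m - 1) * v'\<^sup>2"
abbreviation "\<zeta> \<equiv> A [^] ((2::int) ^ (3 * m - 2))"

lemma A_cong: "2 ^ (3 * m - 1) dvd i - j \<Longrightarrow> A [^] (i::int) = A [^] j"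
  and B_cong: "2 ^ (3 * m - 1) dvd i - j \<Longrightarrow> B [^] (i::int) = B [^] j"
  and C_cong: "2 ^ (3 * m - 1) dvd i - j \<Longrightarrow> C [^] (i::int) = C [^] j"
  using int_pow_cong_mod[OF A A_ord] int_pow_cong_mod[OF B B_ord] int_pow_cong_mod[OF C C_ord]
  unfolding t_eq by auto

lemma A_e: "A [^] e = A [^] (- uu)" and C_e: "C [^] e = C [^] (- uu)"
proof -
  obtain e' where "2 ^ (3 * m - 1) dvd e + uu" by (rule e_obtain)
  then show "A [^] e = A [^] (- uu)" "C [^] e = C [^] (- uu)"
    by (auto intro!: A_cong C_cong)
qed

lemma pow_split: "(2::int) ^ (3 * m - 1) = 2 ^ (2 * m - 1) * 2 ^ m"
proof -
  have "3 * m - 1 = 2 * m - 1 + m" using m3 by simp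
  then show ?thesis by (metis power_add)
qed

lemma A_C_commute:
  assumes "2 ^ (2 * m - 1) dvd i" shows "A [^] (i::int) \<otimes> C [^] (j::int) = C [^] j \<otimes> A [^] i"
proof -
  have "2 ^ (3 * m - 1) dvd \<alpha> * i - i"
    using assms unfolding pow_split \<alpha> by (auto simp: algebra_simps intro: mult_dvd_mono)
  then have "A [^] (\<alpha> * i) = A [^] i" by (rule A_cong)
  then have "A [^] i \<otimes> C = C \<otimes> A [^] i" using A_C[of i] by simp
  from commute_int_pow[OF this, of 1 j] show ?thesis by simp
qed

lemma relation1': "C [^] (\<alpha> - \<beta>) = B [^] vv \<otimes> A [^] uu"
proof -
  interpret sw: macdonald2t G B A "inv C" \<beta> \<alpha> m l t v' u' "- d'" by (rule swapped2t)
  have Bf: "B [^] (- mexp \<beta>) = B [^] vv"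
    using sw.A_e by (simp add: int_pow_neg)
  have "C [^] (\<alpha> - 1) = C [^] (\<alpha> - 1) \<otimes> A [^] e \<otimes> A [^] uu"
    unfolding A_e by (simp add: m_assoc int_pow_mult[symmetric])
  also have "\<dots> = B [^] vv \<otimes> (C [^] (\<beta> - 1) \<otimes> A [^] uu)"
    unfolding relation1[unfolded Bf, symmetric] by (simp add: m_assoc)
  also have "\<dots> = (B [^] vv \<otimes> A [^] uu) \<otimes> C [^] (\<beta> - 1)"
    using A_C_commute[of uu "\<beta> - 1"] by (simp add: m_assoc)
  finally have "C [^] (\<alpha> - 1) \<otimes> C [^] (1 - \<beta>) = B [^] vv \<otimes> A [^] uu"
    by (simp add: m_assoc int_pow_mult[symmetric])
  then show ?thesis by (simp add: int_pow_mult[symmetric])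
qed

lemma C_central_A: "2 ^ (2 * m - 1) dvd i \<Longrightarrow> A \<otimes> C [^] (i::int) = C [^] i \<otimes> A"
proof -
  assume i: "2 ^ (2 * m - 1) dvd i"
  interpret sw: macdonald2 G B A "inv C" \<beta> \<alpha> m l t v' u' "- d'" by (rule swapped2)
  let ?N = "2 ^ (2 * m - 1) :: nat"
  have "2 ^ (2 * m - 1 + m) dvd \<alpha> ^ ?N - 1" by (rule sw.\<beta>_pow_dvd) simp
  then have "A [^] (\<alpha> ^ ?N * 1) = A [^] (1::int)"
    unfolding mult_1_right by (intro A_cong) (simp only: pow_split power_add)
  then have c: "C [^] int ?N \<otimes> A = A \<otimes> C [^] int ?N" using A_Cn[of 1 ?N] by simp
  obtain k where "i = int ?N * k" using i by (auto simp: dvd_def)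
  then show ?thesis using commute_int_pow[OF c, of k 1] by (simp add: int_pow_pow)
qed

lemma C_central_B: "2 ^ (2 * m - 1) dvd i \<Longrightarrow> B \<otimes> C [^] (i::int) = C [^] i \<otimes> B"
proof -
  assume i: "2 ^ (2 * m - 1) dvd i"
  interpret sw: macdonald2t G B A "inv C" \<beta> \<alpha> m l t v' u' "- d'" by (rule swapped2t)
  have "2 ^ (2 * m - 1) dvd - i" using i by simp
  from sw.C_central_A[OF this] show ?thesis by (simp add: int_pow_inv int_pow_neg)
qed

lemma A_gx: "A [^] gx = \<zeta>"
proof -
  obtain g' where g': "odd g'" "gx = 2 ^ (3 * m - 2) * g'" by (rule gx_obtain)
  then obtain k where k: "g' = 2 * k + 1" by (auto elim: oddE)
  have "3 * m - 1 = Suc (3 * m - 2)" using m3 by simp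
  then have "gx - 2 ^ (3 * m - 2) = 2 ^ (3 * m - 1) * k" unfolding g' k by (simp add: algebra_simps)
  then show ?thesis by (intro A_cong) simp
qed

lemma \<zeta>_sq: "\<zeta> \<otimes> \<zeta> = \<one>"
proof -
  have "2 ^ (3 * m - 2) + 2 ^ (3 * m - 2) = (2::int) ^ (3 * m - 1)"
  proof -
    have "3 * m - 1 = Suc (3 * m - 2)" using m3 by simp
    then show ?thesis by simp
  qed
  then show ?thesis using A_ord t_eq by (simp add: int_pow_mult[symmetric])
qed

text \<open>\<open>\<zeta>\<close> is the \<open>2^(m-1)\<close>-th power of \<open>A^e\<close>,
  which acts on \<open>B\<close> by \<open>\<beta>^n\<close>; the resulting exponent is 1 modulo
  \<open>2^(3m-1)\<close>.\<close>

lemma \<zeta>_B: "B \<otimes> \<zeta> = \<zeta> \<otimes> B"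
proof -
  obtain e' where e': "odd e'" "e = 2 ^ (2 * m - 1) * e'" by (rule e_obtain)
  then obtain k where k: "e' = 2 * k + 1" by (auto elim: oddE)
  let ?r = "2 ^ (m - 1) :: nat"
  have p: "3 * m - 2 = 2 * m - 1 + (m - 1)" "3 * m - 1 = Suc (3 * m - 2)" using m3 by simp_all
  have "(2::int) ^ (3 * m - 2) = 2 ^ (2 * m - 1) * 2 ^ (m - 1)" by (subst p(1)) (rule power_add)
  then have "e * int ?r - 2 ^ (3 * m - 2) = 2 ^ (3 * m - 1) * k"
    unfolding e' k p(2) by (simp add: algebra_simps)
  then have \<zeta>: "A [^] (e * int ?r) = \<zeta>" by (intro A_cong) simp
  have "2 ^ (l + (m - 1)) dvd n * ?r" using n_dvd by (simp add: power_add mult_dvd_mono)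
  from \<beta>_pow_dvd[OF this] have "2 ^ (3 * m - 1) dvd \<beta> ^ (n * ?r) - 1"
    by (rule dvd_trans[OF le_imp_power_dvd, rotated]) (use m3 ml in simp)
  then have "B [^] (\<beta> ^ (n * ?r)) = B [^] (1::int)" by (rule B_cong)
  then show ?thesis using B_A_e_pow[of ?r] unfolding \<zeta> by simp
qed

text \<open>This is \<open>relation2\<close> with evaluated exponents: \<open>1 - \<beta>^n\<close>
  equals \<open>- (\<alpha> - \<beta>) * (\<beta> - 1)\<close> modulo
  \<open>2^(3m-1)\<close>.\<close>

lemma relation2': "C [^] uu = \<zeta> \<otimes> B [^] (2 ^ (l + m) * (d' * v'))"
proof -
  let ?K = "2 ^ (l + m) * (d' * v')"
  have "2 ^ (3 * m - 1) dvd \<beta> ^ n - 1 - int n * (2 ^ m * v')"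
    by (rule dvd_trans[OF le_imp_power_dvd \<beta>_pow[OF n_dvd]]) (use m3 ml in simp)
  moreover have "2 ^ (3 * m - 1) dvd (int n - (\<alpha> - \<beta>)) * (2 ^ m * v')" using n_cong t_eq by simp
  ultimately have "2 ^ (3 * m - 1) dvd (\<beta> ^ n - 1 - int n * (2 ^ m * v')) + (int n - (\<alpha> - \<beta>)) * (2 ^ m * v')"
    by (rule dvd_add)
  moreover have "(\<alpha> - \<beta>) * (2 ^ m * v') = ?K" unfolding \<alpha>\<beta> by (simp add: power_add)
  ultimately have "2 ^ (3 * m - 1) dvd - ?K - (1 - \<beta> ^ n)" by (simp add: algebra_simps)
  then have "B [^] (- ?K) = B [^] (1 - \<beta> ^ n)" by (rule B_cong)
  then have "C [^] (- uu) \<otimes> \<zeta> = B [^] (- ?K)" using relation2 unfolding C_e A_gx by simp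
  then have "C [^] uu \<otimes> (C [^] (- uu) \<otimes> \<zeta>) \<otimes> B [^] ?K = C [^] uu \<otimes> B [^] (- ?K) \<otimes> B [^] ?K" by simp
  then show ?thesis by (simp add: m_assoc int_pow_mult_r int_pow_mult[symmetric])
qed

text \<open>The bounds give \<open>l \<ge> m + 2\<close>, so \<open>u'\<close> and \<open>v'\<close>
  agree modulo 4. The parity of \<open>K\<close> in the order estimate rests on this.\<close>

lemma u'_plus_v': "\<exists>k. u' + v' = 2 * (2 * k + 1)"
proof -
  have "2 ^ m * (u' - v') = 2 ^ m * (2 ^ (l - m) * d')"
    using \<alpha>\<beta> ml unfolding \<alpha> \<beta> by (simp add: algebra_simps flip: power_add)
  then have "u' - v' = 2 ^ (l - m) * d'" by simp
  moreover have "l - m = 2 + (l - m - 2)" using l3m m3 by simp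
  then have "(2::int) ^ (l - m) = 4 * 2 ^ (l - m - 2)" by (metis power_add power2_eq_square mult_2 numeral_Bit0 power_one_right)
  moreover obtain j where "v' = 2 * j + 1" using odds by (auto elim: oddE)
  ultimately have "u' + v' = 2 * (2 * (2 ^ (l - m - 2) * d' + j) + 1)" by simp
  then show ?thesis by blast
qed

text \<open>With \<open>x\<close>, \<open>y\<close>, \<open>q\<close> the powers of \<open>B\<close>, \<open>A\<close>, \<open>C\<close> in the statement, the relations give
  \<open>x \<approx> q \<approx> y\<close> on the one hand and \<open>x y \<approx> q\<^bsup>4c\<^esup>\<close> on the other, so that \<open>q\<^sup>2\<close> is trivial.\<close>

lemma order_reduction:
  shows "A [^] ((2::int) ^ (l + m)) = C [^] ((2::int) ^ (2 * m - 1))"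
    and "B [^] ((2::int) ^ (l + m)) = C [^] ((2::int) ^ (2 * m - 1))"
    and "C [^] ((2::int) ^ (2 * m)) = \<one>"
proof -
  interpret sw: macdonald2t G B A "inv C" \<beta> \<alpha> m l t v' u' "- d'" by (rule swapped2t)
  define q x y where "q = C [^] ((2::int) ^ (2 * m - 1))" and "x = B [^] ((2::int) ^ (l + m))"
    and "y = A [^] ((2::int) ^ (l + m))"
  define \<zeta>B where "\<zeta>B = B [^] ((2::int) ^ (3 * m - 2))"
  have c [simp]: "q \<in> carrier G" "x \<in> carrier G" "y \<in> carrier G" "\<zeta>B \<in> carrier G"
    by (simp_all add: q_def x_def y_def \<zeta>B_def)
  have qA: "A \<otimes> q = q \<otimes> A" and qB: "B \<otimes> q = q \<otimes> B"
    unfolding q_def by (simp_all add: C_central_A C_central_B)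
  have q\<zeta>B: "\<zeta>B \<otimes> q [^] i = q [^] i \<otimes> \<zeta>B" for i :: int
    unfolding \<zeta>B_def using commute_int_pow[OF qB] by simp
  have q\<zeta>: "\<zeta> \<otimes> q [^] i = q [^] i \<otimes> \<zeta>" for i :: int
    using commute_int_pow[OF qA] by simp
  have \<zeta>x: "\<zeta> \<otimes> x = x \<otimes> \<zeta>"
    unfolding x_def using commute_int_pow[OF \<zeta>_B, of "2 ^ (l + m)" 1] by simp
  have \<zeta>By: "y \<otimes> \<zeta>B = \<zeta>B \<otimes> y"
    unfolding y_def \<zeta>B_def using commute_int_pow[OF sw.\<zeta>_B, of "2 ^ (l + m)" 1] by simp
  have \<zeta>\<zeta>B: "\<zeta> \<otimes> \<zeta>B = \<zeta>B \<otimes> \<zeta>"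
    unfolding \<zeta>B_def using commute_int_pow[OF \<zeta>_B, of "2 ^ (3 * m - 2)" 1] by simp
  have \<zeta>2: "\<zeta> [^] (2 * k + 1) = \<zeta>" "\<zeta> [^] (2 * k) = \<one>" for k :: int
    using \<zeta>_sq int_pow_mult[of \<zeta> 1 1] by (simp_all add: int_pow_mult flip: int_pow_pow)
  have \<zeta>B2: "\<zeta>B [^] (2 * k + 1) = \<zeta>B" "\<zeta>B [^] (2 * k) = \<one>" for k :: int
    using sw.\<zeta>_sq int_pow_mult[of \<zeta>B 1 1] unfolding \<zeta>B_def by (simp_all add: int_pow_mult flip: int_pow_pow)
  have q_ord: "q [^] ((2::int) ^ t) = \<one>" and x_ord: "x [^] ((2::int) ^ t) = \<one>" and y_ord: "y [^] ((2::int) ^ t) = \<one>"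
  proof -
    have *: "(z [^] j) [^] ((2::int) ^ t) = \<one>" if "z \<in> carrier G" "z [^] ((2::int) ^ t) = \<one>" for z and j :: int
    proof -
      have "(z [^] j) [^] ((2::int) ^ t) = (z [^] ((2::int) ^ t)) [^] j"
        using that(1) by (simp add: int_pow_pow mult.commute)
      then show ?thesis using that(2) by simp
    qed
    show "q [^] ((2::int) ^ t) = \<one>" "x [^] ((2::int) ^ t) = \<one>" "y [^] ((2::int) ^ t) = \<one>"
      unfolding q_def x_def y_def using * A_ord B_ord C_ord by simp_all
  qed
  obtain k1 where k1: "u' = 2 * k1 + 1" using odds by (auto elim: oddE)
  obtain k2 where k2: "v' = 2 * k2 + 1" using odds by (auto elim: oddE)
  have E1: "q [^] (u'\<^sup>2) = \<zeta> \<otimes> x [^] (d' * v')"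
    using relation2' by (simp add: q_def x_def int_pow_pow)
  have E2: "q [^] (v'\<^sup>2) = y [^] (d' * u') \<otimes> \<zeta>B"
  proof -
    have "inv (C [^] vv) = \<zeta>B \<otimes> inv (y [^] (d' * u'))"
      using sw.relation2' by (simp add: \<zeta>B_def y_def int_pow_pow int_pow_inv int_pow_neg)
    then have "C [^] vv = inv (\<zeta>B \<otimes> inv (y [^] (d' * u')))" by (metis C int_pow_closed inv_inv)
    also have "\<dots> = y [^] (d' * u') \<otimes> inv \<zeta>B" by (simp add: inv_mult_group)
    also have "inv \<zeta>B = \<zeta>B" using sw.\<zeta>_sq unfolding \<zeta>B_def by (simp add: inv_equality)
    finally show ?thesis by (simp add: q_def int_pow_pow)
  qed
  define c0 where "c0 = 2 ^ (2 * l - 3 * m) * d'"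
  have E3: "q [^] (4 * c0) = x [^] (v'\<^sup>2) \<otimes> y [^] (u'\<^sup>2)"
  proof -
    \<comment> \<open>This power turns \<open>uu\<close> and \<open>vv\<close> into multiples of
      \<open>2 ^ (l + m)\<close>. The factor 4 in the new exponent of \<open>C\<close>, with
      \<open>c0\<close> an integer, comes from \<open>3 * m < 2 * l + 1\<close>.\<close>
    let ?r = "2 ^ (l - m + 1) :: int"
    have "inv C [^] (- (\<alpha> - \<beta>)) = C [^] (\<alpha> - \<beta>)"
      by (simp only: int_pow_inv int_pow_neg C inv_inv int_pow_closed)
    then have "B [^] vv \<otimes> C [^] (\<alpha> - \<beta>) = C [^] (\<alpha> - \<beta>) \<otimes> B [^] vv"
      using sw.A_C_commute[of vv "- (\<alpha> - \<beta>)"] by simp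
    then have "B [^] vv \<otimes> A [^] uu = A [^] uu \<otimes> B [^] vv"
      unfolding relation1' by (simp add: m_assoc)
    from int_pow_mult_distrib[OF this, of ?r]
    have "(C [^] (\<alpha> - \<beta>)) [^] ?r = B [^] (vv * ?r) \<otimes> A [^] (uu * ?r)"
      by (simp add: relation1' int_pow_pow)
    moreover have "vv * ?r = 2 ^ (l + m) * v'\<^sup>2" "uu * ?r = 2 ^ (l + m) * u'\<^sup>2"
    proof -
      have "l + m = (2 * m - 1) + (l - m + 1)" using ml m3 by simp
      then have "(2::int) ^ (l + m) = 2 ^ (2 * m - 1) * ?r" by (metis power_add)
      then show "vv * ?r = 2 ^ (l + m) * v'\<^sup>2" "uu * ?r = 2 ^ (l + m) * u'\<^sup>2" by simp_all
    qed
    moreover have "(\<alpha> - \<beta>) * ?r = 2 ^ (2 * m - 1) * (4 * c0)"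
    proof -
      have "l + (l - m + 1) = (2 * m - 1) + 2 + (2 * l - 3 * m)" using ml m3 l3m by simp
      then have "(2::int) ^ l * ?r = 2 ^ (2 * m - 1) * 2 ^ 2 * 2 ^ (2 * l - 3 * m)" by (metis power_add)
      then show ?thesis unfolding \<alpha>\<beta> c0_def by simp
    qed
    ultimately have "C [^] (2 ^ (2 * m - 1) * (4 * c0)) = B [^] (2 ^ (l + m) * v'\<^sup>2) \<otimes> A [^] (2 ^ (l + m) * u'\<^sup>2)"
      by (simp only: int_pow_pow C)
    then show ?thesis by (simp add: q_def x_def y_def int_pow_pow)
  qed
  obtain k0 where k0: "u' + v' = 2 * (2 * k0 + 1)" using u'_plus_v' by blast
  \<comment> \<open>\<open>u'^2 v' + v'^2 u' = u' v' (u' + v')\<close> is twice an odd number; after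
    subtraction of \<open>4 * c0 * d'\<close> it is still \<open>2 * K\<close> with \<open>K\<close>
    odd.\<close>
  define K where "K = u' * v' * (2 * k0 + 1) - 2 * (c0 * d')"
  have oK: "odd K" unfolding K_def k1 k2 by simp
  have F1: "q [^] (u'\<^sup>2 * v') = \<zeta> \<otimes> x [^] (d' * v' * v')"
  proof -
    have "\<zeta> \<otimes> x [^] (d' * v') = x [^] (d' * v') \<otimes> \<zeta>" using commute_int_pow[OF \<zeta>x, of 1] by simp
    then have "q [^] (u'\<^sup>2 * v') = \<zeta> [^] v' \<otimes> (x [^] (d' * v')) [^] v'"
      using int_pow_mult_distrib[of \<zeta> "x [^] (d' * v')" v'] E1 by (simp flip: int_pow_pow)
    moreover have "\<zeta> [^] v' = \<zeta>" unfolding k2 by (rule \<zeta>2)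
    ultimately show ?thesis by (simp add: int_pow_pow)
  qed
  have F2: "q [^] (v'\<^sup>2 * u') = y [^] (d' * u' * u') \<otimes> \<zeta>B"
  proof -
    have "y [^] (d' * u') \<otimes> \<zeta>B = \<zeta>B \<otimes> y [^] (d' * u')" using commute_int_pow[OF \<zeta>By, of _ 1] by simp
    then have "q [^] (v'\<^sup>2 * u') = (y [^] (d' * u')) [^] u' \<otimes> \<zeta>B [^] u'"
      using int_pow_mult_distrib[of "y [^] (d' * u')" \<zeta>B u'] E2 by (simp flip: int_pow_pow)
    moreover have "\<zeta>B [^] u' = \<zeta>B" unfolding k1 by (rule \<zeta>B2)
    ultimately show ?thesis by (simp add: int_pow_pow)
  qed
  have xy: "x [^] (i::int) \<otimes> y [^] (j::int) = y [^] j \<otimes> x [^] i" for i j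
  proof -
    have "A \<otimes> x [^] (d' * v') = x [^] (d' * v') \<otimes> A"
    proof -
      have "x [^] (d' * v') = \<zeta> \<otimes> q [^] (u'\<^sup>2)"
        unfolding E1 using \<zeta>_sq by (simp flip: m_assoc)
      moreover have "A \<otimes> q [^] (u'\<^sup>2) = q [^] (u'\<^sup>2) \<otimes> A" using commute_int_pow[OF qA, of 1] by simp
      moreover have "A \<otimes> \<zeta> = \<zeta> \<otimes> A" using commute_int_pow[of A A 1 "2 ^ (3 * m - 2)"] by simp
      ultimately show ?thesis by (metis A c(1) int_pow_closed m_assoc)
    qed
    moreover obtain s where "odd s" "(x [^] (d' * v')) [^] (s::int) = x"
      using odds by (auto intro: pow_inverse_odd[OF c(2) x_ord, of "d' * v'"])
    ultimately have "A \<otimes> x = x \<otimes> A"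
      using commute_int_pow[of A "x [^] (d' * v')" 1 s] by simp
    then show ?thesis unfolding y_def
      using commute_int_pow[of A x "2 ^ (l + m) * j" i] by (simp add: int_pow_pow)
  qed
  have F3: "q [^] (4 * c0 * d') = x [^] (d' * v' * v') \<otimes> y [^] (d' * u' * u')"
  proof -
    have "q [^] (4 * c0 * d') = (x [^] (v'\<^sup>2)) [^] d' \<otimes> (y [^] (u'\<^sup>2)) [^] d'"
      using int_pow_mult_distrib[of "x [^] (v'\<^sup>2)" "y [^] (u'\<^sup>2)" d'] xy E3 by (simp flip: int_pow_pow)
    then show ?thesis by (simp add: int_pow_pow power2_eq_square mult_ac)
  qed
  have qK: "q [^] (2 * K) = \<zeta> \<otimes> \<zeta>B"
  proof -
    have "u'\<^sup>2 * v' + v'\<^sup>2 * u' = u' * v' * (u' + v')" by (simp add: power2_eq_square algebra_simps)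
    also have "\<dots> = 2 * K + 4 * c0 * d'" unfolding k0 K_def by (simp add: algebra_simps)
    finally have "q [^] (2 * K) \<otimes> q [^] (4 * c0 * d') = q [^] (u'\<^sup>2 * v') \<otimes> q [^] (v'\<^sup>2 * u')"
      by (simp flip: int_pow_mult)
    also have "\<dots> = \<zeta> \<otimes> (q [^] (4 * c0 * d') \<otimes> \<zeta>B)" unfolding F1 F2 F3 by (simp add: m_assoc)
    also have "\<dots> = \<zeta> \<otimes> \<zeta>B \<otimes> q [^] (4 * c0 * d')" using q\<zeta>B by (simp add: m_assoc)
    finally show ?thesis by simp
  qed
  have root: "z [^] (i::int) = \<one>" if z: "z \<in> carrier G" "z [^] ((2::int) ^ t) = \<one>" "z [^] (i * r) = \<one>" "odd r"
    for z i and r :: int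
  proof -
    obtain s where s: "odd s" "(z [^] r) [^] (s::int) = z" by (rule pow_inverse_odd[OF z(1,2,4)])
    have "z [^] i = ((z [^] r) [^] s) [^] i" using s by simp
    also have "\<dots> = (z [^] (i * r)) [^] s" using z(1) by (simp add: int_pow_pow mult_ac)
    finally show ?thesis using z(3) by simp
  qed
  have "q [^] (4 * K) = q [^] (2 * K) \<otimes> q [^] (2 * K)" by (simp flip: int_pow_mult)
  also have "\<dots> = (\<zeta> \<otimes> \<zeta>) \<otimes> (\<zeta>B \<otimes> \<zeta>B)" unfolding qK by (metis A \<zeta>\<zeta>B c(4) int_pow_closed m_assoc m_closed)
  also have "\<dots> = \<one>" using \<zeta>_sq sw.\<zeta>_sq by (simp add: \<zeta>B_def)
  finally have q4: "q [^] (4::int) = \<one>" by (rule root[OF c(1) q_ord _ oK])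
  have q_cong: "q [^] i = q [^] j" if "4 dvd i - j" for i j :: int by (rule int_pow_cong_mod[OF c(1) q4 that])
  have sq_odd: "4 dvd 2 * r\<^sup>2 - 2" if "odd r" for r :: int
  proof -
    obtain k where "r = 2 * k + 1" using \<open>odd r\<close> by (auto elim: oddE)
    then have "2 * r\<^sup>2 - 2 = 4 * (2 * k\<^sup>2 + 2 * k)" by (simp add: power2_eq_square algebra_simps)
    then show ?thesis by simp
  qed
  have x2: "x [^] (2::int) = q [^] (2::int)" and y2: "y [^] (2::int) = q [^] (2::int)"
  proof -
    have "\<zeta> \<otimes> x [^] (d' * v') = x [^] (d' * v') \<otimes> \<zeta>" using commute_int_pow[OF \<zeta>x, of 1] by simp
    from int_pow_mult_distrib[OF this, of 2]
    have "q [^] (u'\<^sup>2 * 2) = x [^] (d' * v' * 2)" using \<zeta>2(2)[of 1] E1 by (simp add: int_pow_pow flip: int_pow_pow)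
    then have 1: "x [^] (2 * (d' * v')) = q [^] (2::int)"
      using q_cong[OF sq_odd[OF odds(1)]] by (simp add: mult_ac)
    have "y [^] (d' * u') \<otimes> \<zeta>B = \<zeta>B \<otimes> y [^] (d' * u')" using commute_int_pow[OF \<zeta>By, of _ 1] by simp
    from int_pow_mult_distrib[OF this, of 2]
    have "q [^] (v'\<^sup>2 * 2) = y [^] (d' * u' * 2)" using \<zeta>B2(2)[of 1] E2 by (simp add: int_pow_pow flip: int_pow_pow)
    then have 2: "y [^] (2 * (d' * u')) = q [^] (2::int)"
      using q_cong[OF sq_odd[OF odds(2)]] by (simp add: mult_ac)
    have *: "z [^] (2::int) = q [^] (2::int)" if z: "z \<in> carrier G" "z [^] ((2::int) ^ t) = \<one>" "z [^] (2 * r) = q [^] (2::int)" "odd r" for z and r :: int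
    proof -
      have "z [^] (4 * r) = (z [^] (2 * r)) [^] (2::int)" using z(1) by (simp add: int_pow_pow mult.commute)
      also have "\<dots> = \<one>" unfolding z(3) using q4 by (simp add: int_pow_pow)
      finally have z4: "z [^] (4::int) = \<one>" by (rule root[OF z(1,2) _ z(4)])
      obtain k where "r = 2 * k + 1" using \<open>odd r\<close> by (auto elim: oddE)
      then have "4 dvd 2 * r - 2" by simp
      then show ?thesis using int_pow_cong_mod[OF z(1) z4] z(3) by metis
    qed
    show "x [^] (2::int) = q [^] (2::int)" by (rule *[OF c(2) x_ord 1]) (use odds in simp)
    show "y [^] (2::int) = q [^] (2::int)" by (rule *[OF c(3) y_ord 2]) (use odds in simp)
  qed
  \<comment> \<open>Since \<open>l + 3 \<le> 2 * m\<close>, both involutions are the same power of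
    \<open>y^2 = x^2 = q^2\<close>. Hence they coincide, \<open>q^(2 K)\<close> is trivial, and then
    so are \<open>q^2\<close> and both involutions.\<close>
  have \<zeta>q: "\<zeta> = (q [^] (2::int)) [^] ((2::int) ^ (2 * m - 3 - l))" "\<zeta>B = (q [^] (2::int)) [^] ((2::int) ^ (2 * m - 3 - l))"
  proof -
    have "3 * m - 2 = l + m + (1 + (2 * m - 3 - l))" using l2m m3 by simp
    then have p: "(2::int) ^ (3 * m - 2) = 2 ^ (l + m) * (2 * 2 ^ (2 * m - 3 - l))"
      by (metis power_add power_one_right)
    show "\<zeta> = (q [^] (2::int)) [^] ((2::int) ^ (2 * m - 3 - l))"
      unfolding p y2[symmetric] y_def by (simp add: int_pow_pow mult.assoc)
    show "\<zeta>B = (q [^] (2::int)) [^] ((2::int) ^ (2 * m - 3 - l))"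
      unfolding \<zeta>B_def p x2[symmetric] x_def by (simp add: int_pow_pow mult.assoc)
  qed
  have "\<zeta>B = \<zeta>" using \<zeta>q(2) unfolding \<zeta>q(1)[symmetric] .
  then have "q [^] (2 * K) = \<one>" using qK \<zeta>_sq by (simp only:)
  then have q2: "q [^] (2::int) = \<one>" by (rule root[OF c(1) q_ord _ oK])
  have one: "\<zeta> = \<one>" "\<zeta>B = \<one>" using \<zeta>q unfolding q2 int_pow_one .
  have odd_pow: "z [^] (r::int) = z" if "z \<in> carrier G" "z [^] (2::int) = \<one>" "odd r" for z r
    using int_pow_cong_mod[OF that(1,2), of r 1] that by auto
  have "x [^] (2::int) = \<one>" "y [^] (2::int) = \<one>" using x2 y2 q2 by simp_all
  then have "x [^] (d' * v') = x" "y [^] (d' * u') = y" "q [^] (u'\<^sup>2) = q" "q [^] (v'\<^sup>2) = q"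
    using odds by (simp_all add: odd_pow q2)
  then have "q = x" "q = y" using E1 E2 unfolding one by simp_all
  then show "A [^] ((2::int) ^ (l + m)) = C [^] ((2::int) ^ (2 * m - 1))"
    "B [^] ((2::int) ^ (l + m)) = C [^] ((2::int) ^ (2 * m - 1))"
    by (simp_all add: q_def x_def y_def)
  have "2 ^ (2 * m) = (2::int) ^ (2 * m - 1) * 2" using m3 by (simp flip: power_Suc2)
  then show "C [^] ((2::int) ^ (2 * m)) = \<one>" using q2 by (simp add: q_def int_pow_pow)
qed

end

section \<open>Order and nilpotency class\<close>

context group
begin

text \<open>For normal \<open>N\<close> this is the preimage of the centre of the quotient by
  \<open>N\<close>.\<close>

definition rel_center :: "'a set \<Rightarrow> 'a set" where
  "rel_center N = {x \<in> carrier G. \<forall>y\<in>carrier G. comm G x y \<in> N}"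

fun upper_central :: "nat \<Rightarrow> 'a set" where
  "upper_central 0 = {\<one>}"
| "upper_central (Suc i) = rel_center (upper_central i)"

lemma comm_closed [simp]: "x \<in> carrier G \<Longrightarrow> y \<in> carrier G \<Longrightarrow> comm G x y \<in> carrier G"
  by (simp add: comm_def)

lemma comm_eq_iff:
  "x \<in> carrier G \<Longrightarrow> y \<in> carrier G \<Longrightarrow> z \<in> carrier G \<Longrightarrow> comm G x y = z \<longleftrightarrow> x \<otimes> y = y \<otimes> (x \<otimes> z)"
proof -
  assume c: "x \<in> carrier G" "y \<in> carrier G" "z \<in> carrier G"
  have "y \<otimes> (x \<otimes> comm G x y) = x \<otimes> y" using c by (simp add: comm_def m_assoc inv_cancel_left)
  then show ?thesis using c by (metis comm_closed l_cancel m_closed)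
qed

lemma rel_center_normal:
  assumes "N \<lhd> G" shows "rel_center N \<lhd> G"
proof -
  interpret N: normal N G by fact
  have conj: "inv g \<otimes> x \<otimes> g \<in> N" "g \<otimes> x \<otimes> inv g \<in> N" if "x \<in> N" "g \<in> carrier G" for x g
    using that N.inv_op_closed1 N.inv_op_closed2 by auto
  show ?thesis
  proof (rule normal_invI[OF subgroupI])
    show "rel_center N \<subseteq> carrier G" by (auto simp: rel_center_def)
    have "\<one> \<in> rel_center N" by (auto simp: rel_center_def comm_def)
    then show "rel_center N \<noteq> {}" by blast
    fix x assume "x \<in> rel_center N"
    then have x: "x \<in> carrier G" "\<And>y. y \<in> carrier G \<Longrightarrow> comm G x y \<in> N" by (auto simp: rel_center_def)
    have "comm G (inv x) y \<in> N" if y: "y \<in> carrier G" for y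
    proof -
      have "comm G (inv x) y = x \<otimes> inv (comm G x y) \<otimes> inv x"
        using x(1) y by (simp add: comm_def inv_mult_group m_assoc)
      then show ?thesis using conj(2)[of "inv (comm G x y)" x] x y by simp
    qed
    then show "inv x \<in> rel_center N" using x(1) by (simp add: rel_center_def)
    fix z assume "z \<in> rel_center N"
    then have z: "z \<in> carrier G" "\<And>y. y \<in> carrier G \<Longrightarrow> comm G z y \<in> N" by (auto simp: rel_center_def)
    have "comm G (x \<otimes> z) y \<in> N" if y: "y \<in> carrier G" for y
    proof -
      have "comm G (x \<otimes> z) y = (inv z \<otimes> comm G x y \<otimes> z) \<otimes> comm G z y"
        using x(1) z(1) y by (simp add: comm_def inv_mult_group m_assoc inv_cancel_left)
      then show ?thesis using conj(1)[of "comm G x y" z] x z y by simp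
    qed
    then show "x \<otimes> z \<in> rel_center N" using x(1) z(1) by (simp add: rel_center_def)
  next
    fix g x assume g: "g \<in> carrier G" and "x \<in> rel_center N"
    then have x: "x \<in> carrier G" "\<And>y. y \<in> carrier G \<Longrightarrow> comm G x y \<in> N" by (auto simp: rel_center_def)
    have "comm G (g \<otimes> x \<otimes> inv g) y \<in> N" if y: "y \<in> carrier G" for y
    proof -
      have "comm G (g \<otimes> x \<otimes> inv g) y = g \<otimes> comm G x (inv g \<otimes> y \<otimes> g) \<otimes> inv g"
        using x(1) g y by (simp add: comm_def inv_mult_group m_assoc inv_cancel_left)
      then show ?thesis using conj(2)[of "comm G x (inv g \<otimes> y \<otimes> g)" g] x g y by simp
    qed
    then show "g \<otimes> x \<otimes> inv g \<in> rel_center N" using x(1) g by (simp add: rel_center_def)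
  qed
qed

lemma upper_central_normal: "upper_central i \<lhd> G"
proof (induction i)
  case 0
  show ?case unfolding upper_central.simps by (rule normal_invI[OF triv_subgroup]) simp
qed (simp add: rel_center_normal)

lemma upper_central_numerals: "upper_central 1 = rel_center (upper_central 0)" "upper_central 2 = rel_center (upper_central 1)" "upper_central 3 = rel_center (upper_central 2)"
  "upper_central 4 = rel_center (upper_central 3)"
  by (simp_all add: numeral_eq_Suc)

text \<open>For fixed \<open>x\<close> and normal \<open>N\<close>, the elements \<open>y\<close>
  with \<open>comm G x y \<in> N\<close> form a subgroup.\<close>

lemma rel_center_generators:
  assumes N: "N \<lhd> G" and gen: "carrier G = generate G T" "T \<subseteq> carrier G"
    and x: "x \<in> carrier G" "\<And>y. y \<in> T \<Longrightarrow> comm G x y \<in> N"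
  shows "x \<in> rel_center N"
proof -
  interpret N: normal N G by fact
  define S where "S = {y \<in> carrier G. comm G x y \<in> N}"
  have conj: "inv g \<otimes> x \<otimes> g \<in> N" "g \<otimes> x \<otimes> inv g \<in> N" if "x \<in> N" "g \<in> carrier G" for x g
    using that N.inv_op_closed1 N.inv_op_closed2 by auto
  have "subgroup S G"
  proof (rule subgroupI)
    show "S \<subseteq> carrier G" by (auto simp: S_def)
    have "\<one> \<in> S" using x(1) by (auto simp: S_def comm_def)
    then show "S \<noteq> {}" by blast
    fix y assume y: "y \<in> S"
    have "comm G x (inv y) = y \<otimes> inv (comm G x y) \<otimes> inv y"
      using x(1) y by (simp add: S_def comm_def inv_mult_group m_assoc inv_cancel_left)
    then show "inv y \<in> S" using conj(2)[of "inv (comm G x y)" y] y by (simp add: S_def)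
    fix z assume z: "z \<in> S"
    have "comm G x (y \<otimes> z) = comm G x z \<otimes> (inv z \<otimes> comm G x y \<otimes> z)"
      using x(1) y z by (simp add: S_def comm_def inv_mult_group m_assoc inv_cancel_left)
    then show "y \<otimes> z \<in> S" using conj(1)[of "comm G x y" z] y z by (simp add: S_def)
  qed
  moreover have "T \<subseteq> S" using x gen(2) by (auto simp: S_def)
  ultimately have "carrier G \<subseteq> S" unfolding gen(1) by (rule generate_subgroup_incl[rotated])
  then show ?thesis using x(1) by (auto simp: S_def rel_center_def)
qed

lemma lower_central_subset_upper_central:
  assumes "carrier G \<subseteq> upper_central c" "k \<le> c" shows "lower_central G k \<subseteq> upper_central (c - k)"
  using assms(2)
proof (induction k)
  case (Suc k)
  then have IH: "lower_central G k \<subseteq> upper_central (Suc (c - Suc k))" by (simp add: Suc_diff_Suc)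
  interpret N: normal "upper_central (c - Suc k)" G by (rule upper_central_normal)
  have "{comm G x y | x y. x \<in> lower_central G k \<and> y \<in> carrier G} \<subseteq> upper_central (c - Suc k)"
    using IH by (auto simp: rel_center_def)
  then show ?case using generate_subgroup_incl[OF _ N.subgroup_axioms] by simp
qed (use assms in simp)

lemma one_mem_lower_central: "\<one> \<in> lower_central G k"
  by (cases k) (auto intro: generate.one)

lemma lower_central_trivial_Suc:
  assumes "lower_central G k = {\<one>}" shows "lower_central G (Suc k) = {\<one>}"
proof -
  have "{comm G x y | x y. x \<in> lower_central G k \<and> y \<in> carrier G} \<subseteq> {\<one>}"
    unfolding assms by (auto simp: comm_def)
  then have "lower_central G (Suc k) \<subseteq> {\<one>}"
    using generate_subgroup_incl[OF _ triv_subgroup] by simp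
  then show ?thesis using one_mem_lower_central by blast
qed

text \<open>The upper central series bounds the class from above. One nontrivial element at stage
  \<open>c\<close> excludes all smaller classes, because a trivial term of the lower central series
  stays trivial.\<close>

lemma has_nilpotency_class_Suc:
  assumes "carrier G \<subseteq> upper_central (Suc c)" "\<exists>x\<in>lower_central G c. x \<noteq> \<one>"
  shows "has_nilpotency_class G (Suc c)"
proof -
  have "lower_central G (Suc c) \<subseteq> {\<one>}"
    using lower_central_subset_upper_central[OF assms(1), of "Suc c"] by simp
  moreover have "lower_central G k \<noteq> {\<one>}" if "k < Suc c" for k
  proof
    assume k: "lower_central G k = {\<one>}"
    have "lower_central G (k + j) = {\<one>}" for j
      by (induction j) (simp_all add: k lower_central_trivial_Suc del: lower_central.simps)
    from this[of "c - k"] show False using assms(2) that by auto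
  qed
  ultimately show ?thesis
    using one_mem_lower_central unfolding has_nilpotency_class_def by blast
qed

end

section \<open>Upper bounds for order and class, and a nontrivial iterated commutator\<close>

context macdonald2t
begin

lemma A_top: "A [^] ((2::int) ^ (l + m + 1)) = \<one>" 
proof -
  have "A [^] ((2::int) ^ (l + m + 1)) = (A [^] ((2::int) ^ (l + m))) [^] (2::int)"
    by (simp add: int_pow_pow mult.commute)
  also have "\<dots> = C [^] ((2::int) ^ (2 * m - 1) * 2)" by (simp add: order_reduction(1) int_pow_pow)
  also have "(2::int) ^ (2 * m - 1) * 2 = 2 ^ (2 * m)" using m3 by (simp flip: power_Suc2)
  finally show ?thesis by (simp add: order_reduction(3))
qed

lemma B_top: "B [^] ((2::int) ^ (l + m + 1)) = \<one>"
proof -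
  interpret sw: macdonald2t G B A "inv C" \<beta> \<alpha> m l t v' u' "- d'" by (rule swapped2t)
  show ?thesis by (rule sw.A_top)
qed

text \<open>\<open>bca\<close> for the inverse gives the order of the factors. The exponent of
  \<open>A\<close> is reduced by \<open>relation1'\<close>, where \<open>u'^2\<close> is invertible;
  then that of \<open>B\<close> by \<open>B^(2^(l+m)) = C^(2^(2m-1))\<close>; that of
  \<open>C\<close> comes last, since the earlier reductions change it.\<close>

lemma normal_form:
  assumes bca: "\<And>g. g \<in> carrier G \<Longrightarrow> \<exists>(i::int) (j::int) (k::int). g = B [^] i \<otimes> (C [^] j \<otimes> A [^] k)"
    and g: "g \<in> carrier G"
  shows "\<exists>i\<in>{0..<2 ^ (2 * m - 1)}. \<exists>k\<in>{0..<2 ^ (2 * m)}. \<exists>j\<in>{0..<2 ^ (l + m)}.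
      g = A [^] (i::int) \<otimes> (C [^] (k::int) \<otimes> B [^] (j::int))"
proof -
  interpret sw: macdonald2t G B A "inv C" \<beta> \<alpha> m l t v' u' "- d'" by (rule swapped2t)
  have BC: "B [^] i \<otimes> C [^] k = C [^] k \<otimes> B [^] i" if "2 ^ (2 * m - 1) dvd i" for i k :: int
  proof -
    have "inv C [^] (- k) = C [^] k" by (simp only: int_pow_inv int_pow_neg C inv_inv int_pow_closed)
    then show ?thesis using sw.A_C_commute[OF that, of "- k"] by simp
  qed
  obtain i k j :: int where "inv g = B [^] (- j) \<otimes> (C [^] (- k) \<otimes> A [^] (- i))"
    using bca[of "inv g"] g by (metis inv_closed minus_minus)
  then have "g = inv (B [^] (- j) \<otimes> (C [^] (- k) \<otimes> A [^] (- i)))" using g by (metis inv_inv)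
  then have gi: "g = A [^] i \<otimes> (C [^] k \<otimes> B [^] j)"
    by (simp add: inv_mult_group m_assoc int_pow_neg)
  define i0 where "i0 = i mod 2 ^ (2 * m - 1)"
  define c where "c = i div 2 ^ (2 * m - 1)"
  have i: "i = 2 ^ (2 * m - 1) * c + i0" unfolding c_def i0_def by simp
  have "coprime (u'\<^sup>2) (2 ^ t)" using odds by simp
  then obtain s0 where "[u'\<^sup>2 * s0 = 1] (mod 2 ^ t)" using cong_solve_coprime_int by blast
  then have "2 ^ t dvd c * (u'\<^sup>2 * s0 - 1)" by (simp add: cong_iff_dvd_diff)
  moreover define s where "s = s0 * c"
  ultimately have "2 ^ t dvd u'\<^sup>2 * s - c" by (simp add: algebra_simps)
  then have "2 ^ t dvd 2 ^ (2 * m - 1) * (u'\<^sup>2 * s - c)" by simp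
  then have "2 ^ (3 * m - 1) dvd (i0 + uu * s) - i" unfolding i t_eq by (simp add: algebra_simps)
  then have "A [^] i = A [^] (i0 + uu * s)" using A_cong by metis
  then have Ai: "A [^] i = A [^] i0 \<otimes> (A [^] uu) [^] s" by (simp add: int_pow_mult int_pow_pow)
  have "A [^] uu = C [^] (\<alpha> - \<beta>) \<otimes> B [^] (- vv)"
  proof -
    have "A [^] uu = B [^] (- vv) \<otimes> C [^] (\<alpha> - \<beta>)" unfolding relation1' by (simp add: int_pow_mult_r)
    then show ?thesis using BC[of "- vv"] by simp
  qed
  moreover have "C [^] (\<alpha> - \<beta>) \<otimes> B [^] (- vv) = B [^] (- vv) \<otimes> C [^] (\<alpha> - \<beta>)" by (rule BC[symmetric]) simp
  ultimately have Au: "(A [^] uu) [^] s = C [^] ((\<alpha> - \<beta>) * s) \<otimes> B [^] (- vv * s)"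
    using int_pow_mult_distrib[of "C [^] (\<alpha> - \<beta>)" "B [^] (- vv)" s] by (simp add: int_pow_pow)
  define J where "J = j - vv * s"
  define K where "K = (\<alpha> - \<beta>) * s + k"
  have "g = A [^] i0 \<otimes> (C [^] ((\<alpha> - \<beta>) * s) \<otimes> ((B [^] (- vv * s) \<otimes> C [^] k) \<otimes> B [^] j))"
    unfolding gi Ai Au by (simp add: m_assoc)
  also have "B [^] (- vv * s) \<otimes> C [^] k = C [^] k \<otimes> B [^] (- vv * s)" by (rule BC) simp
  finally have g2: "g = A [^] i0 \<otimes> (C [^] K \<otimes> B [^] J)"
    by (simp add: m_assoc int_pow_mult_r J_def K_def flip: int_pow_mult)
  define j0 where "j0 = J mod 2 ^ (l + m)"
  define c' where "c' = J div 2 ^ (l + m)"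
  have "J = 2 ^ (l + m) * c' + j0" unfolding c'_def j0_def by simp
  then have "B [^] J = (B [^] ((2::int) ^ (l + m))) [^] c' \<otimes> B [^] j0" by (simp add: int_pow_mult int_pow_pow)
  also have "\<dots> = C [^] (2 ^ (2 * m - 1) * c') \<otimes> B [^] j0" by (simp add: order_reduction(2) int_pow_pow)
  finally have g3: "g = A [^] i0 \<otimes> (C [^] (K + 2 ^ (2 * m - 1) * c') \<otimes> B [^] j0)"
    unfolding g2 by (simp add: int_pow_mult_r)
  have "C [^] (K + 2 ^ (2 * m - 1) * c') = C [^] ((K + 2 ^ (2 * m - 1) * c') mod 2 ^ (2 * m))"
    by (rule int_pow_cong_mod[OF C order_reduction(3)]) (simp add: minus_mod_eq_mult_div)
  then have "g = A [^] i0 \<otimes> (C [^] ((K + 2 ^ (2 * m - 1) * c') mod 2 ^ (2 * m)) \<otimes> B [^] j0)"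
    using g3 by simp
  moreover have "i0 \<in> {0..<2 ^ (2 * m - 1)}" "j0 \<in> {0..<2 ^ (l + m)}"
    "(K + 2 ^ (2 * m - 1) * c') mod 2 ^ (2 * m) \<in> {0..<2 ^ (2 * m)}"
    unfolding i0_def j0_def by simp_all
  ultimately show ?thesis by blast
qed

lemma card_bound:
  assumes bca: "\<And>g. g \<in> carrier G \<Longrightarrow> \<exists>(i::int) (j::int) (k::int). g = B [^] i \<otimes> (C [^] j \<otimes> A [^] k)"
  shows "card (carrier G) \<le> 2 ^ (5 * m + l - 1)"
proof -
  let ?S = "{0..<2 ^ (2 * m - 1)} \<times> {0..<2 ^ (2 * m)} \<times> {0..<2 ^ (l + m)} :: (int \<times> int \<times> int) set"
  let ?f = "\<lambda>(i, k, j). A [^] i \<otimes> (C [^] k \<otimes> B [^] j)"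
  have "carrier G \<subseteq> ?f ` ?S"
  proof
    fix g assume "g \<in> carrier G"
    from normal_form[OF bca this] show "g \<in> ?f ` ?S" by force
  qed
  then have "card (carrier G) \<le> card ?S" by (rule surj_card_le[rotated]) simp
  also have "\<dots> = 2 ^ (2 * m - 1) * (2 ^ (2 * m) * 2 ^ (l + m))"
    by (simp add: card_cartesian_product nat_power_eq)
  also have "\<dots> = 2 ^ (5 * m + l - 1)"
  proof -
    have "5 * m + l - 1 = (2 * m - 1) + (2 * m + (l + m))" using m3 by simp
    then show ?thesis by (metis power_add)
  qed
  finally show ?thesis .
qed

text \<open>\<open>A^(2e)\<close> acts on \<open>B\<close> by \<open>\<beta>^(2n)\<close>, which is
  1 modulo \<open>2^(l+m+1)\<close>, and \<open>2e\<close> is an odd multiple of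
  \<open>2^(2m)\<close>.\<close>

lemma A_central:
  assumes "2 ^ (2 * m) dvd i" shows "A [^] (i::int) \<otimes> B = B \<otimes> A [^] i"
proof -
  obtain e' where e': "odd e'" "e = 2 ^ (2 * m - 1) * e'" by (rule e_obtain)
  have p: "(2::int) ^ (2 * m) = 2 ^ (2 * m - 1) * 2" using m3 by (simp flip: power_Suc2)
  have "2 ^ Suc l dvd n * 2" using n_dvd by (simp add: mult_dvd_mono mult.commute)
  from \<beta>_pow_dvd[OF this] have "2 ^ (l + m + 1) dvd \<beta> ^ (n * 2) - 1" by simp
  then have "B [^] (\<beta> ^ (n * 2)) = B [^] (1::int)" by (rule int_pow_cong_mod[OF B B_top])
  then have "B \<otimes> A [^] (e * 2) = A [^] (e * 2) \<otimes> B" using B_A_e_pow[of 2] by simp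
  then have c: "B \<otimes> (A [^] ((2::int) ^ (2 * m))) [^] e' = (A [^] ((2::int) ^ (2 * m))) [^] e' \<otimes> B"
    unfolding e' p by (simp add: int_pow_pow mult_ac)
  have "(A [^] ((2::int) ^ (2 * m))) [^] ((2::int) ^ t) = (A [^] ((2::int) ^ t)) [^] ((2::int) ^ (2 * m))"
    by (simp add: int_pow_pow mult.commute)
  then have "(A [^] ((2::int) ^ (2 * m))) [^] ((2::int) ^ t) = \<one>" by (simp add: A_ord)
  then obtain s where s: "odd s" "((A [^] ((2::int) ^ (2 * m))) [^] e') [^] (s::int) = A [^] ((2::int) ^ (2 * m))"
    by (rule pow_inverse_odd[OF int_pow_closed[OF A] _ e'(1)])
  obtain k where k: "i = 2 ^ (2 * m) * k" using assms by (auto simp: dvd_def)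
  have "A [^] i = ((A [^] ((2::int) ^ (2 * m))) [^] e') [^] (s * k)"
    using s(2) unfolding k by (metis A int_pow_closed int_pow_pow)
  then show ?thesis using commute_int_pow[OF c, of 1 "s * k"] by simp
qed

lemma B_central:
  assumes "2 ^ (2 * m) dvd i" shows "B [^] (i::int) \<otimes> A = A \<otimes> B [^] i"
proof -
  interpret sw: macdonald2t G B A "inv C" \<beta> \<alpha> m l t v' u' "- d'" by (rule swapped2t)
  show ?thesis by (rule sw.A_central[OF assms])
qed

lemma comm_A_pow_B: "comm G (A [^] int N) B = C [^] int N \<otimes> A [^] (\<alpha> * geom \<alpha> N - int N * \<alpha> ^ N)"
proof -
  have "A [^] int N \<otimes> (C [^] int N \<otimes> A [^] (\<alpha> * geom \<alpha> N - int N * \<alpha> ^ N)) = C [^] int N \<otimes> A [^] (\<alpha> * geom \<alpha> N)"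
    by (simp add: A_Cn_r flip: int_pow_mult)
  then show ?thesis by (simp add: comm_eq_iff An_B)
qed

lemma comm_C_A: "comm G C A = A [^] (1 - \<alpha>)"
proof -
  have "A \<otimes> C \<otimes> A [^] (1 - \<alpha>) = C \<otimes> A" unfolding AC by (simp add: m_assoc flip: int_pow_mult)
  then show ?thesis by (simp add: comm_eq_iff m_assoc)
qed

lemma comm_A_B: "comm G A B = C"
  using AB by (simp add: comm_eq_iff m_assoc)

text \<open>The chain is \<open>C = [A,B]\<close>, \<open>[C,A] = A^(1-\<alpha>)\<close>, its
  inverse \<open>A^N\<close>, \<open>W = [A^N,B]\<close> and
  \<open>[W,A] = A^(1-\<alpha>^N)\<close>. The last exponent has valuation \<open>2 * m\<close>,
  less than \<open>l + m + 1\<close>.\<close>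

lemma lower_central_4_nontrivial:
  assumes ord: "\<And>i::int. A [^] i = \<one> \<Longrightarrow> 2 ^ (l + m + 1) dvd i"
  shows "\<exists>x\<in>lower_central G 4. x \<noteq> \<one>"
proof -
  interpret sw: macdonald2t G B A "inv C" \<beta> \<alpha> m l t v' u' "- d'" by (rule swapped2t)
  have sub: "lower_central G k \<subseteq> carrier G" for k
  proof (induction k)
    case (Suc k)
    then have "{comm G x y | x y. x \<in> lower_central G k \<and> y \<in> carrier G} \<subseteq> carrier G" by auto
    then show ?case using generate_in_carrier by auto
  qed simp
  have step: "comm G x y \<in> lower_central G (Suc k)" if "x \<in> lower_central G k" "y \<in> carrier G" for x y k
    using that by (auto intro: generate.incl)
  define N where "N = nat (\<alpha> - 1)"
  have N: "int N = 2 ^ m * u'" "\<alpha> = 1 + int N" using \<alpha>_pos \<alpha> by (simp_all add: N_def)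
  have "C \<in> lower_central G (Suc 0)" using step[of A 0 B] by (simp add: comm_A_B)
  then have 2: "A [^] (1 - \<alpha>) \<in> lower_central G (Suc (Suc 0))" using step[OF _ A, of C "Suc 0"] unfolding comm_C_A by blast
  have "subgroup (lower_central G (Suc k)) G" for k
  proof -
    have "{comm G x y | x y. x \<in> lower_central G k \<and> y \<in> carrier G} \<subseteq> carrier G" using sub[of k] by auto
    then show ?thesis unfolding lower_central.simps(2) by (rule generate_is_subgroup)
  qed
  then have "inv (A [^] (1 - \<alpha>)) \<in> lower_central G (Suc (Suc 0))" using 2 by (rule subgroup.m_inv_closed)
  then have "A [^] int N \<in> lower_central G (Suc (Suc 0))" using N(2) by (simp flip: int_pow_neg)
  then have 3: "comm G (A [^] int N) B \<in> lower_central G (Suc (Suc (Suc 0)))" using step by blast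
  define g where "g = \<alpha> * geom \<alpha> N - int N * \<alpha> ^ N"
  define W where "W = C [^] int N \<otimes> A [^] g"
  have W: "W \<in> carrier G" by (simp add: W_def)
  have "comm G W A \<in> lower_central G (Suc (Suc (Suc (Suc 0))))"
    using 3 step unfolding W_def g_def comm_A_pow_B[symmetric] by blast
  moreover have "comm G W A = A [^] (1 - \<alpha> ^ N)"
  proof -
    have "A \<otimes> (W \<otimes> A [^] (1 - \<alpha> ^ N)) = A [^] (1::int) \<otimes> (C [^] int N \<otimes> A [^] (g + (1 - \<alpha> ^ N)))"
      unfolding W_def by (simp add: m_assoc flip: int_pow_mult)
    also have "\<dots> = C [^] int N \<otimes> A [^] (g + 1)" by (subst A_Cn_r) (simp_all flip: int_pow_mult)
    also have "\<dots> = W \<otimes> A" unfolding W_def by (simp add: m_assoc int_pow_mult)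
    finally show ?thesis using W by (simp add: comm_eq_iff)
  qed
  moreover have "A [^] (1 - \<alpha> ^ N) \<noteq> \<one>"
  proof
    assume "A [^] (1 - \<alpha> ^ N) = \<one>"
    then have "2 ^ (l + m + 1) dvd 1 - \<alpha> ^ N" by (rule ord)
    moreover have "(2::int) ^ (2 * m + 1) dvd 2 ^ (l + m + 1)" using ml by (intro le_imp_power_dvd) simp
    ultimately have 1: "2 ^ (2 * m + 1) dvd 1 - \<alpha> ^ N" using dvd_trans by blast
    have "int (2 ^ m) dvd int N" unfolding N by simp
    then have "2 ^ m dvd N" by (simp only: int_dvd_int_iff)
    from sw.\<beta>_pow[OF this] have "2 ^ (2 * m + 1) dvd \<alpha> ^ N - 1 - int N * (2 ^ m * u')"
      by (rule dvd_trans[OF le_imp_power_dvd, rotated]) (use m3 in simp)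
    from dvd_add[OF 1 this] have "2 ^ (2 * m + 1) dvd - (int N * (2 ^ m * u'))" by simp
    then have "2 ^ (2 * m + 1) dvd int N * (2 ^ m * u')" by (simp only: dvd_minus_iff)
    then have "2 ^ (2 * m) * 2 dvd 2 ^ (2 * m) * (u' * u')" unfolding N
      by (simp add: power_add power_mult power2_eq_square mult_ac)
    then have "2 dvd u' * u'" by (subst (asm) dvd_mult_cancel_left) simp
    then show False using odds by simp
  qed
  ultimately show ?thesis by (auto simp: numeral_eq_Suc simp del: lower_central.simps)
qed

lemma upper_central_A_central:
  assumes gen: "carrier G = generate G {A, B}" and i: "2 ^ (2 * m) dvd i"
  shows "A [^] (i::int) \<in> upper_central 1" "B [^] i \<in> upper_central 1"
proof -
  have AB: "{A, B} \<subseteq> carrier G" by simp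
  have AA: "A [^] i \<otimes> A = A \<otimes> A [^] i" and BB: "B [^] i \<otimes> B = B \<otimes> B [^] i"
    using commute_int_pow[of A A i 1] commute_int_pow[of B B i 1] by simp_all
  show "A [^] i \<in> upper_central 1" unfolding upper_central_numerals(1)
    by (rule rel_center_generators[OF upper_central_normal gen AB])
      (use AA A_central[OF i] in \<open>auto simp: comm_eq_iff\<close>)
  show "B [^] i \<in> upper_central 1" unfolding upper_central_numerals(1)
    by (rule rel_center_generators[OF upper_central_normal gen AB])
      (use BB B_central[OF i] in \<open>auto simp: comm_eq_iff\<close>)
qed

text \<open>\<open>[A^e, B] = B^(1-\<beta>^n)\<close> is central, its exponent being a multiple of
  \<open>2^(l+m)\<close>; and \<open>A^(2^(2m-1))\<close> is a power of \<open>A^e\<close>.\<close>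

lemma upper_central_A_half:
  assumes gen: "carrier G = generate G {A, B}" and i: "2 ^ (2 * m - 1) dvd i"
  shows "A [^] (i::int) \<in> upper_central 2"
proof -
  have AB: "{A, B} \<subseteq> carrier G" by simp
  interpret Z1: normal "upper_central 1" G by (rule upper_central_normal)
  interpret Z2: normal "upper_central 2" G by (rule upper_central_normal)
  have "A [^] e \<in> upper_central 2" unfolding upper_central_numerals(2)
  proof (rule rel_center_generators[OF upper_central_normal gen AB])
    fix y assume "y \<in> {A, B}"
    then consider "y = A" | "y = B" by auto
    then show "comm G (A [^] e) y \<in> upper_central 1"
    proof cases
      case 1
      have "A [^] e \<otimes> A = A \<otimes> A [^] e" using commute_int_pow[of A A e 1] by simp
      then have "comm G (A [^] e) y = \<one>" using 1 by (simp add: comm_eq_iff)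
      then show ?thesis using Z1.one_closed by simp
    next
      case 2
      have "comm G (A [^] e) B = B [^] (1 - \<beta> ^ n)"
      proof -
        have "B \<otimes> (A [^] e \<otimes> B [^] (1 - \<beta> ^ n)) = A [^] e \<otimes> (B [^] (\<beta> ^ n) \<otimes> B [^] (1 - \<beta> ^ n))"
          using B_A_e by (simp flip: m_assoc)
        then show ?thesis by (simp add: comm_eq_iff flip: int_pow_mult)
      qed
      moreover have "2 ^ (2 * m) dvd 1 - \<beta> ^ n"
      proof -
        have "2 ^ (2 * m) dvd \<beta> ^ n - 1"
          by (rule dvd_trans[OF le_imp_power_dvd \<beta>_pow_dvd[OF n_dvd]]) (use ml in simp)
        then show ?thesis by (metis dvd_minus_iff minus_diff_eq)
      qed
      ultimately show ?thesis using 2 upper_central_A_central(2)[OF gen] by simp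
    qed
  qed simp
  moreover obtain e' where e': "odd e'" "e = 2 ^ (2 * m - 1) * e'" by (rule e_obtain)
  have "(A [^] ((2::int) ^ (2 * m - 1))) [^] ((2::int) ^ t) = (A [^] ((2::int) ^ t)) [^] ((2::int) ^ (2 * m - 1))"
    by (simp add: int_pow_pow mult.commute)
  then have "(A [^] ((2::int) ^ (2 * m - 1))) [^] ((2::int) ^ t) = \<one>" by (simp add: A_ord)
  then obtain s where s: "odd s" "((A [^] ((2::int) ^ (2 * m - 1))) [^] e') [^] (s::int) = A [^] ((2::int) ^ (2 * m - 1))"
    by (rule pow_inverse_odd[OF int_pow_closed[OF A] _ e'(1)])
  obtain k where k: "i = 2 ^ (2 * m - 1) * k" using i by (auto simp: dvd_def)
  have "A [^] i = (A [^] e) [^] (s * k)"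
    using s(2) unfolding k e' by (metis A int_pow_closed int_pow_pow)
  ultimately show ?thesis using subgroup_int_pow_closed[OF Z2.subgroup_axioms] by simp
qed

lemma upper_central_C_pow:
  assumes gen: "carrier G = generate G {A, B}"
  shows "C [^] ((2::int) ^ m) \<in> upper_central 2"
proof -
  interpret sw: macdonald2t G B A "inv C" \<beta> \<alpha> m l t v' u' "- d'" by (rule swapped2t)
  have AB: "{A, B} \<subseteq> carrier G" by simp
  interpret Z1: normal "upper_central 1" G by (rule upper_central_normal)
  let ?N = "2 ^ m :: nat"
  have "C [^] int ?N \<in> upper_central 2" unfolding upper_central_numerals(2)
  proof (rule rel_center_generators[OF upper_central_normal gen AB])
    fix y assume "y \<in> {A, B}"
    then consider "y = A" | "y = B" by auto
    then show "comm G (C [^] int ?N) y \<in> upper_central 1"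
    proof cases
      case 1
      have "A \<otimes> (C [^] int ?N \<otimes> A [^] (1 - \<alpha> ^ ?N)) = C [^] int ?N \<otimes> A"
        using A_Cn_r[of "A [^] (1 - \<alpha> ^ ?N)" 1 ?N] by (simp flip: int_pow_mult)
      then have "comm G (C [^] int ?N) A = A [^] (1 - \<alpha> ^ ?N)" by (subst comm_eq_iff) simp_all
      moreover have "2 ^ (2 * m) dvd 1 - \<alpha> ^ ?N"
        using sw.\<beta>_pow_dvd[of m ?N] by (metis dvd_minus_iff dvd_refl minus_diff_eq mult_2)
      ultimately show ?thesis using 1 upper_central_A_central(1)[OF gen] by simp
    next
      case 2
      let ?b = "B [^] (\<beta> ^ ?N - 1)"
      have b: "?b \<in> upper_central 1" using \<beta>_pow_dvd[of m ?N] by (intro upper_central_A_central[OF gen]) (simp add: mult_2)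
      have "B \<otimes> (C [^] int ?N \<otimes> (inv (C [^] int ?N) \<otimes> ?b \<otimes> C [^] int ?N)) = B [^] (1::int) \<otimes> (?b \<otimes> C [^] int ?N)"
        by (simp add: m_assoc inv_cancel_left)
      also have "\<dots> = C [^] int ?N \<otimes> B"
        using Cn_B[of ?N 1] int_pow_mult[of B 1 "\<beta> ^ ?N - 1"] by (simp flip: m_assoc)
      finally have "comm G (C [^] int ?N) B = inv (C [^] int ?N) \<otimes> ?b \<otimes> C [^] int ?N"
        by (subst comm_eq_iff) simp_all
      then show ?thesis using 2 Z1.inv_op_closed1[OF _ b] by simp
    qed
  qed simp
  then show ?thesis by simp
qed

text \<open>For \<open>N = 2^m\<close>, \<open>[A^N, B] = C^N A^g\<close> with \<open>g\<close>
  divisible by \<open>2^(2m-1)\<close>, so both factors already lie in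
  \<open>upper_central 2\<close>.\<close>

lemma upper_central_A_pow:
  assumes gen: "carrier G = generate G {A, B}"
  shows "A [^] ((2::int) ^ m) \<in> upper_central 3"
proof -
  have AB: "{A, B} \<subseteq> carrier G" by simp
  interpret Z2: normal "upper_central 2" G by (rule upper_central_normal)
  let ?N = "2 ^ m :: nat"
  have "A [^] int ?N \<in> upper_central 3" unfolding upper_central_numerals(3)
  proof (rule rel_center_generators[OF upper_central_normal gen AB])
    fix y assume "y \<in> {A, B}"
    then consider "y = A" | "y = B" by auto
    then show "comm G (A [^] int ?N) y \<in> upper_central 2"
    proof cases
      case 1
      have "A [^] int ?N \<otimes> A = A \<otimes> A [^] int ?N" using commute_int_pow[of A A "int ?N" 1] by simp
      then have "comm G (A [^] int ?N) y = \<one>" unfolding 1 by (subst comm_eq_iff) simp_all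
      then show ?thesis using Z2.one_closed by simp
    next
      case 2
      have "2 ^ (2 * m - 1) dvd \<alpha> * geom \<alpha> ?N - int ?N * \<alpha> ^ ?N"
      proof -
        have du: "(2::int) ^ m dvd 2 ^ m * u'" and m1: "1 \<le> m" using m3 by simp_all
        have "2 ^ (m + 2 * m - 1) dvd \<alpha> ^ ?N - 1 - int ?N * (2 ^ m * u')"
          using binomial_first_order[OF du m1, of m ?N] \<alpha> by simp
        also have "\<alpha> ^ ?N - 1 - int ?N * (2 ^ m * u') = 2 ^ m * (u' * (geom \<alpha> ?N - int ?N))"
          unfolding geom_mult[symmetric] by (simp add: \<alpha> algebra_simps)
        also have "(2::int) ^ (m + 2 * m - 1) = 2 ^ m * 2 ^ (2 * m - 1)" using m3 by (simp flip: power_add)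
        finally have "2 ^ (2 * m - 1) dvd u' * (geom \<alpha> ?N - int ?N)" by (subst (asm) dvd_mult_cancel_left) simp
        moreover have "coprime (2 ^ (2 * m - 1)) u'" using odds by simp
        ultimately have 1: "2 ^ (2 * m - 1) dvd geom \<alpha> ?N - int ?N" by (metis coprime_dvd_mult_right_iff)
        have 2: "2 ^ (2 * m - 1) dvd int ?N * (2 ^ m * u')"
        proof -
          have "(2::int) ^ (2 * m - 1) dvd 2 ^ (m + m)" by (intro le_imp_power_dvd) simp
          then show ?thesis by (simp add: power_add flip: mult.assoc)
        qed
        have 3: "2 ^ (2 * m - 1) dvd int ?N * (\<alpha> ^ ?N - 1)"
        proof -
          have "2 ^ m dvd \<alpha> ^ ?N - 1" unfolding geom_mult[symmetric] by (simp add: \<alpha>)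
          then have "2 ^ m * 2 ^ m dvd int ?N * (\<alpha> ^ ?N - 1)" by (simp add: mult_dvd_mono)
          moreover have "(2::int) ^ (2 * m - 1) dvd 2 ^ m * 2 ^ m" unfolding power_add[symmetric] by (intro le_imp_power_dvd) simp
          ultimately show ?thesis using dvd_trans by blast
        qed
        have "\<alpha> * geom \<alpha> ?N - int ?N * \<alpha> ^ ?N
          = \<alpha> * (geom \<alpha> ?N - int ?N) + int ?N * (2 ^ m * u') - int ?N * (\<alpha> ^ ?N - 1)"
          by (simp add: \<alpha> algebra_simps)
        then show ?thesis using 1 2 3 by (metis dvd_add dvd_diff dvd_mult)
      qed
      then have "A [^] (\<alpha> * geom \<alpha> ?N - int ?N * \<alpha> ^ ?N) \<in> upper_central 2" by (rule upper_central_A_half[OF gen])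
      moreover have "C [^] int ?N \<in> upper_central 2" using upper_central_C_pow[OF gen] by simp
      ultimately show ?thesis unfolding 2 comm_A_pow_B by simp
    qed
  qed simp
  then show ?thesis by simp
qed

lemma carrier_subset_upper_central:
  assumes gen: "carrier G = generate G {A, B}"
  shows "carrier G \<subseteq> upper_central (Suc 4)"
proof -
  interpret sw: macdonald2t G B A "inv C" \<beta> \<alpha> m l t v' u' "- d'" by (rule swapped2t)
  have gen': "carrier G = generate G {B, A}" using gen by (simp add: insert_commute)
  have AB: "{A, B} \<subseteq> carrier G" by simp
  interpret Z3: normal "upper_central 3" G by (rule upper_central_normal)
  interpret Z4: normal "upper_central 4" G by (rule upper_central_normal)
  interpret Z5: normal "upper_central (Suc 4)" G by (rule upper_central_normal)
  have Au: "A [^] (1 - \<alpha>) \<in> upper_central 3" "B [^] (\<beta> - 1) \<in> upper_central 3"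
  proof -
    have "(A [^] ((2::int) ^ m)) [^] (- u') \<in> upper_central 3" "(B [^] ((2::int) ^ m)) [^] v' \<in> upper_central 3"
      using upper_central_A_pow[OF gen] sw.upper_central_A_pow[OF gen'] subgroup_int_pow_closed[OF Z3.subgroup_axioms] by blast+
    then show "A [^] (1 - \<alpha>) \<in> upper_central 3" "B [^] (\<beta> - 1) \<in> upper_central 3" by (simp_all add: int_pow_pow \<alpha> \<beta>)
  qed
  have C4: "C \<in> upper_central 4" unfolding upper_central_numerals(4)
  proof (rule rel_center_generators[OF upper_central_normal gen AB])
    fix y assume "y \<in> {A, B}"
    then consider "y = A" | "y = B" by auto
    then show "comm G C y \<in> upper_central 3"
    proof cases
      case 2
      have "B \<otimes> (C \<otimes> (inv C \<otimes> B [^] (\<beta> - 1) \<otimes> C)) = B [^] (1::int) \<otimes> (B [^] (\<beta> - 1) \<otimes> C)"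
        by (simp add: m_assoc inv_cancel_left)
      also have "\<dots> = C \<otimes> B" using CB int_pow_mult[of B 1 "\<beta> - 1"] by (simp flip: m_assoc)
      finally have "comm G C B = inv C \<otimes> B [^] (\<beta> - 1) \<otimes> C" by (subst comm_eq_iff) simp_all
      then show ?thesis using 2 Z3.inv_op_closed1[OF C Au(2)] by simp
    qed (use Au(1) comm_C_A in simp)
  qed simp
  have one: "comm G x x = \<one>" if "x \<in> carrier G" for x using that by (simp add: comm_eq_iff)
  have BA: "comm G B A = inv C" by (rule sw.comm_A_B)
  have "A \<in> upper_central (Suc 4)" unfolding upper_central.simps
    by (rule rel_center_generators[OF upper_central_normal gen AB]) (use C4 one comm_A_B Z4.one_closed in auto)
  moreover have "B \<in> upper_central (Suc 4)" unfolding upper_central.simps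
    by (rule rel_center_generators[OF upper_central_normal gen AB]) (use C4 one BA Z4.one_closed Z4.m_inv_closed in auto)
  ultimately show ?thesis unfolding gen by (intro generate_subgroup_incl Z5.subgroup_axioms) simp
qed

end

section \<open>The presented group\<close>

lemma pres_eq_append:
  assumes "pres_eq R u u'" "pres_eq R v v'" shows "pres_eq R (u @ v) (u' @ v')"
proof -
  have l: "pres_eq R (x @ u) (x @ u')" if "pres_eq R u u'" for x u u'
    using that
  proof (induction)
    case (cancel u y v) then show ?case using pres_eq.cancel[of R "x @ u" y v] by simp
  next
    case (relator r u v) then show ?case using pres_eq.relator[of r R "x @ u" v] by simp
  qed (auto intro: pres_eq.intros)
  have r: "pres_eq R (u @ x) (u' @ x)" if "pres_eq R u u'" for x u u'
    using that
  proof (induction)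
    case (cancel u y v) then show ?case using pres_eq.cancel[of R u y "v @ x"] by simp
  next
    case (relator r u v) then show ?case using pres_eq.relator[of r R u "v @ x"] by simp
  qed (auto intro: pres_eq.intros)
  show ?thesis using l[OF assms(2), of u] r[OF assms(1), of v'] by (blast intro: pres_eq.trans)
qed

lemma pres_class_eq_iff: "pres_class R u = pres_class R v \<longleftrightarrow> pres_eq R u v"
  unfolding pres_class_def by (blast intro: pres_eq.intros)

lemma pres_eq_some: "pres_eq R u (SOME w. w \<in> pres_class R u)"
  using someI[of "\<lambda>w. w \<in> pres_class R u" u] by (simp add: pres_class_def pres_eq.refl)

lemma pres_mult_class: "pres_mult R (pres_class R u) (pres_class R v) = pres_class R (u @ v)"
  unfolding pres_mult_def pres_class_eq_iff
  by (blast intro: pres_eq.sym pres_eq_append pres_eq_some)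

lemma pres_eq_word_inv: "pres_eq R (word_inv w @ w) []"
proof (induction w)
  case (Cons l w)
  have "word_inv (l # w) @ (l # w) = word_inv w @ [letter_inv l, letter_inv (letter_inv l)] @ w"
    by (simp add: word_inv_def letter_inv_def)
  then have "pres_eq R (word_inv (l # w) @ (l # w)) (word_inv w @ w)"
    using pres_eq.cancel[of R "word_inv w" "letter_inv l" w] by simp
  then show ?case using Cons by (blast intro: pres_eq.trans)
qed (simp add: word_inv_def pres_eq.refl)

lemma presented_group_simps:
  "carrier (presented_group R) = range (pres_class R)"
  "pres_class R u \<otimes>\<^bsub>presented_group R\<^esub> pres_class R v = pres_class R (u @ v)"
  "\<one>\<^bsub>presented_group R\<^esub> = pres_class R []"
  by (simp_all add: presented_group_def pres_mult_class)

lemma group_presented_group: "group (presented_group R)"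
proof (rule groupI)
  fix x assume "x \<in> carrier (presented_group R)"
  then obtain u where u: "x = pres_class R u" by (auto simp: presented_group_simps)
  show "\<exists>y\<in>carrier (presented_group R). y \<otimes>\<^bsub>presented_group R\<^esub> x = \<one>\<^bsub>presented_group R\<^esub>"
    using pres_eq_word_inv[of R u] unfolding u
    by (intro bexI[of _ "pres_class R (word_inv u)"]) (auto simp: presented_group_simps pres_class_eq_iff)
qed (auto simp: presented_group_simps)

lemma presented_group_inv: "inv\<^bsub>presented_group R\<^esub> (pres_class R u) = pres_class R (word_inv u)"
proof -
  interpret group "presented_group R" by (rule group_presented_group)
  show ?thesis
    using pres_eq_word_inv[of R u]
    by (intro inv_equality) (auto simp: presented_group_simps pres_class_eq_iff)
qed

lemma presented_group_int_pow:
  "pres_class R u [^]\<^bsub>presented_group R\<^esub> (n::int) = pres_class R (word_pow u n)"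
proof -
  interpret group "presented_group R" by (rule group_presented_group)
  have mem: "pres_class R u \<in> carrier (presented_group R)" for u by (simp add: presented_group_simps)
  have nat: "pres_class R u [^]\<^bsub>presented_group R\<^esub> (k::nat) = pres_class R (concat (replicate k u))" for k u
  proof (induction k)
    case (Suc k)
    have "replicate k u @ [u] = u # replicate k u" by (metis replicate_app_Cons_same append_Nil2)
    then have "concat (replicate k u) @ u = u @ concat (replicate k u)"
      by (metis concat.simps(2) concat_append concat.simps(1) append_Nil2)
    then show ?case using Suc by (simp add: presented_group_simps)
  qed (simp add: presented_group_simps)
  show ?thesis
  proof (cases "n \<ge> 0")
    case True
    then show ?thesis by (simp add: int_pow_def2 nat word_pow_def)
  next
    case False
    then have n: "n < 0" by simp
    have "pres_class R u [^]\<^bsub>presented_group R\<^esub> n = inv\<^bsub>presented_group R\<^esub> (pres_class R u [^]\<^bsub>presented_group R\<^esub> nat (- n))"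
      unfolding int_pow_def2 using n by (simp only: if_True)
    also have "\<dots> = pres_class R (concat (replicate (nat (- n)) (word_inv u)))"
      by (subst nat_pow_inv[OF mem, symmetric]) (simp only: presented_group_inv nat)
    finally show ?thesis using n by (simp add: word_pow_def)
  qed
qed

lemma pres_class_mem_generate:
  "pres_class R u \<in> generate (presented_group R) {pres_class R wA, pres_class R wB}" (is "_ \<in> generate ?G ?S")
proof (induction u)
  case Nil
  then show ?case using generate.one[of ?G ?S] by (simp add: presented_group_simps)
next
  case (Cons x u)
  obtain g i where x: "x = (g, i)" by (cases x)
  have inv: "pres_class R (word_inv wA) \<in> generate ?G ?S" "pres_class R (word_inv wB) \<in> generate ?G ?S"
    unfolding presented_group_inv[symmetric] by (auto intro: generate.inv)
  have "pres_class R [x] \<in> generate ?G ?S"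
    using inv generate.incl[of "pres_class R wA" ?S ?G] generate.incl[of "pres_class R wB" ?S ?G] unfolding x
    by (cases g; cases i) (simp_all add: wA_def wB_def word_inv_def letter_inv_def)
  from generate.eng[OF this Cons] show ?case by (simp add: presented_group_simps)
qed

lemma macdonald_Grp:
  "macdonald (Grp \<alpha> \<beta>) (genA \<alpha> \<beta>) (genB \<alpha> \<beta>) (genC \<alpha> \<beta>) \<alpha> \<beta>"
proof -
  let ?R = "G_relators \<alpha> \<beta>"
  interpret group "Grp \<alpha> \<beta>" unfolding Grp_def by (rule group_presented_group)
  have mem: "genA \<alpha> \<beta> \<in> carrier (Grp \<alpha> \<beta>)" "genB \<alpha> \<beta> \<in> carrier (Grp \<alpha> \<beta>)" "genC \<alpha> \<beta> \<in> carrier (Grp \<alpha> \<beta>)"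
    by (auto simp: Grp_def genA_def genB_def genC_def presented_group_simps)
  have rel: "pres_class ?R r = \<one>\<^bsub>Grp \<alpha> \<beta>\<^esub>" if "r \<in> ?R" for r
    using pres_eq.relator[OF that, of "[]" "[]"] by (simp add: Grp_def presented_group_simps pres_class_eq_iff)
  have inv: "inv\<^bsub>Grp \<alpha> \<beta>\<^esub> genA \<alpha> \<beta> = pres_class ?R (word_inv wA)" "inv\<^bsub>Grp \<alpha> \<beta>\<^esub> genB \<alpha> \<beta> = pres_class ?R (word_inv wB)"
    "inv\<^bsub>Grp \<alpha> \<beta>\<^esub> genC \<alpha> \<beta> = pres_class ?R (word_inv wC)"
    by (simp_all add: Grp_def genA_def genB_def genC_def presented_group_inv)
  have pow: "genA \<alpha> \<beta> [^]\<^bsub>Grp \<alpha> \<beta>\<^esub> (n::int) = pres_class ?R (word_pow wA n)"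
    "genB \<alpha> \<beta> [^]\<^bsub>Grp \<alpha> \<beta>\<^esub> n = pres_class ?R (word_pow wB n)" for n
    by (simp_all add: Grp_def genA_def genB_def presented_group_int_pow)
  have C: "genC \<alpha> \<beta> = inv\<^bsub>Grp \<alpha> \<beta>\<^esub> genA \<alpha> \<beta> \<otimes>\<^bsub>Grp \<alpha> \<beta>\<^esub> (inv\<^bsub>Grp \<alpha> \<beta>\<^esub> genB \<alpha> \<beta> \<otimes>\<^bsub>Grp \<alpha> \<beta>\<^esub> (genA \<alpha> \<beta> \<otimes>\<^bsub>Grp \<alpha> \<beta>\<^esub> genB \<alpha> \<beta>))"
    unfolding inv unfolding genA_def genB_def genC_def Grp_def by (simp add: presented_group_simps wC_def)
  have 1: "inv\<^bsub>Grp \<alpha> \<beta>\<^esub> genC \<alpha> \<beta> \<otimes>\<^bsub>Grp \<alpha> \<beta>\<^esub> (genA \<alpha> \<beta> \<otimes>\<^bsub>Grp \<alpha> \<beta>\<^esub> (genC \<alpha> \<beta> \<otimes>\<^bsub>Grp \<alpha> \<beta>\<^esub> genA \<alpha> \<beta> [^]\<^bsub>Grp \<alpha> \<beta>\<^esub> (- \<alpha>))) = \<one>\<^bsub>Grp \<alpha> \<beta>\<^esub>"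
    using rel[of "word_inv wC @ wA @ wC @ word_pow wA (- \<alpha>)"] unfolding inv pow 
    unfolding genA_def genC_def Grp_def by (simp add: presented_group_simps G_relators_def)
  have 2: "genC \<alpha> \<beta> \<otimes>\<^bsub>Grp \<alpha> \<beta>\<^esub> (genB \<alpha> \<beta> \<otimes>\<^bsub>Grp \<alpha> \<beta>\<^esub> (inv\<^bsub>Grp \<alpha> \<beta>\<^esub> genC \<alpha> \<beta> \<otimes>\<^bsub>Grp \<alpha> \<beta>\<^esub> genB \<alpha> \<beta> [^]\<^bsub>Grp \<alpha> \<beta>\<^esub> (- \<beta>))) = \<one>\<^bsub>Grp \<alpha> \<beta>\<^esub>"
    using rel[of "wC @ wB @ word_inv wC @ word_pow wB (- \<beta>)"] unfolding inv pow 
    unfolding genB_def genC_def Grp_def by (simp add: presented_group_simps G_relators_def)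
  show ?thesis
  proof
    show "genA \<alpha> \<beta> \<otimes>\<^bsub>Grp \<alpha> \<beta>\<^esub> genB \<alpha> \<beta> = genB \<alpha> \<beta> \<otimes>\<^bsub>Grp \<alpha> \<beta>\<^esub> genA \<alpha> \<beta> \<otimes>\<^bsub>Grp \<alpha> \<beta>\<^esub> genC \<alpha> \<beta>"
      unfolding C using mem by (simp add: m_assoc inv_cancel_left)
    have "genA \<alpha> \<beta> \<otimes>\<^bsub>Grp \<alpha> \<beta>\<^esub> (genC \<alpha> \<beta> \<otimes>\<^bsub>Grp \<alpha> \<beta>\<^esub> genA \<alpha> \<beta> [^]\<^bsub>Grp \<alpha> \<beta>\<^esub> (- \<alpha>)) = genC \<alpha> \<beta>"
      using 1 mem by (metis inv_closed inv_equality inv_inv int_pow_closed m_closed inv_comm)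
    then have "genA \<alpha> \<beta> \<otimes>\<^bsub>Grp \<alpha> \<beta>\<^esub> (genC \<alpha> \<beta> \<otimes>\<^bsub>Grp \<alpha> \<beta>\<^esub> genA \<alpha> \<beta> [^]\<^bsub>Grp \<alpha> \<beta>\<^esub> (- \<alpha>)) \<otimes>\<^bsub>Grp \<alpha> \<beta>\<^esub> genA \<alpha> \<beta> [^]\<^bsub>Grp \<alpha> \<beta>\<^esub> \<alpha>
       = genC \<alpha> \<beta> \<otimes>\<^bsub>Grp \<alpha> \<beta>\<^esub> genA \<alpha> \<beta> [^]\<^bsub>Grp \<alpha> \<beta>\<^esub> \<alpha>" by simp
    then show "genA \<alpha> \<beta> \<otimes>\<^bsub>Grp \<alpha> \<beta>\<^esub> genC \<alpha> \<beta> = genC \<alpha> \<beta> \<otimes>\<^bsub>Grp \<alpha> \<beta>\<^esub> genA \<alpha> \<beta> [^]\<^bsub>Grp \<alpha> \<beta>\<^esub> \<alpha>"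
      using mem by (simp add: m_assoc flip: int_pow_mult)
    have "(genC \<alpha> \<beta> \<otimes>\<^bsub>Grp \<alpha> \<beta>\<^esub> (genB \<alpha> \<beta> \<otimes>\<^bsub>Grp \<alpha> \<beta>\<^esub> (inv\<^bsub>Grp \<alpha> \<beta>\<^esub> genC \<alpha> \<beta> \<otimes>\<^bsub>Grp \<alpha> \<beta>\<^esub> genB \<alpha> \<beta> [^]\<^bsub>Grp \<alpha> \<beta>\<^esub> (- \<beta>)))) \<otimes>\<^bsub>Grp \<alpha> \<beta>\<^esub> (genB \<alpha> \<beta> [^]\<^bsub>Grp \<alpha> \<beta>\<^esub> \<beta> \<otimes>\<^bsub>Grp \<alpha> \<beta>\<^esub> genC \<alpha> \<beta>)
      = genB \<alpha> \<beta> [^]\<^bsub>Grp \<alpha> \<beta>\<^esub> \<beta> \<otimes>\<^bsub>Grp \<alpha> \<beta>\<^esub> genC \<alpha> \<beta>" unfolding 2 using mem by simp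
    then show "genC \<alpha> \<beta> \<otimes>\<^bsub>Grp \<alpha> \<beta>\<^esub> genB \<alpha> \<beta> = genB \<alpha> \<beta> [^]\<^bsub>Grp \<alpha> \<beta>\<^esub> \<beta> \<otimes>\<^bsub>Grp \<alpha> \<beta>\<^esub> genC \<alpha> \<beta>"
      using mem by (simp add: m_assoc int_pow_mult_r)
  qed (use mem in auto)
qed

lemma Grp_generated: "carrier (Grp \<alpha> \<beta>) = generate (Grp \<alpha> \<beta>) {genA \<alpha> \<beta>, genB \<alpha> \<beta>}"
proof -
  interpret m: macdonald "Grp \<alpha> \<beta>" "genA \<alpha> \<beta>" "genB \<alpha> \<beta>" "genC \<alpha> \<beta>" \<alpha> \<beta> by (rule macdonald_Grp)
  have "carrier (Grp \<alpha> \<beta>) \<subseteq> generate (Grp \<alpha> \<beta>) {genA \<alpha> \<beta>, genB \<alpha> \<beta>}"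
    using pres_class_mem_generate by (auto simp: Grp_def genA_def genB_def presented_group_simps)
  moreover have "generate (Grp \<alpha> \<beta>) {genA \<alpha> \<beta>, genB \<alpha> \<beta>} \<subseteq> carrier (Grp \<alpha> \<beta>)"
    by (rule m.generate_incl) simp
  ultimately show ?thesis by blast
qed

section \<open>Transfer from the model to the presented group and to its Sylow 2-subgroup\<close>

lemma model_exists:
  fixes \<alpha> \<beta> u' v' d' :: int
  assumes "\<alpha> = 1 + 2 ^ m * u'" "\<beta> = 1 + 2 ^ m * v'" "\<alpha> - \<beta> = 2 ^ l * d'"
    and odds: "odd u'" "odd v'" "odd d'" and m: "3 \<le> m" "m < l" "l + 3 \<le> 2 * m"
  obtains th where "model (2 ^ (m - 2)) (2 ^ (l - 2)) u' v' d' th (l + m + 1)"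
proof -
  have "coprime 3 ((2::int) ^ (l + m + 1))" by simp
  from cong_solve_coprime_int[OF this] obtain th :: int where "[3 * th = 1] (mod 2 ^ (l + m + 1))" by blast
  then have th: "2 ^ (l + m + 1) dvd 3 * th - 1" by (simp add: cong_iff_dvd_diff)
  have W: "(32::int) * 2 ^ (l - 2) * 2 ^ (m - 2) = 2 ^ (l + m + 1)"
  proof -
    have "l + m + 1 = 5 + (l - 2) + (m - 2)" using m by simp
    then have "(2::int) ^ (l + m + 1) = 2 ^ 5 * 2 ^ (l - 2) * 2 ^ (m - 2)" by (metis power_add)
    then show ?thesis by simp
  qed
  show thesis
  proof (rule that, unfold_locales)
    have "(2::int) * 2 ^ (m - 2) = 2 ^ (m - 1)" using m by (simp flip: power_Suc add: Suc_diff_Suc numeral_2_eq_2)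
    then show "(2::int) * 2 ^ (m - 2) dvd 2 ^ (l - 2)" using m by (simp add: le_imp_power_dvd)
    have "(2::int) * 2 ^ (l - 2) = 2 ^ (l - 1)" using m by (simp flip: power_Suc add: Suc_diff_Suc numeral_2_eq_2)
    moreover have "((2::int) ^ (m - 2))\<^sup>2 = 2 ^ (2 * (m - 2))" by (metis mult.commute power_mult)
    ultimately show "(2::int) * 2 ^ (l - 2) dvd (2 ^ (m - 2))\<^sup>2" using m by (simp add: le_imp_power_dvd)
    have "(4::int) * 2 ^ (m - 2) = 2 ^ m" "(4::int) * 2 ^ (l - 2) = 2 ^ l"
    proof -
      have "m = 2 + (m - 2)" "l = 2 + (l - 2)" using m by simp_all
      then show "(4::int) * 2 ^ (m - 2) = 2 ^ m" "(4::int) * 2 ^ (l - 2) = 2 ^ l"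
        by (metis power_add power2_eq_square mult_2 numeral_Bit0 power_one_right)+
    qed
    then have "4 * (2 ^ (m - 2) * (u' - v')) = 4 * (2 ^ (l - 2) * d')"
      using assms(1-3) by (simp add: algebra_simps)
    then show "2 ^ (m - 2) * (u' - v') = 2 ^ (l - 2) * d'" by simp
    show "32 * 2 ^ (l - 2) * 2 ^ (m - 2) dvd 3 * th - 1" unfolding W by (rule th)
  qed (use odds W in auto)
qed

text \<open>The predicate \<open>L\<close> hides the model. What is kept of the lattice is that it
  separates powers of each generator and points of the box, and absorbs multiples of the
  moduli.\<close>

lemma Grp_separation:
  fixes \<alpha> \<beta> u' v' d' :: int
  assumes ab: "\<alpha> = 1 + 2 ^ m * u'" "\<beta> = 1 + 2 ^ m * v'" "\<alpha> - \<beta> = 2 ^ l * d'"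
    and odds: "odd u'" "odd v'" "odd d'" and m: "3 \<le> m" "m < l" "l + 3 \<le> 2 * m" "3 * m < 2 * l + 1"
  obtains L :: "int \<Rightarrow> int \<Rightarrow> int \<Rightarrow> bool" where
    "\<And>i k j i' k' j'. genA \<alpha> \<beta> [^]\<^bsub>Grp \<alpha> \<beta>\<^esub> (i::int) \<otimes>\<^bsub>Grp \<alpha> \<beta>\<^esub> (genC \<alpha> \<beta> [^]\<^bsub>Grp \<alpha> \<beta>\<^esub> (k::int) \<otimes>\<^bsub>Grp \<alpha> \<beta>\<^esub> genB \<alpha> \<beta> [^]\<^bsub>Grp \<alpha> \<beta>\<^esub> (j::int))
      = genA \<alpha> \<beta> [^]\<^bsub>Grp \<alpha> \<beta>\<^esub> (i'::int) \<otimes>\<^bsub>Grp \<alpha> \<beta>\<^esub> (genC \<alpha> \<beta> [^]\<^bsub>Grp \<alpha> \<beta>\<^esub> (k'::int) \<otimes>\<^bsub>Grp \<alpha> \<beta>\<^esub> genB \<alpha> \<beta> [^]\<^bsub>Grp \<alpha> \<beta>\<^esub> (j'::int))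
      \<Longrightarrow> L (i - i') (k' - k) (j - j')"
    "\<And>x. L x 0 0 \<Longrightarrow> 2 ^ (l + m + 1) dvd x" "\<And>y. L 0 y 0 \<Longrightarrow> 2 ^ (2 * m) dvd y" "\<And>z. L 0 0 z \<Longrightarrow> 2 ^ (l + m + 1) dvd z"
    "\<And>x y z. L x y z \<Longrightarrow> \<bar>x\<bar> < 2 ^ (2 * m - 1) \<Longrightarrow> \<bar>y\<bar> < 2 ^ (2 * m) \<Longrightarrow> \<bar>z\<bar> < 2 ^ (l + m) \<Longrightarrow> x = 0 \<and> y = 0 \<and> z = 0"
    "\<And>x y z x' y' z'. L x y z \<Longrightarrow> 2 ^ (l + m + 1) dvd x' - x \<Longrightarrow> 2 ^ (2 * m) dvd y' - y \<Longrightarrow> 2 ^ (l + m + 1) dvd z' - z \<Longrightarrow> L x' y' z'"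
proof -
  let ?e = "2 ^ (m - 2) :: int" and ?D = "2 ^ (l - 2) :: int"
  obtain th where "model ?e ?D u' v' d' th (l + m + 1)" by (rule model_exists[OF ab odds m(1-3)])
  then interpret mo: model ?e ?D u' v' d' th "l + m + 1" .
  have four: "(4::int) * 2 ^ (m - 2) = 2 ^ m" "(4::int) * 2 ^ (l - 2) = 2 ^ l"
  proof -
    have "m = 2 + (m - 2)" "l = 2 + (l - 2)" using m by simp_all
    then show "(4::int) * 2 ^ (m - 2) = 2 ^ m" "(4::int) * 2 ^ (l - 2) = 2 ^ l"
      by (metis power_add power2_eq_square mult_2 numeral_Bit0 power_one_right)+
  qed
  have sq: "((2::int) ^ m)\<^sup>2 = 2 ^ (2 * m)" by (metis mult.commute power_mult)
  have W: "mo.W = 2 ^ (l + m + 1)" using mo.W_pow unfolding mo.W_def .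
  have w: "mo.w = 2 ^ (l + m)" using W mo.dvd_basics(7) by simp
  have "mo.V = (4 * 2 ^ (m - 2))\<^sup>2" unfolding mo.V_def by (simp add: power_mult_distrib)
  then have V: "mo.V = 2 ^ (2 * m)" unfolding four sq .
  have V1: "mo.V1 = 2 ^ (2 * m - 1)"
  proof -
    have "2 * m = Suc (2 * m - 1)" using m by simp
    then have "(2::int) ^ (2 * m) = 2 * 2 ^ (2 * m - 1)" by (metis power_Suc)
    then show ?thesis using V mo.dvd_basics(8) by simp
  qed
  have al: "1 + 4 * mo.h = \<alpha>" "1 + 4 * mo.g = \<beta>"
    unfolding mo.h_def mo.g_def ab(1,2) using four by (simp_all flip: mult.assoc)
  have ed: "2 * ?e ^ 3 dvd ?D\<^sup>2"
  proof -
    have "2 * ?e ^ 3 = 2 ^ (1 + (m - 2) * 3)" "?D\<^sup>2 = 2 ^ ((l - 2) * 2)" by (simp_all add: power_mult)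
    moreover have "1 + (m - 2) * 3 \<le> (l - 2) * 2" using m by simp
    ultimately show ?thesis by (simp only: le_imp_power_dvd)
  qed
  show thesis
  proof (rule that[of mo.inL])
    fix i k j i' k' j' :: int
    assume "genA \<alpha> \<beta> [^]\<^bsub>Grp \<alpha> \<beta>\<^esub> i \<otimes>\<^bsub>Grp \<alpha> \<beta>\<^esub> (genC \<alpha> \<beta> [^]\<^bsub>Grp \<alpha> \<beta>\<^esub> k \<otimes>\<^bsub>Grp \<alpha> \<beta>\<^esub> genB \<alpha> \<beta> [^]\<^bsub>Grp \<alpha> \<beta>\<^esub> j)
      = genA \<alpha> \<beta> [^]\<^bsub>Grp \<alpha> \<beta>\<^esub> i' \<otimes>\<^bsub>Grp \<alpha> \<beta>\<^esub> (genC \<alpha> \<beta> [^]\<^bsub>Grp \<alpha> \<beta>\<^esub> k' \<otimes>\<^bsub>Grp \<alpha> \<beta>\<^esub> genB \<alpha> \<beta> [^]\<^bsub>Grp \<alpha> \<beta>\<^esub> j')"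
    then have "pres_eq (G_relators \<alpha> \<beta>) (word_pow wA i @ word_pow wC k @ word_pow wB j) (word_pow wA i' @ word_pow wC k' @ word_pow wB j')"
      by (simp add: Grp_def genA_def genB_def genC_def presented_group_int_pow presented_group_simps pres_class_eq_iff)
    then show "mo.inL (i - i') (k' - k) (j - j')" using mo.normal_form_separation unfolding al by blast
  next
    show "2 ^ (l + m + 1) dvd x" if "mo.inL x 0 0" for x using mo.inL_separation(1)[OF ed that] unfolding W .
    show "2 ^ (2 * m) dvd y" if "mo.inL 0 y 0" for y using mo.inL_separation(2)[OF ed that] unfolding V .
    show "2 ^ (l + m + 1) dvd z" if "mo.inL 0 0 z" for z using mo.inL_separation(3)[OF ed that] unfolding W .
    show "x = 0 \<and> y = 0 \<and> z = 0"
      if "mo.inL x y z" "\<bar>x\<bar> < 2 ^ (2 * m - 1)" "\<bar>y\<bar> < 2 ^ (2 * m)" "\<bar>z\<bar> < 2 ^ (l + m)" for x y z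
      using mo.inL_separation(4)[OF ed, unfolded V1 V w] that by blast
    show "mo.inL x' y' z'"
      if "mo.inL x y z" "2 ^ (l + m + 1) dvd x' - x" "2 ^ (2 * m) dvd y' - y" "2 ^ (l + m + 1) dvd z' - z" for x y z x' y' z'
      using mo.inL_cong[unfolded W V, OF that] .
  qed
qed

lemma int_multiplicity_decompose:
  fixes x :: int
  assumes "x \<noteq> 0" "multiplicity 2 x = m"
  obtains y where "x = 2 ^ m * y" "odd y"
proof -
  obtain y where "x = 2 ^ multiplicity 2 x * y" "odd y"
    by (rule multiplicity_decompose'[OF assms(1), of 2]) simp_all
  then show thesis using that assms(2) by simp
qed

text \<open>As \<open>P\<close> and \<open>Q\<close> commute elementwise, each relation splits into
  a \<open>P\<close>-component and a \<open>Q\<close>-component, and \<open>PQ_unique\<close>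
  extracts the former.\<close>

lemma (in two_part_decomposition) part_macdonald:
  assumes "macdonald G A B C \<alpha> \<beta>"
    and P: "a \<in> P" "b \<in> P" "c \<in> P" and Q: "a' \<in> Q" "b' \<in> Q" "c' \<in> Q"
    and eq: "A = a \<otimes> a'" "B = b \<otimes> b'" "C = c \<otimes> c'"
  shows "macdonald (G\<lparr>carrier := P\<rparr>) a b c \<alpha> \<beta>"
proof -
  interpret macdonald G A B C \<alpha> \<beta> by fact
  interpret H: group "G\<lparr>carrier := P\<rparr>" by (rule P.subgroup_is_group) (rule is_group)
  have car: "a \<in> carrier G" "b \<in> carrier G" "c \<in> carrier G" "a' \<in> carrier G" "b' \<in> carrier G" "c' \<in> carrier G"
    using P Q by auto
  have cm: "(x \<otimes> x') \<otimes> (y \<otimes> y') = (x \<otimes> y) \<otimes> (x' \<otimes> y')" if "x \<in> P" "y \<in> P" "x' \<in> Q" "y' \<in> Q" for x y x' y'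
  proof -
    have c: "x \<in> carrier G" "y \<in> carrier G" "x' \<in> carrier G" "y' \<in> carrier G" using that by auto
    have "x' \<otimes> y = y \<otimes> x'" using PQ_commute[OF that(2,3)] by simp
    then show ?thesis using c by (metis m_assoc m_closed)
  qed
  have pow: "(x \<otimes> x') [^] (i::int) = x [^] i \<otimes> x' [^] i" if "x \<in> P" "x' \<in> Q" for x x' i
    using that by (intro int_pow_mult_distrib PQ_commute) auto
  have powP: "x [^] (i::int) \<in> P" if "x \<in> P" for x i using that by (rule subgroup_int_pow_closed[OF P.subgroup_axioms])
  have powQ: "x [^] (i::int) \<in> Q" if "x \<in> Q" for x i using that by (rule subgroup_int_pow_closed[OF Q.subgroup_axioms])
  have 1: "a \<otimes> b = b \<otimes> a \<otimes> c"
  proof (rule PQ_unique(1)[of "a \<otimes> b" "a' \<otimes> b'" "b \<otimes> a \<otimes> c" "b' \<otimes> a' \<otimes> c'"])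
    show "a \<otimes> b \<otimes> (a' \<otimes> b') = b \<otimes> a \<otimes> c \<otimes> (b' \<otimes> a' \<otimes> c')"
    proof -
      have "a \<otimes> b \<otimes> (a' \<otimes> b') = A \<otimes> B" unfolding eq by (rule cm[symmetric]) (use P Q in auto)
      also have "\<dots> = (b \<otimes> b') \<otimes> (a \<otimes> a') \<otimes> (c \<otimes> c')" using AB unfolding eq .
      also have "(b \<otimes> b') \<otimes> (a \<otimes> a') = (b \<otimes> a) \<otimes> (b' \<otimes> a')" by (rule cm) (use P Q in auto)
      also have "\<dots> \<otimes> (c \<otimes> c') = b \<otimes> a \<otimes> c \<otimes> (b' \<otimes> a' \<otimes> c')" by (rule cm) (use P Q in auto)
      finally show ?thesis .
    qed
  qed (use P Q in auto)
  have 2: "a \<otimes> c = c \<otimes> a [^] \<alpha>"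
  proof (rule PQ_unique(1)[of "a \<otimes> c" "a' \<otimes> c'" "c \<otimes> a [^] \<alpha>" "c' \<otimes> a' [^] \<alpha>"])
    show "a \<otimes> c \<otimes> (a' \<otimes> c') = c \<otimes> a [^] \<alpha> \<otimes> (c' \<otimes> a' [^] \<alpha>)"
    proof -
      have "a \<otimes> c \<otimes> (a' \<otimes> c') = A \<otimes> C" unfolding eq by (rule cm[symmetric]) (use P Q in auto)
      also have "\<dots> = (c \<otimes> c') \<otimes> (a [^] \<alpha> \<otimes> a' [^] \<alpha>)" using AC pow[OF P(1) Q(1)] unfolding eq by simp
      also have "\<dots> = c \<otimes> a [^] \<alpha> \<otimes> (c' \<otimes> a' [^] \<alpha>)" by (rule cm) (use P Q powP powQ in auto)
      finally show ?thesis .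
    qed
  qed (use P Q powP powQ in auto)
  have 3: "c \<otimes> b = b [^] \<beta> \<otimes> c"
  proof (rule PQ_unique(1)[of "c \<otimes> b" "c' \<otimes> b'" "b [^] \<beta> \<otimes> c" "b' [^] \<beta> \<otimes> c'"])
    show "c \<otimes> b \<otimes> (c' \<otimes> b') = b [^] \<beta> \<otimes> c \<otimes> (b' [^] \<beta> \<otimes> c')"
    proof -
      have "c \<otimes> b \<otimes> (c' \<otimes> b') = C \<otimes> B" unfolding eq by (rule cm[symmetric]) (use P Q in auto)
      also have "\<dots> = (b [^] \<beta> \<otimes> b' [^] \<beta>) \<otimes> (c \<otimes> c')" using CB pow[OF P(2) Q(2)] unfolding eq by simp
      also have "\<dots> = b [^] \<beta> \<otimes> c \<otimes> (b' [^] \<beta> \<otimes> c')" by (rule cm) (use P Q powP powQ in auto)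
      finally show ?thesis .
    qed
  qed (use P Q powP powQ in auto)
  show ?thesis
    by unfold_locales
      (use P 1 2 3 in \<open>auto simp: int_pow_consistent[OF P.subgroup_axioms, symmetric]\<close>)
qed

text \<open>The same large multiple \<open>z\<close> of \<open>2 ^ T\<close> is added to both
  exponents: they become larger than 1, the powers of \<open>A\<close> and \<open>B\<close> and the
  difference \<open>\<alpha> - \<beta>\<close> are unchanged, and \<open>u'\<close>,
  \<open>v'\<close> change by even numbers.\<close>

lemma (in macdonald) macdonald2_exists:
  fixes u' v' d' :: int
  assumes A_ord: "A [^] ((2::int) ^ t) = \<one>" and B_ord: "B [^] ((2::int) ^ t) = \<one>"
    and C_ord: "C [^] ((2::int) ^ t) = \<one>"
    and ab: "\<alpha> = 1 + 2 ^ m * u'" "\<beta> = 1 + 2 ^ m * v'" "\<alpha> - \<beta> = 2 ^ l * d'"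
    and odds: "odd u'" "odd v'" "odd d'" and m: "3 \<le> m" "m < l" "l + 3 \<le> 2 * m" "3 * m < 2 * l + 1"
  obtains \<alpha>1 \<beta>1 u1 v1 where "macdonald2t G A B C \<alpha>1 \<beta>1 m l (3 * m - 1) u1 v1 d'"
proof -
  define T where "T = m + (1 + (t + 2 * m))"
  define s where "s = \<bar>\<alpha>\<bar> + \<bar>\<beta>\<bar> + 2"
  define z where "z = 2 ^ T * s"
  have T: "(2::int) ^ T = 2 ^ m * (2 * 2 ^ (t + 2 * m))" unfolding T_def power_add by simp
  have tT: "(2::int) ^ t dvd 2 ^ T" unfolding T_def by (intro le_imp_power_dvd) simp
  have lift: "x [^] ((2::int) ^ T) = \<one>" if "x \<in> carrier G" "x [^] ((2::int) ^ t) = \<one>" for x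
    using int_pow_cong_mod[OF that, of "2 ^ T" 0] tT by simp
  have zT: "2 ^ T dvd z" by (simp add: z_def)
  have "z \<ge> s" unfolding z_def s_def by (simp add: mult_le_cancel_right1)
  then have pos: "\<alpha> + z > 1" "\<beta> + z > 1" unfolding s_def by linarith+
  have m1: "macdonald G A B C (\<alpha> + z) (\<beta> + z)"
  proof (rule change_exponents)
    show "A [^] (\<alpha> + z) = A [^] \<alpha>" using int_pow_cong_mod[OF A lift[OF A A_ord], of "\<alpha> + z" \<alpha>] zT by simp
    show "B [^] (\<beta> + z) = B [^] \<beta>" using int_pow_cong_mod[OF B lift[OF B B_ord], of "\<beta> + z" \<beta>] zT by simp
  qed
  let ?k = "2 * (2 ^ (t + 2 * m) * s)"
  interpret m2: macdonald2 G A B C "\<alpha> + z" "\<beta> + z" m l T "u' + ?k" "v' + ?k" d'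
  proof (intro macdonald2.intro m1 macdonald2_axioms.intro)
    show "\<alpha> + z = 1 + 2 ^ m * (u' + ?k)" "\<beta> + z = 1 + 2 ^ m * (v' + ?k)"
      unfolding z_def T ab(1,2) by (simp_all add: algebra_simps)
  qed (use lift A_ord B_ord C_ord pos ab odds m in \<open>auto simp: T_def\<close>)
  have "macdonald2t G A B C (\<alpha> + z) (\<beta> + z) m l (3 * m - 1) (u' + ?k) (v' + ?k) d'"
    by (intro macdonald2t.intro m2.improved macdonald2t_axioms.intro HOL.refl)
  then show thesis by (rule that)
qed

theorem theorem16p4:
  fixes \<alpha> \<beta> :: int and m l :: nat
  assumes "\<alpha> \<noteq> 1" and "\<beta> \<noteq> 1"
    and "multiplicity 2 (\<alpha> - 1) = m" and "multiplicity 2 (\<beta> - 1) = m" and "m \<ge> 3"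
    and "multiplicity 2 (\<alpha> - \<beta>) = l"
    and "m < l" and "l \<le> 2 * m - 3" and "2 * l + 2 > 3 * m + 1"
  shows "card (sylow2_set (Grp \<alpha> \<beta>)) = 2 ^ (5 * m + l - 1)
    \<and> has_nilpotency_class ((Grp \<alpha> \<beta>)\<lparr>carrier := sylow2_set (Grp \<alpha> \<beta>)\<rparr>) 5
    \<and> group.ord (Grp \<alpha> \<beta>) (proj2 (Grp \<alpha> \<beta>) (genA \<alpha> \<beta>)) = 2 ^ (l + m + 1)
    \<and> group.ord (Grp \<alpha> \<beta>) (proj2 (Grp \<alpha> \<beta>) (genB \<alpha> \<beta>)) = 2 ^ (l + m + 1)
    \<and> group.ord (Grp \<alpha> \<beta>) (proj2 (Grp \<alpha> \<beta>) (genC \<alpha> \<beta>)) = 2 ^ (2 * m)"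
proof -
  have lm: "3 \<le> m" "m < l" "l + 3 \<le> 2 * m" "3 * m < 2 * l + 1" using assms by simp_all
  obtain u' where u': "\<alpha> - 1 = 2 ^ m * u'" "odd u'"
    using int_multiplicity_decompose[of "\<alpha> - 1" m] assms by auto
  obtain v' where v': "\<beta> - 1 = 2 ^ m * v'" "odd v'"
    using int_multiplicity_decompose[of "\<beta> - 1" m] assms by auto
  have "\<alpha> - \<beta> \<noteq> 0" using assms(6,7) by (metis multiplicity_zero not_less_zero)
  then obtain d' where d': "\<alpha> - \<beta> = 2 ^ l * d'" "odd d'"
    using int_multiplicity_decompose[of "\<alpha> - \<beta>" l] assms(6) by auto
  have ab: "\<alpha> = 1 + 2 ^ m * u'" "\<beta> = 1 + 2 ^ m * v'" using u' v' by simp_all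
  note sep_facts = ab d'(1) u'(2) v'(2) d'(2) lm
  define G where "G = Grp \<alpha> \<beta>"
  define A where "A = genA \<alpha> \<beta>"
  define B where "B = genB \<alpha> \<beta>"
  define C where "C = genC \<alpha> \<beta>"
  interpret M: macdonald G A B C \<alpha> \<beta>
    unfolding G_def A_def B_def C_def by (rule macdonald_Grp)
  interpret sw: macdonald G B A "inv\<^bsub>G\<^esub> C" \<beta> \<alpha> by (rule M.swapped)
  have nz: "x \<noteq> 0" "x \<noteq> -1" if "x = 1 + 2 ^ m * y" for x y :: int
  proof -
    have "(2::int) ^ 2 dvd 2 ^ m" using lm(1) by (intro le_imp_power_dvd) simp
    then have "4 dvd 2 ^ m * y" by simp
    then have "4 dvd x - 1" using that by simp
    then show "x \<noteq> 0" "x \<noteq> -1" by auto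
  qed
  have ord_A: "group.ord G A > 0" by (rule M.ord_A_pos) (use nz[OF ab(1)] assms(1) in auto)
  have ord_B: "group.ord G B > 0" by (rule sw.ord_A_pos) (use nz[OF ab(2)] assms(2) in auto)
  have gen: "carrier G = generate G {A, B}" unfolding G_def A_def B_def by (rule Grp_generated)
  obtain P Q e t n where dec: "two_part_decomposition G P Q e"
    and aP: "A [^]\<^bsub>G\<^esub> int n \<in> P" "B [^]\<^bsub>G\<^esub> int n \<in> P" "C [^]\<^bsub>G\<^esub> int n \<in> P"
    and aQ: "A [^]\<^bsub>G\<^esub> (1 - int n) \<in> Q" "B [^]\<^bsub>G\<^esub> (1 - int n) \<in> Q" "C [^]\<^bsub>G\<^esub> (1 - int n) \<in> Q"
    and a_ord: "(A [^]\<^bsub>G\<^esub> int n) [^]\<^bsub>G\<^esub> (2 ^ t :: nat) = \<one>\<^bsub>G\<^esub>" "(B [^]\<^bsub>G\<^esub> int n) [^]\<^bsub>G\<^esub> (2 ^ t :: nat) = \<one>\<^bsub>G\<^esub>"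
      "(C [^]\<^bsub>G\<^esub> int n) [^]\<^bsub>G\<^esub> (2 ^ t :: nat) = \<one>\<^bsub>G\<^esub>"
    and bca: "\<And>g. g \<in> P \<Longrightarrow> \<exists>(i::int) (j::int) (k::int).
       g = (B [^]\<^bsub>G\<^esub> int n) [^]\<^bsub>G\<^esub> i \<otimes>\<^bsub>G\<^esub> ((C [^]\<^bsub>G\<^esub> int n) [^]\<^bsub>G\<^esub> j \<otimes>\<^bsub>G\<^esub> (A [^]\<^bsub>G\<^esub> int n) [^]\<^bsub>G\<^esub> k)"
    by (rule M.two_part_decomposition_exists[OF ord_A ord_B gen]) (rule that; assumption)
  interpret D: two_part_decomposition G P Q e by (rule dec)
  define a where "a = A [^]\<^bsub>G\<^esub> int n"
  define b where "b = B [^]\<^bsub>G\<^esub> int n"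
  define c where "c = C [^]\<^bsub>G\<^esub> int n"
  note abc = a_def[symmetric] b_def[symmetric] c_def[symmetric]
  note aP = aP[unfolded abc] and a_ord = a_ord[unfolded abc] and bca = bca[unfolded abc]
  have abc_car: "a \<in> carrier G" "b \<in> carrier G" "c \<in> carrier G" by (simp_all add: a_def b_def c_def)
  have split: "x = x [^]\<^bsub>G\<^esub> int n \<otimes>\<^bsub>G\<^esub> x [^]\<^bsub>G\<^esub> (1 - int n)" if "x \<in> carrier G" for x
    using that by (simp flip: M.int_pow_mult)
  have A_split: "A = a \<otimes>\<^bsub>G\<^esub> A [^]\<^bsub>G\<^esub> (1 - int n)" and B_split: "B = b \<otimes>\<^bsub>G\<^esub> B [^]\<^bsub>G\<^esub> (1 - int n)"
    and C_split: "C = c \<otimes>\<^bsub>G\<^esub> C [^]\<^bsub>G\<^esub> (1 - int n)"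
    unfolding a_def b_def c_def by (rule split; simp)+
  have proj: "proj2 G A = a" "proj2 G B = b" "proj2 G C = c"
    using D.proj2_eq[OF aP(1) aQ(1)] D.proj2_eq[OF aP(2) aQ(2)] D.proj2_eq[OF aP(3) aQ(3)]
    unfolding A_split[symmetric] B_split[symmetric] C_split[symmetric] .
  define H where "H = G\<lparr>carrier := P\<rparr>"
  have Hpow: "x [^]\<^bsub>H\<^esub> (i::int) = x [^]\<^bsub>G\<^esub> i" if "x \<in> P" for x i
    unfolding H_def using M.int_pow_consistent[OF D.P.subgroup_axioms that] by simp
  have Hs: "carrier H = P" "x \<otimes>\<^bsub>H\<^esub> y = x \<otimes>\<^bsub>G\<^esub> y" "\<one>\<^bsub>H\<^esub> = \<one>\<^bsub>G\<^esub>" for x y by (simp_all add: H_def)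
  interpret mH: macdonald H a b c \<alpha> \<beta>
    unfolding H_def by (rule D.part_macdonald[OF M.macdonald_axioms aP aQ A_split B_split C_split])
  have ord2: "x [^]\<^bsub>H\<^esub> ((2::int) ^ t) = \<one>\<^bsub>H\<^esub>" if "x \<in> P" "x [^]\<^bsub>G\<^esub> (2 ^ t :: nat) = \<one>\<^bsub>G\<^esub>" for x
    using that int_pow_int[of G x "2 ^ t"] by (simp add: Hpow Hs)
  obtain \<alpha>1 \<beta>1 u1 v1 where "macdonald2t H a b c \<alpha>1 \<beta>1 m l (3 * m - 1) u1 v1 d'"
    by (rule mH.macdonald2_exists[OF ord2[OF aP(1) a_ord(1)] ord2[OF aP(2) a_ord(2)] ord2[OF aP(3) a_ord(3)] sep_facts])
  then interpret N: macdonald2t H a b c \<alpha>1 \<beta>1 m l "3 * m - 1" u1 v1 d' .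
  have bcaH: "\<exists>(i::int) (j::int) (k::int). g = b [^]\<^bsub>H\<^esub> i \<otimes>\<^bsub>H\<^esub> (c [^]\<^bsub>H\<^esub> j \<otimes>\<^bsub>H\<^esub> a [^]\<^bsub>H\<^esub> k)" if "g \<in> carrier H" for g
    using bca that aP by (simp add: Hpow Hs)
  have genH: "carrier H = generate H {a, b}"
  proof
    let ?S = "generate H {a, b}"
    have S: "subgroup ?S H" by (rule mH.generate_is_subgroup) simp
    have "a \<in> ?S" "b \<in> ?S" by (auto intro: generate.incl)
    moreover have "comm H a b \<in> ?S"
      unfolding comm_def using calculation S by (meson subgroup.m_closed subgroup.m_inv_closed)
    then have "c \<in> ?S" by (simp add: N.comm_A_B)
    ultimately show "carrier H \<subseteq> ?S"
      using bcaH mH.subgroup_int_pow_closed[OF S] subgroup.m_closed[OF S] by (metis subsetI)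
    show "?S \<subseteq> carrier H" by (rule mH.generate_incl) simp
  qed
  obtain L :: "int \<Rightarrow> int \<Rightarrow> int \<Rightarrow> bool" where
    L: "\<And>i k j i' k' j'. A [^]\<^bsub>G\<^esub> (i::int) \<otimes>\<^bsub>G\<^esub> (C [^]\<^bsub>G\<^esub> (k::int) \<otimes>\<^bsub>G\<^esub> B [^]\<^bsub>G\<^esub> (j::int))
      = A [^]\<^bsub>G\<^esub> (i'::int) \<otimes>\<^bsub>G\<^esub> (C [^]\<^bsub>G\<^esub> (k'::int) \<otimes>\<^bsub>G\<^esub> B [^]\<^bsub>G\<^esub> (j'::int)) \<Longrightarrow> L (i - i') (k' - k) (j - j')"
    and Lx: "\<And>x. L x 0 0 \<Longrightarrow> 2 ^ (l + m + 1) dvd x" and Ly: "\<And>y. L 0 y 0 \<Longrightarrow> 2 ^ (2 * m) dvd y"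
    and Lz: "\<And>z. L 0 0 z \<Longrightarrow> 2 ^ (l + m + 1) dvd z"
    and Lsmall: "\<And>x y z. L x y z \<Longrightarrow> \<bar>x\<bar> < 2 ^ (2 * m - 1) \<Longrightarrow> \<bar>y\<bar> < 2 ^ (2 * m) \<Longrightarrow> \<bar>z\<bar> < 2 ^ (l + m) \<Longrightarrow> x = 0 \<and> y = 0 \<and> z = 0"
    and Lcong: "\<And>x y z x' y' z'. L x y z \<Longrightarrow> 2 ^ (l + m + 1) dvd x' - x \<Longrightarrow> 2 ^ (2 * m) dvd y' - y \<Longrightarrow> 2 ^ (l + m + 1) dvd z' - z \<Longrightarrow> L x' y' z'"
    by (rule Grp_separation[OF sep_facts, folded G_def A_def B_def C_def]) (rule that; assumption)
  have A1: "2 ^ (l + m + 1) dvd i" if "A [^]\<^bsub>G\<^esub> (i::int) = \<one>\<^bsub>G\<^esub>" for i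
    using L[of i 0 0 0 0 0] that Lx by simp
  have B1: "2 ^ (l + m + 1) dvd i" if "B [^]\<^bsub>G\<^esub> (i::int) = \<one>\<^bsub>G\<^esub>" for i
    using L[of 0 0 i 0 0 0] that Lz by simp
  have C1: "2 ^ (2 * m) dvd i" if "C [^]\<^bsub>G\<^esub> (i::int) = \<one>\<^bsub>G\<^esub>" for i
    using L[of 0 0 0 0 i 0] that Ly by simp
  \<comment> \<open>\<open>A^(1-n)\<close> lies in \<open>Q\<close> and has odd order, whereas only
    multiples of \<open>2^(l+m+1)\<close> kill \<open>A\<close>. So \<open>n\<close> is 1 modulo all
    moduli of \<open>L\<close>, and statements about \<open>A\<close>, \<open>B\<close>,
    \<open>C\<close> carry over to \<open>a\<close>, \<open>b\<close>, \<open>c\<close>.\<close>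
  have n1: "2 ^ (l + m + 1) dvd int n - 1"
  proof -
    let ?r = "group.ord G (A [^]\<^bsub>G\<^esub> (1 - int n))"
    have "(A [^]\<^bsub>G\<^esub> (1 - int n)) [^]\<^bsub>G\<^esub> int ?r = \<one>\<^bsub>G\<^esub>" by (simp add: int_pow_int M.pow_ord_eq_1)
    then have "A [^]\<^bsub>G\<^esub> ((1 - int n) * int ?r) = \<one>\<^bsub>G\<^esub>" by (simp add: M.int_pow_pow)
    then have "2 ^ (l + m + 1) dvd (1 - int n) * int ?r" by (rule A1)
    moreover have "coprime (2 ^ (l + m + 1)) (int ?r)" using D.ord_Q[OF aQ(1)] by simp
    ultimately have "2 ^ (l + m + 1) dvd 1 - int n" by (metis coprime_dvd_mult_left_iff)
    then show ?thesis by (metis dvd_minus_iff minus_diff_eq)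
  qed
  have "(2::int) ^ (2 * m) dvd 2 ^ (l + m + 1)" using lm by (intro le_imp_power_dvd) simp
  then have n2: "2 ^ (2 * m) dvd int n - 1" using n1 dvd_trans by blast
  have drop: "k dvd i" if "k dvd int n * i" "k dvd int n - 1" for k i
  proof -
    have "k dvd int n * i - (int n - 1) * i" using that by (intro dvd_diff) auto
    then show ?thesis by (simp add: algebra_simps)
  qed
  have a1: "2 ^ (l + m + 1) dvd i" if "a [^]\<^bsub>G\<^esub> (i::int) = \<one>\<^bsub>G\<^esub>" for i
    using that unfolding a_def by (intro drop[OF A1 n1]) (simp add: M.int_pow_pow)
  have b1: "2 ^ (l + m + 1) dvd i" if "b [^]\<^bsub>G\<^esub> (i::int) = \<one>\<^bsub>G\<^esub>" for i
    using that unfolding b_def by (intro drop[OF B1 n1]) (simp add: M.int_pow_pow)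
  have c1: "2 ^ (2 * m) dvd i" if "c [^]\<^bsub>G\<^esub> (i::int) = \<one>\<^bsub>G\<^esub>" for i
    using that unfolding c_def by (intro drop[OF C1 n2]) (simp add: M.int_pow_pow)
  have ordI: "group.ord G x = 2 ^ k"
    if x: "x \<in> carrier G" "x [^]\<^bsub>G\<^esub> ((2::int) ^ k) = \<one>\<^bsub>G\<^esub>" "\<And>i::int. x [^]\<^bsub>G\<^esub> i = \<one>\<^bsub>G\<^esub> \<Longrightarrow> 2 ^ k dvd i" for x k
  proof (rule dvd_antisym)
    have "int (group.ord G x) dvd 2 ^ k" using x(1,2) by (simp add: M.int_pow_eq_id)
    then have "int (group.ord G x) dvd int (2 ^ k)" by simp
    then show "group.ord G x dvd 2 ^ k" by (simp only: int_dvd_int_iff)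
    have "x [^]\<^bsub>G\<^esub> int (group.ord G x) = \<one>\<^bsub>G\<^esub>" using x(1) by (simp add: int_pow_int M.pow_ord_eq_1)
    from x(3)[OF this] have "int (2 ^ k) dvd int (group.ord G x)" by simp
    then show "2 ^ k dvd group.ord G x" by (simp only: int_dvd_int_iff)
  qed
  have oa: "group.ord G a = 2 ^ (l + m + 1)"
    by (rule ordI) (use abc_car a1 N.A_top aP in \<open>auto simp: Hpow Hs\<close>)
  have ob: "group.ord G b = 2 ^ (l + m + 1)"
    by (rule ordI) (use abc_car b1 N.B_top aP in \<open>auto simp: Hpow Hs\<close>)
  have oc: "group.ord G c = 2 ^ (2 * m)"
    by (rule ordI) (use abc_car c1 N.order_reduction(3) aP in \<open>auto simp: Hpow Hs\<close>)
  have class5: "has_nilpotency_class H 5"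
  proof -
    have "has_nilpotency_class H (Suc 4)"
    proof (rule mH.has_nilpotency_class_Suc)
      show "carrier H \<subseteq> mH.upper_central (Suc 4)" by (rule N.carrier_subset_upper_central[OF genH])
      show "\<exists>x\<in>lower_central H 4. x \<noteq> \<one>\<^bsub>H\<^esub>"
        by (rule N.lower_central_4_nontrivial) (use a1 aP in \<open>simp add: Hpow Hs\<close>)
    qed
    then show ?thesis by simp
  qed
  \<comment> \<open>The box of exponents is the one from \<open>normal_form\<close>; its points are
    now separated by \<open>L\<close>, so the upper bound is attained.\<close>
  have "card P \<ge> 2 ^ (5 * m + l - 1)"
  proof -
    let ?S = "{0..<2 ^ (2 * m - 1)} \<times> {0..<2 ^ (2 * m)} \<times> {0..<2 ^ (l + m)} :: (int \<times> int \<times> int) set"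
    let ?f = "\<lambda>(i, k, j). a [^]\<^bsub>G\<^esub> i \<otimes>\<^bsub>G\<^esub> (c [^]\<^bsub>G\<^esub> k \<otimes>\<^bsub>G\<^esub> b [^]\<^bsub>G\<^esub> j)"
    have "inj_on ?f ?S"
    proof (rule inj_onI)
      fix x y assume xy: "x \<in> ?S" "y \<in> ?S" "?f x = ?f y"
      obtain i k j where x: "x = (i, k, j)" by (rule prod_cases3)
      obtain i' k' j' where y: "y = (i', k', j')" by (rule prod_cases3)
      have r: "i \<in> {0..<2 ^ (2 * m - 1)}" "k \<in> {0..<2 ^ (2 * m)}" "j \<in> {0..<2 ^ (l + m)}"
        "i' \<in> {0..<2 ^ (2 * m - 1)}" "k' \<in> {0..<2 ^ (2 * m)}" "j' \<in> {0..<2 ^ (l + m)}"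
        and eq: "a [^]\<^bsub>G\<^esub> i \<otimes>\<^bsub>G\<^esub> (c [^]\<^bsub>G\<^esub> k \<otimes>\<^bsub>G\<^esub> b [^]\<^bsub>G\<^esub> j) = a [^]\<^bsub>G\<^esub> i' \<otimes>\<^bsub>G\<^esub> (c [^]\<^bsub>G\<^esub> k' \<otimes>\<^bsub>G\<^esub> b [^]\<^bsub>G\<^esub> j')"
        using xy unfolding x y by auto
      have "L (int n * i - int n * i') (int n * k' - int n * k) (int n * j - int n * j')"
        using eq unfolding a_def b_def c_def by (intro L) (simp add: M.int_pow_pow)
      moreover have "K dvd (x - y) - (int n * x - int n * y)" if "K dvd int n - 1" for K x y
      proof -
        have "(x - y) - (int n * x - int n * y) = (int n - 1) * (y - x)" by (simp add: algebra_simps)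
        then show ?thesis using that by simp
      qed
      ultimately have "L (i - i') (k' - k) (j - j')" using n1 n2 by (intro Lcong[of _ _ _ "i - i'"]) auto
      moreover have "\<bar>i - i'\<bar> < 2 ^ (2 * m - 1)" "\<bar>k' - k\<bar> < 2 ^ (2 * m)" "\<bar>j - j'\<bar> < 2 ^ (l + m)" using r by auto
      ultimately have "i - i' = 0 \<and> k' - k = 0 \<and> j - j' = 0" by (rule Lsmall)
      then show "x = y" unfolding x y by simp
    qed
    moreover have "?f ` ?S \<subseteq> P"
      using aP M.subgroup_int_pow_closed[OF D.P.subgroup_axioms] by auto
    ultimately have "card ?S \<le> card P" using D.finite_P by (rule card_inj_on_le)
    moreover have "card ?S = 2 ^ (2 * m - 1) * (2 ^ (2 * m) * 2 ^ (l + m))"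
      by (simp add: card_cartesian_product nat_power_eq)
    moreover have "5 * m + l - 1 = (2 * m - 1) + (2 * m + (l + m))" using lm by simp
    then have "(2::nat) ^ (5 * m + l - 1) = 2 ^ (2 * m - 1) * (2 ^ (2 * m) * 2 ^ (l + m))" by (metis power_add)
    ultimately show ?thesis by simp
  qed
  moreover have "card P \<le> 2 ^ (5 * m + l - 1)" using N.card_bound[OF bcaH] by (simp add: Hs)
  ultimately have cardP: "card P = 2 ^ (5 * m + l - 1)" by simp
  show ?thesis
    using cardP class5 oa ob oc
    unfolding G_def[symmetric] A_def[symmetric] B_def[symmetric] C_def[symmetric] proj D.sylow2_set_eq H_def
    by blast
qed

end
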